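(* Let $R$ be a local (Noetherian) ring and let $\mathbf x=x_1,\dots,x_n$ be elements of $R$. Then for any finitely generated $R$-module $M$, $$(\mathrm{Ann}_R M)^{n+1}\subseteq (\mathrm{Ann}_R(H^0_{\mathbf xR}(M)))\cdots(\mathrm{Ann}_R(H^n_{\mathbf xR}(M)))\subseteq\mathrm{Ann}_R M.$$
   Context: $R$ is commutative with non-zero identity. $\mathbf xR$ is the ideal of $R$ generated by $x_1,\dots,x_n$. For an ideal $\mathfrak a$ of $R$, $H^i_{\mathfrak a}(M)=\varinjlim_{t\ge 1}\mathrm{Ext}^i_R(R/\mathfrak a^t,M)$ is the $i$-th local cohomology module of $M$ with support in $V(\mathfrak a)=\{\mathfrak p\in\mathrm{Spec}\,R:\mathfrak p\supseteq\mathfrak a\}$. $\mathrm{Ann}_R(L)$ denotes the annihilator in $R$ of an $R$-module $L$. The middle term is the product of the $n+1$ ideals $\mathrm{Ann}_R(H^i_{\mathbf xR}(M))$, $i=0,\dots,n$.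
   Formalization: The second inclusion is stated only for x_1,...,x_n in the maximal ideal of R; for arbitrary elements it fails (R = M a field, n = 1, x_1 = 1: all local cohomology vanishes, the product is R, but Ann M = 0). The first inclusion is stated for arbitrary elements. *)

theory Defs
  imports "HOL-Algebra.Module" "HOL-Algebra.Ideal_Product" "HOL-Algebra.Ring_Divisibility"
begin

section \<open>Rings and modules\<close>

locale noetherian_local_ring = cring R + noetherian_ring R
  for R (structure) and \<mm> +
  assumes maximalideal: "maximalideal \<mm> R"
    and unique: "maximalideal J R \<Longrightarrow> J = \<mm>"

definition finitely_generated_module ::
    "('a, 'r) ring_scheme \<Rightarrow> ('a, 'b, 'm) module_scheme \<Rightarrow> bool" where
  "finitely_generated_module R M \<longleftrightarrow>
     (\<exists>A. finite A \<and> A \<subseteq> carrier M \<and>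
        (\<forall>H. submodule H R M \<and> A \<subseteq> H \<longrightarrow> H = carrier M))"

definition annihilator ::
    "('a, 'r) ring_scheme \<Rightarrow> ('a, 'b, 'm) module_scheme \<Rightarrow> 'a set" where
  "annihilator R M = {r \<in> carrier R. \<forall>m \<in> carrier M. r \<odot>\<^bsub>M\<^esub> m = \<zero>\<^bsub>M\<^esub>}"

text \<open>
  The record type of modules extends that of rings. The fields \<open>mult\<close> and \<open>one\<close> play
  no role for modules and are left undefined in the constructions below.
\<close>

definition regular_module :: "('a, 'r) ring_scheme \<Rightarrow> ('a, 'a) module" where
  "regular_module R = \<lparr>carrier = carrier R, monoid.mult = undefined, one = undefined,
     ring.zero = \<zero>\<^bsub>R\<^esub>, ring.add = (\<oplus>\<^bsub>R\<^esub>), smult = (\<otimes>\<^bsub>R\<^esub>)\<rparr>"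

definition quotient_module ::
    "('a, 'r) ring_scheme \<Rightarrow> ('a, 'b, 'm) module_scheme \<Rightarrow> 'b set \<Rightarrow> ('a, 'b set) module" where
  "quotient_module R M K = \<lparr>carrier = a_rcosets\<^bsub>M\<^esub> K, monoid.mult = undefined, one = undefined,
     ring.zero = K, ring.add = set_add M, smult = (\<lambda>r C. \<Union>x\<in>C. K +>\<^bsub>M\<^esub> (r \<odot>\<^bsub>M\<^esub> x))\<rparr>"

text \<open>
  Linear maps are extensional (\<^const>\<open>undefined\<close> off the carrier of the domain), so that
  equal maps are equal as functions.
\<close>

definition module_hom ::
    "('a, 'r) ring_scheme \<Rightarrow> ('a, 'b, 'm) module_scheme \<Rightarrow> ('a, 'c, 'k) module_scheme
      \<Rightarrow> ('b \<Rightarrow> 'c) set" where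
  "module_hom R M N = {f \<in> carrier M \<rightarrow>\<^sub>E carrier N.
     (\<forall>x \<in> carrier M. \<forall>y \<in> carrier M. f (x \<oplus>\<^bsub>M\<^esub> y) = f x \<oplus>\<^bsub>N\<^esub> f y) \<and>
     (\<forall>r \<in> carrier R. \<forall>x \<in> carrier M. f (r \<odot>\<^bsub>M\<^esub> x) = r \<odot>\<^bsub>N\<^esub> f x)}"

definition hom_module ::
    "('a, 'r) ring_scheme \<Rightarrow> ('a, 'b, 'm) module_scheme \<Rightarrow> ('a, 'c, 'k) module_scheme
      \<Rightarrow> ('a, 'b \<Rightarrow> 'c) module" where
  "hom_module R M N = \<lparr>carrier = module_hom R M N, monoid.mult = undefined, one = undefined,
     ring.zero = (\<lambda>x \<in> carrier M. \<zero>\<^bsub>N\<^esub>),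
     ring.add = (\<lambda>f g. \<lambda>x \<in> carrier M. f x \<oplus>\<^bsub>N\<^esub> g x),
     smult = (\<lambda>r f. \<lambda>x \<in> carrier M. r \<odot>\<^bsub>N\<^esub> f x)\<rparr>"

section \<open>Free modules\<close>

definition free_module :: "('a, 'r) ring_scheme \<Rightarrow> 'g set \<Rightarrow> ('a, 'g \<Rightarrow> 'a) module" where
  "free_module R B = \<lparr>carrier = {f. (\<forall>b \<in> B. f b \<in> carrier R) \<and> (\<forall>b. b \<notin> B \<longrightarrow> f b = \<zero>\<^bsub>R\<^esub>) \<and>
       finite {b. f b \<noteq> \<zero>\<^bsub>R\<^esub>}},
     monoid.mult = undefined, one = undefined,
     ring.zero = (\<lambda>_. \<zero>\<^bsub>R\<^esub>), ring.add = (\<lambda>f g b. f b \<oplus>\<^bsub>R\<^esub> g b), smult = (\<lambda>r f b. r \<otimes>\<^bsub>R\<^esub> f b)\<rparr>"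

definition free_unit :: "('a, 'r) ring_scheme \<Rightarrow> 'g \<Rightarrow> 'g \<Rightarrow> 'a" where
  "free_unit R b = (\<lambda>c. if c = b then \<one>\<^bsub>R\<^esub> else \<zero>\<^bsub>R\<^esub>)"

definition linear_extension ::
    "('a, 'r) ring_scheme \<Rightarrow> 'g set \<Rightarrow> ('a, 'b, 'm) module_scheme \<Rightarrow> ('g \<Rightarrow> 'b)
      \<Rightarrow> ('g \<Rightarrow> 'a) \<Rightarrow> 'b" where
  "linear_extension R B M \<phi> =
     (\<lambda>f \<in> carrier (free_module R B). \<Oplus>\<^bsub>M\<^esub>b \<in> {b. f b \<noteq> \<zero>\<^bsub>R\<^esub>}. f b \<odot>\<^bsub>M\<^esub> \<phi> b)"

fun formal_sum :: "('a, 'r) ring_scheme \<Rightarrow> ('a \<times> 'g) list \<Rightarrow> 'g \<Rightarrow> 'a" where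
  "formal_sum R [] = (\<lambda>_. \<zero>\<^bsub>R\<^esub>)"
| "formal_sum R ((r, b) # l) = (formal_sum R l)(b := r \<oplus>\<^bsub>R\<^esub> formal_sum R l b)"

section \<open>The canonical free resolution\<close>

text \<open>
  Every \<open>R\<close>-module \<open>N\<close> has a functorial free resolution
  \<open>\<dots> \<rightarrow> F\<^sub>2 \<rightarrow> F\<^sub>1 \<rightarrow> F\<^sub>0 \<rightarrow> N \<rightarrow> 0\<close>: the module \<open>F\<^sub>0\<close> is free on the elements of \<open>N\<close>,
  and \<open>F\<^bsub>i+1\<^esub>\<close> is free on the words \<open>(r\<^sub>1, b\<^sub>1) \<dots> (r\<^sub>k, b\<^sub>k)\<close>, with \<open>r\<^sub>j\<close> in \<open>R\<close> and
  \<open>b\<^sub>j\<close> in the basis of \<open>F\<^sub>i\<close>, for which \<open>r\<^sub>1 b\<^sub>1 + \<dots> + r\<^sub>k b\<^sub>k\<close> lies in the kernel of the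
  map out of \<open>F\<^sub>i\<close>; such a word is sent to this linear combination. Using words for the
  kernel elements keeps the bases of all \<open>F\<^sub>i\<close> in one type.
\<close>

datatype ('a, 'n) res_gen =
    Gen (res_elt: 'n)
  | Rel (res_word: "('a \<times> ('a, 'n) res_gen) list")

fun res_basis ::
    "('a, 'r) ring_scheme \<Rightarrow> ('a, 'n, 'm) module_scheme \<Rightarrow> nat \<Rightarrow> ('a, 'n) res_gen set" where
  "res_basis R N 0 = Gen ` carrier N"
| "res_basis R N (Suc 0) = Rel ` {l \<in> lists (carrier R \<times> res_basis R N 0).
     linear_extension R (res_basis R N 0) N res_elt (formal_sum R l) = \<zero>\<^bsub>N\<^esub>}"
| "res_basis R N (Suc (Suc i)) = Rel ` {l \<in> lists (carrier R \<times> res_basis R N (Suc i)).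
     linear_extension R (res_basis R N (Suc i)) (free_module R (res_basis R N i))
       (\<lambda>b. formal_sum R (res_word b)) (formal_sum R l) = \<zero>\<^bsub>free_module R (res_basis R N i)\<^esub>}"

definition res_module ::
    "('a, 'r) ring_scheme \<Rightarrow> ('a, 'n, 'm) module_scheme \<Rightarrow> nat
      \<Rightarrow> ('a, ('a, 'n) res_gen \<Rightarrow> 'a) module" where
  "res_module R N i = free_module R (res_basis R N i)"

definition res_aug ::
    "('a, 'r) ring_scheme \<Rightarrow> ('a, 'n, 'm) module_scheme \<Rightarrow> (('a, 'n) res_gen \<Rightarrow> 'a) \<Rightarrow> 'n" where
  "res_aug R N = linear_extension R (res_basis R N 0) N res_elt"

text \<open>\<open>res_diff R N i\<close> is the map from \<open>F\<^bsub>i+1\<^esub>\<close> to \<open>F\<^sub>i\<close>.\<close>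

definition res_diff ::
    "('a, 'r) ring_scheme \<Rightarrow> ('a, 'n, 'm) module_scheme \<Rightarrow> nat
      \<Rightarrow> (('a, 'n) res_gen \<Rightarrow> 'a) \<Rightarrow> ('a, 'n) res_gen \<Rightarrow> 'a" where
  "res_diff R N i = linear_extension R (res_basis R N (Suc i)) (res_module R N i)
     (\<lambda>b. formal_sum R (res_word b))"

text \<open>The chain map induced by a linear map \<open>f\<close> from \<open>N\<close> to \<open>N'\<close>.\<close>

definition res_map ::
    "('a, 'r) ring_scheme \<Rightarrow> ('a, 'n, 'm) module_scheme \<Rightarrow> ('a, 'p, 'q) module_scheme
      \<Rightarrow> ('n \<Rightarrow> 'p) \<Rightarrow> nat \<Rightarrow> (('a, 'n) res_gen \<Rightarrow> 'a) \<Rightarrow> ('a, 'p) res_gen \<Rightarrow> 'a" where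
  "res_map R N N' f i = linear_extension R (res_basis R N i) (res_module R N' i)
     (\<lambda>b. free_unit R (map_res_gen id f b))"

section \<open>Ext\<close>

definition ext_cochains ::
    "('a, 'r) ring_scheme \<Rightarrow> ('a, 'n, 'k) module_scheme \<Rightarrow> ('a, 'b, 'm) module_scheme \<Rightarrow> nat
      \<Rightarrow> ('a, (('a, 'n) res_gen \<Rightarrow> 'a) \<Rightarrow> 'b) module" where
  "ext_cochains R N M i = hom_module R (res_module R N i) M"

definition ext_diff ::
    "('a, 'r) ring_scheme \<Rightarrow> ('a, 'n, 'k) module_scheme \<Rightarrow> nat
      \<Rightarrow> ((('a, 'n) res_gen \<Rightarrow> 'a) \<Rightarrow> 'b) \<Rightarrow> (('a, 'n) res_gen \<Rightarrow> 'a) \<Rightarrow> 'b" where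
  "ext_diff R N i \<phi> = compose (carrier (res_module R N (Suc i))) \<phi> (res_diff R N i)"

definition ext_cocycles ::
    "('a, 'r) ring_scheme \<Rightarrow> ('a, 'n, 'k) module_scheme \<Rightarrow> ('a, 'b, 'm) module_scheme \<Rightarrow> nat
      \<Rightarrow> ((('a, 'n) res_gen \<Rightarrow> 'a) \<Rightarrow> 'b) set" where
  "ext_cocycles R N M i = {\<phi> \<in> carrier (ext_cochains R N M i).
     ext_diff R N i \<phi> = \<zero>\<^bsub>ext_cochains R N M (Suc i)\<^esub>}"

fun ext_coboundaries ::
    "('a, 'r) ring_scheme \<Rightarrow> ('a, 'n, 'k) module_scheme \<Rightarrow> ('a, 'b, 'm) module_scheme \<Rightarrow> nat
      \<Rightarrow> ((('a, 'n) res_gen \<Rightarrow> 'a) \<Rightarrow> 'b) set" where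
  "ext_coboundaries R N M 0 = {\<zero>\<^bsub>ext_cochains R N M 0\<^esub>}"
| "ext_coboundaries R N M (Suc i) = ext_diff R N i ` carrier (ext_cochains R N M i)"

definition Ext_module ::
    "('a, 'r) ring_scheme \<Rightarrow> ('a, 'n, 'k) module_scheme \<Rightarrow> ('a, 'b, 'm) module_scheme \<Rightarrow> nat
      \<Rightarrow> ('a, ((('a, 'n) res_gen \<Rightarrow> 'a) \<Rightarrow> 'b) set) module" where
  "Ext_module R N M i =
     quotient_module R ((ext_cochains R N M i)\<lparr>carrier := ext_cocycles R N M i\<rparr>)
       (ext_coboundaries R N M i)"

text \<open>The map from \<open>Ext\<^sup>i(N', M)\<close> to \<open>Ext\<^sup>i(N, M)\<close> induced by a linear map \<open>f\<close> from \<open>N\<close> to \<open>N'\<close>.\<close>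

definition Ext_map ::
    "('a, 'r) ring_scheme \<Rightarrow> ('a, 'n, 'k) module_scheme \<Rightarrow> ('a, 'p, 'q) module_scheme
      \<Rightarrow> ('n \<Rightarrow> 'p) \<Rightarrow> ('a, 'b, 'm) module_scheme \<Rightarrow> nat
      \<Rightarrow> ((('a, 'p) res_gen \<Rightarrow> 'a) \<Rightarrow> 'b) set \<Rightarrow> ((('a, 'n) res_gen \<Rightarrow> 'a) \<Rightarrow> 'b) set" where
  "Ext_map R N N' f M i C =
     (\<Union>\<phi>\<in>C. ext_coboundaries R N M i +>\<^bsub>ext_cochains R N M i\<^esub>
        compose (carrier (res_module R N i)) \<phi> (res_map R N N' f i))"

section \<open>Direct limits\<close>

text \<open>
  Direct limits of modules \<open>L t\<close> over a linearly ordered index set \<open>I\<close>, with transition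
  maps \<open>\<tau> t u\<close> from \<open>L t\<close> to \<open>L u\<close> for \<open>t \<le> u\<close>.
\<close>

definition direct_limit_rel ::
    "'i::linorder set \<Rightarrow> ('i \<Rightarrow> ('a, 'b, 'm) module_scheme) \<Rightarrow> ('i \<Rightarrow> 'i \<Rightarrow> 'b \<Rightarrow> 'b)
      \<Rightarrow> (('i \<times> 'b) \<times> ('i \<times> 'b)) set" where
  "direct_limit_rel I L \<tau> = {((t, x), (u, y)). t \<in> I \<and> x \<in> carrier (L t) \<and>
     u \<in> I \<and> y \<in> carrier (L u) \<and> (\<exists>s \<in> I. t \<le> s \<and> u \<le> s \<and> \<tau> t s x = \<tau> u s y)}"

definition direct_limit ::
    "'i::linorder set \<Rightarrow> ('i \<Rightarrow> ('a, 'b, 'm) module_scheme) \<Rightarrow> ('i \<Rightarrow> 'i \<Rightarrow> 'b \<Rightarrow> 'b)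
      \<Rightarrow> ('a, ('i \<times> 'b) set) module" where
  "direct_limit I L \<tau> = \<lparr>
     carrier = (SIGMA t:I. carrier (L t)) // direct_limit_rel I L \<tau>,
     monoid.mult = undefined, one = undefined,
     ring.zero = (\<Union>t\<in>I. direct_limit_rel I L \<tau> `` {(t, \<zero>\<^bsub>L t\<^esub>)}),
     ring.add = (\<lambda>C D. \<Union>(t, x)\<in>C. \<Union>(u, y)\<in>D. direct_limit_rel I L \<tau> ``
       {(max t u, \<tau> t (max t u) x \<oplus>\<^bsub>L (max t u)\<^esub> \<tau> u (max t u) y)}),
     smult = (\<lambda>r C. \<Union>(t, x)\<in>C. direct_limit_rel I L \<tau> `` {(t, r \<odot>\<^bsub>L t\<^esub> x)})\<rparr>"

section \<open>Local cohomology\<close>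

abbreviation ideal_power :: "('a, 'r) ring_scheme \<Rightarrow> 'a set \<Rightarrow> nat \<Rightarrow> 'a set" where
  "ideal_power R I t \<equiv> I [^]\<^bsub>ideals_set R\<^esub> t"

definition power_quotient :: "('a, 'r) ring_scheme \<Rightarrow> 'a set \<Rightarrow> nat \<Rightarrow> ('a, 'a set) module" where
  "power_quotient R I t = quotient_module R (regular_module R) (ideal_power R I t)"

text \<open>The projection from \<open>R/I\<^sup>u\<close> onto \<open>R/I\<^sup>t\<close> for \<open>t \<le> u\<close>, sending \<open>I\<^sup>u + r\<close> to \<open>I\<^sup>t + r\<close>.\<close>

definition power_projection :: "('a, 'r) ring_scheme \<Rightarrow> 'a set \<Rightarrow> nat \<Rightarrow> 'a set \<Rightarrow> 'a set" where
  "power_projection R I t C = (\<Union>r\<in>C. ideal_power R I t +>\<^bsub>R\<^esub> r)"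

definition local_cohomology ::
    "('a, 'r) ring_scheme \<Rightarrow> 'a set \<Rightarrow> nat \<Rightarrow> ('a, 'b, 'm) module_scheme
      \<Rightarrow> ('a, (nat \<times> ((('a, 'a set) res_gen \<Rightarrow> 'a) \<Rightarrow> 'b) set) set) module" where
  "local_cohomology R I i M = direct_limit {1..}
     (\<lambda>t. Ext_module R (power_quotient R I t) M i)
     (\<lambda>t u. Ext_map R (power_quotient R I u) (power_quotient R I t) (power_projection R I t) M i)"

section \<open>Well-definedness\<close>

text \<open>
  The facts below confirm that \<open>res_module\<close> with \<open>res_diff\<close> and \<open>res_aug\<close> is a free
  resolution (\<open>exact0\<close>, \<open>exact1\<close>, \<open>exact2\<close>), that \<open>Ext_map\<close> is a contravariant
  functor into \<open>R\<close>-modules, and that local cohomology is an \<open>R\<close>-module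
  (\<open>local_cohomology_is_module\<close>). In particular its annihilator is an ideal, so the
  products of annihilators formed in the monoid \<open>ideals_set R\<close> are genuine ideal products.
\<close>

subsection \<open>Hom and quotient modules\<close>

lemma UN_eq_const: "x \<in> A \<Longrightarrow> (\<And>y. y \<in> A \<Longrightarrow> f y = c) \<Longrightarrow> (\<Union>y\<in>A. f y) = c"
  by auto

lemma (in module) submodule_abelian_subgroup: "submodule H R M \<Longrightarrow> abelian_subgroup H M"
  by (rule abelian_subgroupI3) 
    (auto simp: abelian_group_axioms additive_subgroup_def submodule_def)

lemma (in cring) regular_module_is_module: "module R (regular_module R)"
  by (rule moduleI) (auto simp: regular_module_def intro!: abelian_groupI is_cring l_distr r_distr m_assoc a_assoc
     intro: a_comm l_neg bexI[of _ "\<ominus> _"])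

context module
begin

lemma quotient_smult:
  assumes K: "submodule K R M" and "r \<in> carrier R" "x \<in> carrier M"
  shows "r \<odot>\<^bsub>quotient_module R M K\<^esub> (K +>\<^bsub>M\<^esub> x) = K +>\<^bsub>M\<^esub> (r \<odot>\<^bsub>M\<^esub> x)"
proof -
  interpret K: abelian_subgroup K M by (rule submodule_abelian_subgroup[OF K])
  have "K +>\<^bsub>M\<^esub> (r \<odot>\<^bsub>M\<^esub> y) = K +>\<^bsub>M\<^esub> (r \<odot>\<^bsub>M\<^esub> x)" if "y \<in> K +>\<^bsub>M\<^esub> x" for y
  proof -
    from that obtain k where k: "k \<in> K" "y = k \<oplus>\<^bsub>M\<^esub> x"
      by (auto simp: a_r_coset_def')
    have kc: "k \<in> carrier M" using k K.a_subset by auto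
    have "r \<odot>\<^bsub>M\<^esub> y = r \<odot>\<^bsub>M\<^esub> k \<oplus>\<^bsub>M\<^esub> r \<odot>\<^bsub>M\<^esub> x"
      using k assms kc by (simp add: smult_r_distr)
    moreover have "r \<odot>\<^bsub>M\<^esub> k \<in> K" using submoduleE(4)[OF K] assms k by auto
    ultimately have "r \<odot>\<^bsub>M\<^esub> y \<in> K +>\<^bsub>M\<^esub> (r \<odot>\<^bsub>M\<^esub> x)" by (auto simp: a_r_coset_def')
    thus ?thesis using assms K.a_subgroup
      by (metis a_repr_independence smult_closed)
  qed
  note 1 = this
  have 2: "x \<in> K +>\<^bsub>M\<^esub> x" using assms K.a_rcos_self by auto
  have "(\<Union>y\<in>K +>\<^bsub>M\<^esub> x. K +>\<^bsub>M\<^esub> (r \<odot>\<^bsub>M\<^esub> y)) = K +>\<^bsub>M\<^esub> (r \<odot>\<^bsub>M\<^esub> x)" by (rule UN_eq_const[OF 2 1])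
  thus ?thesis by (simp add: quotient_module_def)
qed

lemma quotient_carrier: "carrier (quotient_module R M K) = (\<lambda>x. K +>\<^bsub>M\<^esub> x) ` carrier M"
  by (auto simp: quotient_module_def A_RCOSETS_def' )

lemma quotient_add:
  assumes K: "submodule K R M" and "y \<in> carrier M" "x \<in> carrier M"
  shows "(K +>\<^bsub>M\<^esub> x) \<oplus>\<^bsub>quotient_module R M K\<^esub> (K +>\<^bsub>M\<^esub> y) = K +>\<^bsub>M\<^esub> (x \<oplus>\<^bsub>M\<^esub> y)"
proof -
  interpret K: abelian_subgroup K M by (rule submodule_abelian_subgroup[OF K])
  show ?thesis using assms by (simp add: quotient_module_def K.a_rcos_sum)
qed

lemma quotient_zero: "submodule K R M \<Longrightarrow> \<zero>\<^bsub>quotient_module R M K\<^esub> = K +>\<^bsub>M\<^esub> \<zero>\<^bsub>M\<^esub>"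
  using a_coset_add_zero[of K] submoduleE(1)[of K] by (simp add: quotient_module_def)

lemma quotient_is_module:
  assumes K: "submodule K R M"
  shows "module R (quotient_module R M K)"
proof (rule moduleI[OF is_cring abelian_groupI], goal_cases)
  case (6 x)
  then obtain m where "m \<in> carrier M" "x = K +>\<^bsub>M\<^esub> m" by (auto simp: quotient_carrier)
  thus ?case
    by (intro bexI[of _ "K +>\<^bsub>M\<^esub> (\<ominus>\<^bsub>M\<^esub> m)"])
       (simp_all add: quotient_add quotient_zero K quotient_carrier M.l_neg)
qed (auto simp: quotient_carrier quotient_add quotient_smult quotient_zero K M.a_ac smult_l_distr smult_r_distr smult_assoc1)

end

lemma hom_is_module:
  assumes M: "module R M" and N: "module R N"
  shows "module R (hom_module R M N)"
proof -
  interpret M: module R M by fact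
  interpret N: module R N by fact
  have inv: "(\<lambda>x\<in>carrier M. \<ominus>\<^bsub>N\<^esub> f x) \<in> module_hom R M N" if "f \<in> module_hom R M N" for f
    using that by (auto simp: module_hom_def N.M.minus_add N.smult_r_minus PiE_def Pi_def)
  show ?thesis
  proof (rule moduleI[OF M.is_cring abelian_groupI], goal_cases)
    case (6 f)
    thus ?case using inv[of f]
      by (intro bexI[of _ "\<lambda>x\<in>carrier M. \<ominus>\<^bsub>N\<^esub> f x"])
        (auto simp: hom_module_def module_hom_def N.M.l_neg PiE_def Pi_def fun_eq_iff)
  next
    case (7 r f)
    have "r \<odot>\<^bsub>N\<^esub> (s \<odot>\<^bsub>N\<^esub> y) = s \<odot>\<^bsub>N\<^esub> (r \<odot>\<^bsub>N\<^esub> y)" if "s \<in> carrier R" "y \<in> carrier N" for s y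
      using that 7 by (metis M.R.m_comm N.smult_assoc1)
    thus ?case using 7 by (auto simp: hom_module_def module_hom_def PiE_def Pi_def N.smult_r_distr)
  qed (auto simp: hom_module_def module_hom_def PiE_def Pi_def fun_eq_iff N.M.a_ac extensional_def
         N.smult_l_distr N.smult_r_distr N.smult_assoc1)
qed

lemma free_is_module:
  fixes R (structure)
  assumes "cring R" shows "module R (free_module R B)"
proof -
  interpret cring R by fact
  have fin: "finite {b. h (f b) (g b) \<noteq> \<zero>}" if "finite {b. f b \<noteq> \<zero>}" "finite {b. g b \<noteq> \<zero>}" "h \<zero> \<zero> = \<zero>" for f g h
    by (rule finite_subset[of _ "{b. f b \<noteq> \<zero>} \<union> {b. g b \<noteq> \<zero>}"]) (use that in auto)
  have c: "f b \<in> carrier R" if "f \<in> carrier (free_module R B)" for f b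
    using that by (cases "b \<in> B") (auto simp: free_module_def)
  show ?thesis
  proof (rule moduleI[OF is_cring abelian_groupI], goal_cases)
    case (1 f g) thus ?case using fin[of f g "(\<oplus>)"] by (auto simp: free_module_def)
  next
    case (6 f)
    thus ?case using c[OF 6] fin[of f f "\<lambda>x _. \<ominus> x"]
      by (intro bexI[of _ "\<lambda>x. \<ominus> f x"])
        (auto simp: free_module_def l_neg fun_eq_iff)
  next
    case (7 r f) thus ?case using fin[of f f "\<lambda>x _. r \<otimes> x"] by (auto simp: free_module_def)
  next
    case (3 f g h) thus ?case using c[OF 3(1)] c[OF 3(2)] c[OF 3(3)]
      by (simp add: free_module_def a_ac fun_eq_iff)
  next
    case (4 f g) thus ?case using c[OF 4(1)] c[OF 4(2)]
      by (simp add: free_module_def a_ac fun_eq_iff)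
  next
    case (5 f) thus ?case using c[OF 5] by (simp add: free_module_def)
  next
    case (8 a b f) thus ?case using c[OF 8(3)] by (simp add: free_module_def l_distr)
  next
    case (9 a f g) thus ?case using c[OF 9(2)] c[OF 9(3)] by (simp add: free_module_def r_distr)
  next
    case (10 a b f) thus ?case using c[OF 10(3)] by (simp add: free_module_def m_assoc)
  next
    case (11 f) thus ?case using c[OF 11] by (simp add: free_module_def)
  qed (auto simp: free_module_def)
qed

subsection \<open>Free modules and exactness of the resolution\<close>

locale free_to = module R M for R (structure) and B :: "'g set" and M (structure) +
  fixes \<phi> assumes phi: "b \<in> B \<Longrightarrow> \<phi> b \<in> carrier M"
begin

lemma le_eq:
  assumes "f \<in> carrier (free_module R B)" "finite S" "{b. f b \<noteq> \<zero>\<^bsub>R\<^esub>} \<subseteq> S" "S \<subseteq> B"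
  shows "linear_extension R B M \<phi> f = (\<Oplus>\<^bsub>M\<^esub>b\<in>S. f b \<odot>\<^bsub>M\<^esub> \<phi> b)"
proof -
  have "(\<Oplus>\<^bsub>M\<^esub>b\<in>{b. f b \<noteq> \<zero>\<^bsub>R\<^esub>}. f b \<odot>\<^bsub>M\<^esub> \<phi> b) = (\<Oplus>\<^bsub>M\<^esub>b\<in>S. f b \<odot>\<^bsub>M\<^esub> \<phi> b)"
    by (rule M.add.finprod_mono_neutral_cong_left) (use assms phi in \<open>auto simp: free_module_def\<close>)
  thus ?thesis using assms by (simp add: linear_extension_def)
qed

lemma suppB: "f \<in> carrier (free_module R B) \<Longrightarrow> {b. f b \<noteq> \<zero>\<^bsub>R\<^esub>} \<subseteq> B \<and> finite {b. f b \<noteq> \<zero>\<^bsub>R\<^esub>}"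
  by (auto simp: free_module_def)

lemma le_hom: "linear_extension R B M \<phi> \<in> module_hom R (free_module R B) M"
  unfolding module_hom_def
proof (intro CollectI conjI ballI)
  show "linear_extension R B M \<phi> \<in> carrier (free_module R B) \<rightarrow>\<^sub>E carrier M"
    unfolding linear_extension_def
    by (auto intro!: M.finsum_closed smult_closed phi simp: free_module_def)
next
  fix f g assume fg: "f \<in> carrier (free_module R B)" "g \<in> carrier (free_module R B)"
  let ?S = "{b. f b \<noteq> \<zero>\<^bsub>R\<^esub>} \<union> {b. g b \<noteq> \<zero>\<^bsub>R\<^esub>}"
  interpret F: module R "free_module R B" by (rule free_is_module[OF is_cring])
  have S: "finite ?S" "?S \<subseteq> B" using suppB fg by auto
  have fgc: "f b \<in> carrier R" "g b \<in> carrier R" if "b \<in> B" for b using that fg by (auto simp: free_module_def)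
  have "linear_extension R B M \<phi> (f \<oplus>\<^bsub>free_module R B\<^esub> g) = (\<Oplus>\<^bsub>M\<^esub>b\<in>?S. (f b \<oplus>\<^bsub>R\<^esub> g b) \<odot>\<^bsub>M\<^esub> \<phi> b)"
  proof (subst le_eq[where S = ?S])
    show "f \<oplus>\<^bsub>free_module R B\<^esub> g \<in> carrier (free_module R B)" using fg by auto
  qed (use fg S in \<open>auto simp: free_module_def\<close>)
  also have "\<dots> = (\<Oplus>\<^bsub>M\<^esub>b\<in>?S. f b \<odot>\<^bsub>M\<^esub> \<phi> b \<oplus>\<^bsub>M\<^esub> g b \<odot>\<^bsub>M\<^esub> \<phi> b)"
    by (rule M.finsum_cong') (use S phi fgc in \<open>auto simp: smult_l_distr subset_iff\<close>)
  also have "\<dots> = (\<Oplus>\<^bsub>M\<^esub>b\<in>?S. f b \<odot>\<^bsub>M\<^esub> \<phi> b) \<oplus>\<^bsub>M\<^esub> (\<Oplus>\<^bsub>M\<^esub>b\<in>?S. g b \<odot>\<^bsub>M\<^esub> \<phi> b)"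
    by (rule M.finsum_addf) (use S fgc phi in \<open>auto simp: subset_iff\<close>)
  also have "\<dots> = linear_extension R B M \<phi> f \<oplus>\<^bsub>M\<^esub> linear_extension R B M \<phi> g"
    using fg S by (subst (1 2) le_eq[where S = ?S]) auto
  finally show "linear_extension R B M \<phi> (f \<oplus>\<^bsub>free_module R B\<^esub> g) =
     linear_extension R B M \<phi> f \<oplus>\<^bsub>M\<^esub> linear_extension R B M \<phi> g" .
next
  fix r f assume fg: "r \<in> carrier R" "f \<in> carrier (free_module R B)"
  interpret F: module R "free_module R B" by (rule free_is_module[OF is_cring])
  let ?S = "{b. f b \<noteq> \<zero>\<^bsub>R\<^esub>}"
  have S: "finite ?S" "?S \<subseteq> B" using suppB fg by auto
  have fgc: "f b \<in> carrier R" if "b \<in> B" for b using that fg by (auto simp: free_module_def)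
  have "linear_extension R B M \<phi> (r \<odot>\<^bsub>free_module R B\<^esub> f) = (\<Oplus>\<^bsub>M\<^esub>b\<in>?S. (r \<otimes>\<^bsub>R\<^esub> f b) \<odot>\<^bsub>M\<^esub> \<phi> b)"
  proof (subst le_eq[where S = ?S])
    show "r \<odot>\<^bsub>free_module R B\<^esub> f \<in> carrier (free_module R B)" using fg by auto
  qed (use fg S in \<open>auto simp: free_module_def\<close>)
  also have "\<dots> = (\<Oplus>\<^bsub>M\<^esub>b\<in>?S. r \<odot>\<^bsub>M\<^esub> (f b \<odot>\<^bsub>M\<^esub> \<phi> b))"
    by (rule M.finsum_cong') (use S phi fgc fg in \<open>auto simp: smult_assoc1 subset_iff\<close>)
  also have "\<dots> = r \<odot>\<^bsub>M\<^esub> linear_extension R B M \<phi> f"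
    using fg S phi fgc by (subst finsum_smult_ldistr[symmetric]) (auto simp: le_eq[where S = ?S] subset_iff)
  finally show "linear_extension R B M \<phi> (r \<odot>\<^bsub>free_module R B\<^esub> f) = r \<odot>\<^bsub>M\<^esub> linear_extension R B M \<phi> f" .
qed

lemma le_unit:
  assumes "b \<in> B" shows "linear_extension R B M \<phi> (free_unit R b) = \<phi> b"
proof -
  have "linear_extension R B M \<phi> (free_unit R b) = (\<Oplus>\<^bsub>M\<^esub>c\<in>{b}. free_unit R b c \<odot>\<^bsub>M\<^esub> \<phi> c)"
    by (rule le_eq) (use assms in \<open>auto simp: free_module_def free_unit_def intro: finite_subset[of _ "{b}"]\<close>)
  thus ?thesis using assms phi by (simp add: free_unit_def M.finsum_insert)
qed

end

lemma (in cring) unit_carrier: "b \<in> B \<Longrightarrow> free_unit R b \<in> carrier (free_module R B)"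
  by (auto simp: free_module_def free_unit_def intro: finite_subset[of _ "{b}"])

lemma (in cring) formal_sum_Cons:
  assumes "r \<in> carrier R" "b \<in> B" "f \<in> carrier (free_module R B)"
  shows "f(b := r \<oplus> f b) = r \<odot>\<^bsub>free_module R B\<^esub> free_unit R b \<oplus>\<^bsub>free_module R B\<^esub> f"
proof -
  have "f c \<in> carrier R" for c using assms by (cases "c \<in> B") (auto simp: free_module_def)
  thus ?thesis using assms by (auto simp: free_module_def free_unit_def fun_eq_iff)
qed

lemma (in cring) formal_sum_carrier:
  "l \<in> lists (carrier R \<times> B) \<Longrightarrow> formal_sum R l \<in> carrier (free_module R B)"
proof (induction l rule: lists.induct)
  case Nil thus ?case by (simp add: free_module_def)
next
  case (Cons p l)
  interpret F: module R "free_module R B" by (rule free_is_module[OF is_cring])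
  obtain r b where p: "p = (r, b)" by (cases p)
  show ?case using Cons p formal_sum_Cons[of r b B "formal_sum R l"] unit_carrier[of b B] by (simp del: fun_upd_apply)
qed

lemma (in cring) formal_sum_surj:
  assumes "f \<in> carrier (free_module R B)"
  shows "\<exists>l \<in> lists (carrier R \<times> B). formal_sum R l = f"
proof -
  have "finite S \<Longrightarrow> S \<subseteq> B \<Longrightarrow> (\<And>b. b \<in> B \<Longrightarrow> f b \<in> carrier R) \<Longrightarrow> (\<And>b. b \<notin> S \<Longrightarrow> f b = \<zero>)
    \<Longrightarrow> \<exists>l \<in> lists (carrier R \<times> B). formal_sum R l = f" for S and f
  proof (induction S arbitrary: f rule: finite_induct)
    case empty thus ?case by (intro bexI[of _ "[]"]) auto
  next
    case (insert b S)
    have "\<exists>l \<in> lists (carrier R \<times> B). formal_sum R l = f(b := \<zero>)"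
      by (rule insert.IH) (use insert.prems in auto)
    then obtain l where l: "l \<in> lists (carrier R \<times> B)" "formal_sum R l = f(b := \<zero>)" by auto
    show ?case
      by (rule bexI[of _ "(f b, b) # l"]) (use l insert.prems in auto)
  qed
  note aux = this
  show ?thesis by (rule aux[of "{b. f b \<noteq> \<zero>}"]) (use assms in \<open>auto simp: free_module_def\<close>)
qed

lemma hom_zero: 
  assumes "module R M" "module R N" "f \<in> module_hom R M N" shows "f \<zero>\<^bsub>M\<^esub> = \<zero>\<^bsub>N\<^esub>"
proof -
  interpret M: module R M by fact
  interpret N: module R N by fact
  have "f (\<zero>\<^bsub>R\<^esub> \<odot>\<^bsub>M\<^esub> \<zero>\<^bsub>M\<^esub>) = \<zero>\<^bsub>R\<^esub> \<odot>\<^bsub>N\<^esub> f \<zero>\<^bsub>M\<^esub>"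
    using assms(3) M.R.zero_closed M.M.zero_closed unfolding module_hom_def by blast
  moreover have "f \<zero>\<^bsub>M\<^esub> \<in> carrier N" using assms(3) unfolding module_hom_def by auto
  ultimately show ?thesis by simp
qed

lemma hom_eq_on_units:
  assumes "module R M" "f \<in> module_hom R (free_module R B) M" "g \<in> module_hom R (free_module R B) M"
    and "\<And>b. b \<in> B \<Longrightarrow> f (free_unit R b) = g (free_unit R b)"
  shows "f = g"
proof -
  interpret module R M by fact
  interpret F: module R "free_module R B" by (rule free_is_module[OF is_cring])
  note z = hom_zero[OF F.module_axioms assms(1)]
  have "f (formal_sum R l) = g (formal_sum R l)" if "l \<in> lists (carrier R \<times> B)" for l
    using that
  proof (induction l rule: lists.induct)
    case Nil
    have e: "(\<lambda>_. \<zero>\<^bsub>R\<^esub>) = \<zero>\<^bsub>free_module R B\<^esub>" by (simp add: free_module_def)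
    show ?case unfolding formal_sum.simps e using z assms(2,3) by metis
  next
    case (Cons p l)
    obtain r b where p: "p = (r, b)" by (cases p)
    have c: "formal_sum R l \<in> carrier (free_module R B)" using Cons formal_sum_carrier by auto
    show ?case using Cons p assms(2-4) c formal_sum_Cons[of r b B "formal_sum R l"] unit_carrier[of b B]
      by (simp add: module_hom_def del: fun_upd_apply)
  qed
  hence "f x = g x" if "x \<in> carrier (free_module R B)" for x using that formal_sum_surj by metis
  thus ?thesis using assms(2,3) unfolding module_hom_def by (auto intro: PiE_ext)
qed

lemma compose_hom:
  assumes "f \<in> module_hom R M N" "g \<in> module_hom R N P" "module R M"
  shows "compose (carrier M) g f \<in> module_hom R M P"
proof -
  interpret M: module R M by fact
  show ?thesis
  using assms by (auto simp: module_hom_def compose_def PiE_def Pi_def)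
qed

context module begin

lemma F_module: "module R (res_module R M i)"
  unfolding res_module_def by (rule free_is_module[OF is_cring])

lemma aug_free: "free_to R (res_basis R M 0) M res_elt"
  by unfold_locales auto

lemma aug_hom: "res_aug R M \<in> module_hom R (res_module R M 0) M"
  using free_to.le_hom[OF aug_free] by (simp add: res_aug_def res_module_def)

lemma res_basis_Suc: "res_basis R M (Suc i) \<subseteq> Rel ` lists (carrier R \<times> res_basis R M i)"
  by (cases i) auto

lemma diff_free: "free_to R (res_basis R M (Suc i)) (res_module R M i) (\<lambda>b. formal_sum R (res_word b))"
proof -
  interpret F: module R "res_module R M i" by (rule F_module)
  show ?thesis
    apply unfold_locales
    using res_basis_Suc[of i] unfolding res_module_def
    by (force intro!: formal_sum_carrier)
qed

lemma diff_hom: "res_diff R M i \<in> module_hom R (res_module R M (Suc i)) (res_module R M i)"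
  using free_to.le_hom[OF diff_free] by (simp add: res_diff_def res_module_def)

lemma exact0: "res_aug R M ` carrier (res_module R M 0) = carrier M"
proof
  show "res_aug R M ` carrier (res_module R M 0) \<subseteq> carrier M" using aug_hom by (auto simp: module_hom_def)
  have "res_aug R M (free_unit R (Gen m)) = m" if "m \<in> carrier M" for m
    unfolding res_aug_def by (subst free_to.le_unit[OF aug_free]) (use that in auto)
  moreover have "free_unit R (Gen m) \<in> carrier (res_module R M 0)" if "m \<in> carrier M" for m
    unfolding res_module_def using that by (auto intro!: unit_carrier)
  ultimately show "carrier M \<subseteq> res_aug R M ` carrier (res_module R M 0)" by force
qed

lemma res_basis_Suc0: "res_basis R M (Suc 0) = Rel ` {l \<in> lists (carrier R \<times> res_basis R M 0). res_aug R M (formal_sum R l) = \<zero>\<^bsub>M\<^esub>}"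
  by (simp add: res_aug_def)

lemma res_basis_SucSuc: "res_basis R M (Suc (Suc i)) = Rel ` {l \<in> lists (carrier R \<times> res_basis R M (Suc i)).
   res_diff R M i (formal_sum R l) = \<zero>\<^bsub>res_module R M i\<^esub>}"
  by (simp add: res_diff_def res_module_def)

lemma exact_aux:
  assumes B: "res_basis R M (Suc i) = Rel ` {l \<in> lists (carrier R \<times> res_basis R M i). d (formal_sum R l) = \<zero>\<^bsub>P\<^esub>}"
    and d: "d \<in> module_hom R (res_module R M i) P" and P: "module R P"
  shows "res_diff R M i ` carrier (res_module R M (Suc i)) = {x \<in> carrier (res_module R M i). d x = \<zero>\<^bsub>P\<^esub>}"
proof
  have dr: "res_diff R M i (free_unit R b) = formal_sum R (res_word b)" if "b \<in> res_basis R M (Suc i)" for b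
    unfolding res_diff_def by (rule free_to.le_unit[OF diff_free that])
  interpret P: module R P by fact
  interpret H: module R "hom_module R (res_module R M (Suc i)) P"
    by (rule hom_is_module[OF F_module P])
  have "compose (carrier (res_module R M (Suc i))) d (res_diff R M i) = \<zero>\<^bsub>hom_module R (res_module R M (Suc i)) P\<^esub>"
    apply (rule hom_eq_on_units[OF P, where B = "res_basis R M (Suc i)"])
    subgoal using compose_hom[OF diff_hom d F_module] by (simp add: res_module_def)
    subgoal using H.zero_closed by (simp add: hom_module_def res_module_def)
    subgoal premises b for b
    proof -
      have u: "free_unit R b \<in> carrier (res_module R M (Suc i))"
        unfolding res_module_def by (rule unit_carrier[OF b])
      have "d (formal_sum R (res_word b)) = \<zero>\<^bsub>P\<^esub>" using b unfolding B by auto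
      thus ?thesis using u by (simp add: compose_def hom_module_def dr[OF b])
    qed
    done
  note fe = fun_cong[OF this]
  have z: "d (res_diff R M i x) = \<zero>\<^bsub>P\<^esub>" if "x \<in> carrier (res_module R M (Suc i))" for x
    using fe[of x] that by (simp add: compose_def hom_module_def)
  show "res_diff R M i ` carrier (res_module R M (Suc i)) \<subseteq> {x \<in> carrier (res_module R M i). d x = \<zero>\<^bsub>P\<^esub>}"
    using z diff_hom[of i] by (auto simp: module_hom_def)
  show "{x \<in> carrier (res_module R M i). d x = \<zero>\<^bsub>P\<^esub>} \<subseteq> res_diff R M i ` carrier (res_module R M (Suc i))"
  proof safe
    fix x assume x: "x \<in> carrier (res_module R M i)" "d x = \<zero>\<^bsub>P\<^esub>"
    then obtain l where l: "l \<in> lists (carrier R \<times> res_basis R M i)" "formal_sum R l = x"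
      using formal_sum_surj[of x] unfolding res_module_def by auto
    have b: "Rel l \<in> res_basis R M (Suc i)" using l x by (auto simp: B)
    show "x \<in> res_diff R M i ` carrier (res_module R M (Suc i))"
      by (rule image_eqI[of _ _ "free_unit R (Rel l)"])
        (use dr[OF b] l b in \<open>auto simp: res_module_def intro!: unit_carrier\<close>)
  qed
qed

lemma exact1: "res_diff R M 0 ` carrier (res_module R M (Suc 0)) = {x \<in> carrier (res_module R M 0). res_aug R M x = \<zero>\<^bsub>M\<^esub>}"
  by (rule exact_aux[OF res_basis_Suc0 aug_hom module_axioms])

lemma exact2: "res_diff R M (Suc i) ` carrier (res_module R M (Suc (Suc i))) =
   {x \<in> carrier (res_module R M (Suc i)). res_diff R M i x = \<zero>\<^bsub>res_module R M i\<^esub>}"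
  by (rule exact_aux[OF res_basis_SucSuc diff_hom F_module])

end


subsection \<open>Ext modules\<close>

locale ext_pair = N?: module R N + M?: module R M for R (structure) and N (structure) and M (structure)
begin

lemma cochains_module: "module R (ext_cochains R N M i)"
  unfolding ext_cochains_def by (rule hom_is_module[OF N.F_module M.module_axioms])

lemma compose_pre_hom:
  assumes h: "h \<in> module_hom R P Q" and P: "module R P" and Q: "module R Q"
  shows "(\<lambda>\<phi>\<in>module_hom R Q M. compose (carrier P) \<phi> h) \<in> module_hom R (hom_module R Q M) (hom_module R P M)"
proof -
  interpret P: module R P by fact
  interpret Q: module R Q by fact
  interpret H: module R "hom_module R Q M" by (rule hom_is_module[OF Q M.module_axioms])
  have hc: "h x \<in> carrier Q" if "x \<in> carrier P" for x using that h by (auto simp: module_hom_def)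
  have 1: "f \<oplus>\<^bsub>hom_module R Q M\<^esub> g \<in> module_hom R Q M" if "f \<in> module_hom R Q M" "g \<in> module_hom R Q M" for f g
    using that H.M.a_closed[of f g] by (simp add: hom_module_def)
  have 2: "r \<odot>\<^bsub>hom_module R Q M\<^esub> g \<in> module_hom R Q M" if "r \<in> carrier R" "g \<in> module_hom R Q M" for r g
    using that H.smult_closed[of r g] by (simp add: hom_module_def)
  have car: "carrier (hom_module R Q M) = module_hom R Q M" for Q :: "('a, 'z, 'y) module_scheme" by (simp add: hom_module_def)
  show ?thesis
    unfolding module_hom_def[of R "hom_module R Q M"] car
    by (auto simp: 1 2 compose_hom[OF h _ P]) 
      (auto simp: hom_module_def compose_def hc fun_eq_iff)
qed

lemma ext_diff_hom: "(\<lambda>\<phi>\<in>carrier (ext_cochains R N M i). ext_diff R N i \<phi>) \<in> module_hom R (ext_cochains R N M i) (ext_cochains R N M (Suc i))"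
  using compose_pre_hom[OF N.diff_hom N.F_module N.F_module, of i]
  by (simp add: ext_cochains_def ext_diff_def[abs_def] hom_module_def)

lemma kernel_submodule:
  assumes h: "h \<in> module_hom R P Q" and P: "module R P" and Q: "module R Q"
  shows "submodule {x \<in> carrier P. h x = \<zero>\<^bsub>Q\<^esub>} R P" and "submodule (h ` carrier P) R Q"
proof -
  interpret P: module R P by fact
  interpret Q: module R Q by fact
  have hc: "h x \<in> carrier Q" if "x \<in> carrier P" for x using that h by (auto simp: module_hom_def)
  have ha: "h (x \<oplus>\<^bsub>P\<^esub> y) = h x \<oplus>\<^bsub>Q\<^esub> h y" if "x \<in> carrier P" "y \<in> carrier P" for x y using that h by (auto simp: module_hom_def)
  have hs: "h (r \<odot>\<^bsub>P\<^esub> y) = r \<odot>\<^bsub>Q\<^esub> h y" if "r \<in> carrier R" "y \<in> carrier P" for r y using that h by (auto simp: module_hom_def)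
  have hz: "h \<zero>\<^bsub>P\<^esub> = \<zero>\<^bsub>Q\<^esub>" by (rule hom_zero[OF P Q h])
  have hm: "h (\<ominus>\<^bsub>P\<^esub> y) = \<ominus>\<^bsub>Q\<^esub> h y" if "y \<in> carrier P" for y
    using that ha[of "\<ominus>\<^bsub>P\<^esub> y" y] hz hc
    by (metis P.M.a_inv_closed P.M.l_neg Q.M.minus_equality)
  show "submodule {x \<in> carrier P. h x = \<zero>\<^bsub>Q\<^esub>} R P"
    by (rule P.submoduleI) (auto simp: hz hm ha hs)
  show "submodule (h ` carrier P) R Q"
  proof (rule Q.submoduleI)
    show "\<zero>\<^bsub>Q\<^esub> \<in> h ` carrier P" using hz by (metis P.M.zero_closed imageI)
  qed (auto simp: hc hm[symmetric] ha[symmetric] hs[symmetric])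
qed

lemma cocycles_submodule: "submodule (ext_cocycles R N M i) R (ext_cochains R N M i)"
proof -
  have "ext_cocycles R N M i = {x \<in> carrier (ext_cochains R N M i).
      (\<lambda>\<phi>\<in>carrier (ext_cochains R N M i). ext_diff R N i \<phi>) x = \<zero>\<^bsub>ext_cochains R N M (Suc i)\<^esub>}"
    by (auto simp: ext_cocycles_def)
  thus ?thesis using kernel_submodule(1)[OF ext_diff_hom cochains_module cochains_module] by simp
qed

lemma coboundaries_submodule: "submodule (ext_coboundaries R N M i) R (ext_cochains R N M i)"
proof (cases i)
  case 0
  interpret C: module R "ext_cochains R N M 0" by (rule cochains_module)
  show ?thesis unfolding 0 by (rule C.submoduleI) auto
next
  case (Suc j)
  have "ext_coboundaries R N M i = (\<lambda>\<phi>\<in>carrier (ext_cochains R N M j). ext_diff R N j \<phi>) ` carrier (ext_cochains R N M j)"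
    by (auto simp: Suc)
  thus ?thesis using kernel_submodule(2)[OF ext_diff_hom cochains_module cochains_module] Suc by simp
qed

lemma res_diff_diff:
  "x \<in> carrier (res_module R N (Suc (Suc i))) \<Longrightarrow> res_diff R N i (res_diff R N (Suc i) x) = \<zero>\<^bsub>res_module R N i\<^esub>"
  using N.exact2[of i] by auto

lemma coboundaries_cocycles: "ext_coboundaries R N M i \<subseteq> ext_cocycles R N M i"
proof (cases i)
  case 0
  thus ?thesis using submodule.axioms(1)[OF cocycles_submodule[of 0]]
    by (auto simp: subgroup_def)
next
  case (Suc j)
  have "ext_diff R N (Suc j) (ext_diff R N j \<phi>) = \<zero>\<^bsub>ext_cochains R N M (Suc (Suc j))\<^esub>"
    if "\<phi> \<in> carrier (ext_cochains R N M j)" for \<phi>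
  proof -
    have p: "\<phi> \<in> module_hom R (res_module R N j) M" using that by (simp add: ext_cochains_def hom_module_def)
    have z: "\<phi> \<zero>\<^bsub>res_module R N j\<^esub> = \<zero>\<^bsub>M\<^esub>" by (rule hom_zero[OF N.F_module M.module_axioms p])
    have d: "res_diff R N (Suc j) x \<in> carrier (res_module R N (Suc j))" if "x \<in> carrier (res_module R N (Suc (Suc j)))" for x
      using that N.diff_hom[of "Suc j"] by (auto simp: module_hom_def)
    show ?thesis
      by (auto simp: ext_diff_def ext_cochains_def hom_module_def compose_def fun_eq_iff d res_diff_diff z)
  qed
  moreover have "ext_diff R N j \<phi> \<in> carrier (ext_cochains R N M (Suc j))" if "\<phi> \<in> carrier (ext_cochains R N M j)" for \<phi>
    using that ext_diff_hom[of j] by (auto simp: module_hom_def)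
  ultimately show ?thesis by (auto simp: ext_cocycles_def Suc)
qed

lemma cocycles_module: "module R ((ext_cochains R N M i)\<lparr>carrier := ext_cocycles R N M i\<rparr>)"
  by (rule submodule.submodule_is_module[OF cocycles_submodule cochains_module])

lemma coboundaries_submodule': "submodule (ext_coboundaries R N M i) R ((ext_cochains R N M i)\<lparr>carrier := ext_cocycles R N M i\<rparr>)"
proof -
  interpret C: module R "ext_cochains R N M i" by (rule cochains_module)
  interpret Z: module R "(ext_cochains R N M i)\<lparr>carrier := ext_cocycles R N M i\<rparr>" by (rule cocycles_module)
  show ?thesis
  proof (rule Z.module_incl_imp_submodule)
    show "ext_coboundaries R N M i \<subseteq> carrier (ext_cochains R N M i\<lparr>carrier := ext_cocycles R N M i\<rparr>)"
      using coboundaries_cocycles by simp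
    show "module R (ext_cochains R N M i\<lparr>carrier := ext_cocycles R N M i, carrier := ext_coboundaries R N M i\<rparr>)"
      using submodule.submodule_is_module[OF coboundaries_submodule cochains_module] by simp
  qed
qed

lemma Ext_is_module: "module R (Ext_module R N M i)"
  unfolding Ext_module_def
  by (rule module.quotient_is_module[OF cocycles_module coboundaries_submodule'])

end

subsection \<open>Functoriality of Ext in the first argument\<close>

locale linear_map = N?: module R N + N'?: module R N'
  for R (structure) and N (structure) and N' (structure) +
  fixes f
  assumes f_closed: "x \<in> carrier N \<Longrightarrow> f x \<in> carrier N'"
    and f_add: "x \<in> carrier N \<Longrightarrow> y \<in> carrier N \<Longrightarrow> f (x \<oplus>\<^bsub>N\<^esub> y) = f x \<oplus>\<^bsub>N'\<^esub> f y"
    and f_smult: "r \<in> carrier R \<Longrightarrow> x \<in> carrier N \<Longrightarrow> f (r \<odot>\<^bsub>N\<^esub> x) = r \<odot>\<^bsub>N'\<^esub> f x"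
begin

lemma f_hom: "restrict f (carrier N) \<in> module_hom R N N'"
  by (auto simp: module_hom_def f_closed f_add f_smult)

lemma f_zero: "f \<zero>\<^bsub>N\<^esub> = \<zero>\<^bsub>N'\<^esub>"
  using hom_zero[OF N.module_axioms N'.module_axioms f_hom] by simp

abbreviation "gm \<equiv> map_res_gen id f"
abbreviation "good i \<equiv> (\<forall>b \<in> res_basis R N i. gm b \<in> res_basis R N' i)"

lemma rm_free: "good i \<Longrightarrow> free_to R (res_basis R N i) (res_module R N' i) (\<lambda>b. free_unit R (gm b))"
proof -
  assume g: "good i"
  interpret F: module R "res_module R N' i" by (rule N'.F_module)
  show ?thesis
    apply unfold_locales
    using g by (auto simp: res_module_def intro!: N.R.unit_carrier)
qed

lemma rm_hom: "good i \<Longrightarrow> res_map R N N' f i \<in> module_hom R (res_module R N i) (res_module R N' i)"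
  using free_to.le_hom[OF rm_free] by (simp add: res_map_def res_module_def)

lemma rm_unit: "good i \<Longrightarrow> b \<in> res_basis R N i \<Longrightarrow> res_map R N N' f i (free_unit R b) = free_unit R (gm b)"
  unfolding res_map_def by (rule free_to.le_unit[OF rm_free])

lemma rm_sum:
  assumes g: "good i" and l: "l \<in> lists (carrier R \<times> res_basis R N i)"
  shows "res_map R N N' f i (formal_sum R l) = formal_sum R (map (map_prod id gm) l)"
    and "map (map_prod id gm) l \<in> lists (carrier R \<times> res_basis R N' i)"
  using l
proof (induction l rule: lists.induct)
  case Nil
  {
    case 1
    have "formal_sum R [] = \<zero>\<^bsub>res_module R N i\<^esub>" "formal_sum R [] = \<zero>\<^bsub>res_module R N' i\<^esub>"
      by (simp_all add: res_module_def free_module_def)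
    thus ?case using hom_zero[OF N.F_module N'.F_module rm_hom[OF g]] by simp
  next
    case 2 show ?case by simp
  }
next
  case (Cons p l)
  {
    case 1
    obtain r b where p: "p = (r, b)" by (cases p)
    have c: "formal_sum R l \<in> carrier (free_module R (res_basis R N i))" using Cons by (auto intro: N.R.formal_sum_carrier)
    have c': "formal_sum R (map (map_prod id gm) l) \<in> carrier (free_module R (res_basis R N' i))" by (rule N.R.formal_sum_carrier) (rule Cons.IH(2))
    interpret F: module R "free_module R (res_basis R N i)" by (rule free_is_module[OF N.R.is_cring])
    have rb: "r \<in> carrier R" "b \<in> res_basis R N i" "gm b \<in> res_basis R N' i" using Cons(1) p g by auto
    have m: "map (map_prod id gm) (p # l) = (r, gm b) # map (map_prod id gm) l" by (simp add: p)
    have "formal_sum R (p # l) = r \<odot>\<^bsub>res_module R N i\<^esub> free_unit R b \<oplus>\<^bsub>res_module R N i\<^esub> formal_sum R l"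
      unfolding p formal_sum.simps res_module_def by (rule N.R.formal_sum_Cons[OF rb(1,2) c])
    moreover have "formal_sum R (map (map_prod id gm) (p # l)) =
        r \<odot>\<^bsub>res_module R N' i\<^esub> free_unit R (gm b) \<oplus>\<^bsub>res_module R N' i\<^esub> formal_sum R (map (map_prod id gm) l)"
      unfolding m formal_sum.simps res_module_def by (rule N.R.formal_sum_Cons[OF rb(1,3) c'])
    moreover have "r \<odot>\<^bsub>res_module R N i\<^esub> free_unit R b \<in> carrier (res_module R N i)" "free_unit R b \<in> carrier (res_module R N i)"
      unfolding res_module_def using N.R.unit_carrier[OF rb(2)] rb by auto
    ultimately show ?case
      using rm_hom[OF g] rb c rm_unit[OF g rb(2)] Cons.IH(1)
      unfolding module_hom_def by (simp only: res_module_def mem_Collect_eq)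
  next
    case 2
    obtain r b where p: "p = (r, b)" by (cases p)
    have "map_prod id gm p \<in> carrier R \<times> res_basis R N' i" using Cons(1) g p by auto
    thus ?case unfolding list.map by (rule lists.Cons) (rule Cons.IH(2))
  }
qed

lemma chain0:
  assumes g: "good 0" and x: "x \<in> carrier (res_module R N 0)"
  shows "res_aug R N' (res_map R N N' f 0 x) = f (res_aug R N x)"
proof -
  have u: "free_unit R b \<in> carrier (res_module R N 0)" if "b \<in> res_basis R N 0" for b
    using that by (auto simp: res_module_def intro: N.R.unit_carrier)
  have "compose (carrier (res_module R N 0)) (res_aug R N') (res_map R N N' f 0) =
      compose (carrier (res_module R N 0)) (restrict f (carrier N)) (res_aug R N)"
  proof (rule hom_eq_on_units[OF N'.module_axioms, where B = "res_basis R N 0"])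
    fix b assume b: "b \<in> res_basis R N 0"
    have 1: "res_aug R N (free_unit R b) = res_elt b"
      unfolding res_aug_def by (rule free_to.le_unit[OF N.aug_free b])
    have "res_aug R N' (free_unit R (gm b)) = res_elt (gm b)"
      unfolding res_aug_def by (rule free_to.le_unit[OF N'.aug_free]) (use g b in blast)
    thus "compose (carrier (res_module R N 0)) (res_aug R N') (res_map R N N' f 0) (free_unit R b) =
      compose (carrier (res_module R N 0)) (restrict f (carrier N)) (res_aug R N) (free_unit R b)"
      using b 1 u[OF b] rm_unit[OF g b] by (auto simp: compose_def)
  qed (use compose_hom[OF rm_hom[OF g] N'.aug_hom N.F_module] compose_hom[OF N.aug_hom f_hom N.F_module]
      in \<open>simp_all add: res_module_def\<close>)
  from fun_cong[OF this, of x] x show ?thesis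
    using N.aug_hom by (auto simp: compose_def module_hom_def)
qed

lemma chain_Suc:
  assumes g: "good i" "good (Suc i)" and x: "x \<in> carrier (res_module R N (Suc i))"
  shows "res_diff R N' i (res_map R N N' f (Suc i) x) = res_map R N N' f i (res_diff R N i x)"
proof -
  have u: "free_unit R b \<in> carrier (res_module R N (Suc i))" if "b \<in> res_basis R N (Suc i)" for b
    using that by (auto simp: res_module_def intro: N.R.unit_carrier)
  have "compose (carrier (res_module R N (Suc i))) (res_diff R N' i) (res_map R N N' f (Suc i)) =
      compose (carrier (res_module R N (Suc i))) (res_map R N N' f i) (res_diff R N i)"
  proof (rule hom_eq_on_units[OF N'.F_module, where B = "res_basis R N (Suc i)"])
    fix b assume b: "b \<in> res_basis R N (Suc i)"
    have 1: "res_diff R N i (free_unit R b) = formal_sum R (res_word b)"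
      unfolding res_diff_def by (rule free_to.le_unit[OF N.diff_free b])
    obtain l where l: "b = Rel l" "l \<in> lists (carrier R \<times> res_basis R N i)" using N.res_basis_Suc b by blast
    have "res_diff R N' i (free_unit R (gm b)) = formal_sum R (res_word (gm b))"
      unfolding res_diff_def by (rule free_to.le_unit[OF N'.diff_free]) (use g b in blast)
    also have "\<dots> = res_map R N N' f i (formal_sum R l)"
      using rm_sum(1)[OF g(1) l(2)] l(1) by simp
    finally show "compose (carrier (res_module R N (Suc i))) (res_diff R N' i) (res_map R N N' f (Suc i)) (free_unit R b) =
      compose (carrier (res_module R N (Suc i))) (res_map R N N' f i) (res_diff R N i) (free_unit R b)"
      using b 1 l u[OF b] rm_unit[OF g(2) b] by (simp add: compose_def)
  qed (use compose_hom[OF rm_hom[OF g(2)] N'.diff_hom N.F_module] compose_hom[OF N.diff_hom rm_hom[OF g(1)] N.F_module]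
      in \<open>simp_all add: res_module_def\<close>)
  from fun_cong[OF this, of x] x show ?thesis by (simp add: compose_def)
qed

lemma good: "good i"
proof -
  have 0: "good 0" by (auto simp: f_closed)
  have s: "good i \<and> good (Suc i)" for i
  proof (induction i)
    case 0
    have "gm b \<in> res_basis R N' (Suc 0)" if "b \<in> res_basis R N (Suc 0)" for b
    proof -
      from that obtain l where l: "b = Rel l" "l \<in> lists (carrier R \<times> res_basis R N 0)" "res_aug R N (formal_sum R l) = \<zero>\<^bsub>N\<^esub>"
        unfolding N.res_basis_Suc0 by auto
      have "formal_sum R l \<in> carrier (res_module R N 0)" unfolding res_module_def by (rule N.R.formal_sum_carrier[OF l(2)])
      hence "res_aug R N' (formal_sum R (map (map_prod id gm) l)) = \<zero>\<^bsub>N'\<^esub>"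
        using rm_sum(1)[OF \<open>good 0\<close> l(2)] chain0[OF \<open>good 0\<close>] l(3) f_zero by metis
      thus ?thesis unfolding N'.res_basis_Suc0 using l rm_sum(2)[OF \<open>good 0\<close> l(2)] by auto
    qed
    thus ?case using \<open>good 0\<close> by blast
  next
    case (Suc i)
    hence g: "good i" "good (Suc i)" by blast+
    have "gm b \<in> res_basis R N' (Suc (Suc i))" if "b \<in> res_basis R N (Suc (Suc i))" for b
    proof -
      from that obtain l where l: "b = Rel l" "l \<in> lists (carrier R \<times> res_basis R N (Suc i))" "res_diff R N i (formal_sum R l) = \<zero>\<^bsub>res_module R N i\<^esub>"
        unfolding N.res_basis_SucSuc by auto
      have "formal_sum R l \<in> carrier (res_module R N (Suc i))" unfolding res_module_def by (rule N.R.formal_sum_carrier[OF l(2)])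
      hence "res_diff R N' i (formal_sum R (map (map_prod id gm) l)) = \<zero>\<^bsub>res_module R N' i\<^esub>"
        using rm_sum(1)[OF g(2) l(2)] chain_Suc[OF g] l(3) hom_zero[OF N.F_module N'.F_module rm_hom[OF g(1)]] by metis
      thus ?thesis unfolding N'.res_basis_SucSuc using l rm_sum(2)[OF g(2) l(2)] by auto
    qed
    thus ?case using g by blast
  qed
  show ?thesis using s by blast
qed

lemmas rm_hom' = rm_hom[OF good] and rm_unit' = rm_unit[OF good] and chain' = chain_Suc[OF good good]

end

lemma res_map_comp:
  assumes "linear_map R N N' f" "linear_map R N' N'' g" "linear_map R N N'' h"
    and h: "\<And>x. x \<in> carrier N \<Longrightarrow> h x = g (f x)"
    and x: "x \<in> carrier (res_module R N i)"
  shows "res_map R N' N'' g i (res_map R N N' f i x) = res_map R N N'' h i x"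
proof -
  interpret f: linear_map R N N' f by fact
  interpret g: linear_map R N' N'' g by fact
  interpret h: linear_map R N N'' h by fact
  have mm: "map_res_gen id g (map_res_gen id f b) = map_res_gen id h b" if "b \<in> res_basis R N i" for b
  proof -
    have "set2_res_gen b \<subseteq> carrier N" if "b \<in> res_basis R N i" for b
      using that
    proof (induction i arbitrary: b)
      case 0 thus ?case by auto
    next
      case (Suc i)
      then obtain l where l: "b = Rel l" "l \<in> lists (carrier R \<times> res_basis R N i)" using f.N.res_basis_Suc by blast
      show ?case using l Suc.IH by (fastforce simp: prod_set_defs in_lists_conv_set)
    qed
    from this[OF that] show ?thesis
      unfolding res_gen.map_comp by (intro res_gen.map_cong) (auto simp: h)
  qed
  have "compose (carrier (res_module R N i)) (res_map R N' N'' g i) (res_map R N N' f i) = res_map R N N'' h i"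
  proof (rule hom_eq_on_units[OF g.N'.F_module, where B = "res_basis R N i"])
    fix b assume b: "b \<in> res_basis R N i"
    hence "free_unit R b \<in> carrier (res_module R N i)" "map_res_gen id f b \<in> res_basis R N' i"
      using f.good by (auto simp: res_module_def intro: f.N.R.unit_carrier)
    thus "compose (carrier (res_module R N i)) (res_map R N' N'' g i) (res_map R N N' f i) (free_unit R b) =
       res_map R N N'' h i (free_unit R b)"
      using b mm by (simp add: compose_def f.rm_unit' g.rm_unit' h.rm_unit')
  qed (use compose_hom[OF f.rm_hom' g.rm_hom' f.N.F_module] h.rm_hom' in \<open>simp_all add: res_module_def\<close>)
  from fun_cong[OF this, of x] x show ?thesis by (simp add: compose_def)
qed

lemma res_map_id:
  assumes "linear_map R N N f" and h: "\<And>x. x \<in> carrier N \<Longrightarrow> f x = x"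
    and x: "x \<in> carrier (res_module R N i)"
  shows "res_map R N N f i x = x"
proof -
  interpret f: linear_map R N N f by fact
  interpret F: module R "res_module R N i" by (rule f.N.F_module)
  have mm: "map_res_gen id f b = b" if "b \<in> res_basis R N i" for b
  proof -
    have "set2_res_gen b \<subseteq> carrier N" if "b \<in> res_basis R N i" for b
      using that
    proof (induction i arbitrary: b)
      case 0 thus ?case by auto
    next
      case (Suc i)
      then obtain l where l: "b = Rel l" "l \<in> lists (carrier R \<times> res_basis R N i)" using f.N.res_basis_Suc by blast
      show ?case using l Suc.IH by (fastforce simp: prod_set_defs in_lists_conv_set)
    qed
    from this[OF that] have "map_res_gen id f b = map_res_gen id id b"
      by (intro res_gen.map_cong) (auto simp: h)
    thus ?thesis by (simp add: res_gen.map_id)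
  qed
  have "res_map R N N f i = (\<lambda>x\<in>carrier (res_module R N i). x)"
  proof (rule hom_eq_on_units[OF f.N.F_module, where B = "res_basis R N i"])
    show "(\<lambda>x\<in>carrier (res_module R N i). x) \<in> module_hom R (free_module R (res_basis R N i)) (res_module R N i)"
      using F.M.a_closed F.smult_closed by (auto simp: module_hom_def res_module_def)
    fix b assume b: "b \<in> res_basis R N i"
    hence "free_unit R b \<in> carrier (res_module R N i)"
      by (auto simp: res_module_def intro: f.N.R.unit_carrier)
    thus "res_map R N N f i (free_unit R b) = (\<lambda>x\<in>carrier (res_module R N i). x) (free_unit R b)"
      using b mm by (simp add: f.rm_unit')
  qed (use f.rm_hom' in \<open>simp_all add: res_module_def\<close>)
  thus ?thesis using x by simp
qed

lemma restrict_hom: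
  assumes h: "(\<lambda>x\<in>carrier A. g x) \<in> module_hom R A B" and A: "module R A" and B: "module R B"
  shows "x \<in> carrier A \<Longrightarrow> y \<in> carrier A \<Longrightarrow> g (x \<oplus>\<^bsub>A\<^esub> y) = g x \<oplus>\<^bsub>B\<^esub> g y"
    and "r \<in> carrier R \<Longrightarrow> x \<in> carrier A \<Longrightarrow> g (r \<odot>\<^bsub>A\<^esub> x) = r \<odot>\<^bsub>B\<^esub> g x"
    and "g \<zero>\<^bsub>A\<^esub> = \<zero>\<^bsub>B\<^esub>"
proof -
  interpret A: module R A by fact
  show "g \<zero>\<^bsub>A\<^esub> = \<zero>\<^bsub>B\<^esub>" using hom_zero[OF A B h] by simp
  show "g (x \<oplus>\<^bsub>A\<^esub> y) = g x \<oplus>\<^bsub>B\<^esub> g y" if x: "x \<in> carrier A" and y: "y \<in> carrier A"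
  proof -
    have "(\<lambda>x\<in>carrier A. g x) (x \<oplus>\<^bsub>A\<^esub> y) = (\<lambda>x\<in>carrier A. g x) x \<oplus>\<^bsub>B\<^esub> (\<lambda>x\<in>carrier A. g x) y"
      using h x y unfolding module_hom_def by blast
    thus ?thesis using x y by simp
  qed
  show "g (r \<odot>\<^bsub>A\<^esub> x) = r \<odot>\<^bsub>B\<^esub> g x" if x: "x \<in> carrier A" and r: "r \<in> carrier R"
  proof -
    have "(\<lambda>x\<in>carrier A. g x) (r \<odot>\<^bsub>A\<^esub> x) = r \<odot>\<^bsub>B\<^esub> (\<lambda>x\<in>carrier A. g x) x"
      using h x r unfolding module_hom_def by blast
    thus ?thesis using x r by simp
  qed
qed

locale ext_lin = linear_map R N N' f + M?: module R M for R (structure) and N (structure) and N' (structure) and f and M (structure)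
begin

sublocale E: ext_pair R N M ..
sublocale E': ext_pair R N' M ..

abbreviation "pull i \<phi> \<equiv> compose (carrier (res_module R N i)) \<phi> (res_map R N N' f i)"

lemma pull_hom: "(\<lambda>\<phi>\<in>carrier (ext_cochains R N' M i). pull i \<phi>) \<in> module_hom R (ext_cochains R N' M i) (ext_cochains R N M i)"
  using E.compose_pre_hom[OF rm_hom' N.F_module N'.F_module, of i]
  by (simp add: ext_cochains_def hom_module_def)

lemma pull_closed: "\<phi> \<in> carrier (ext_cochains R N' M i) \<Longrightarrow> pull i \<phi> \<in> carrier (ext_cochains R N M i)"
  using pull_hom[of i] by (auto simp: module_hom_def)

lemmas pull_lin = restrict_hom[OF pull_hom E'.cochains_module E.cochains_module]

lemma pull_add: "\<phi> \<in> carrier (ext_cochains R N' M i) \<Longrightarrow> \<psi> \<in> carrier (ext_cochains R N' M i) \<Longrightarrow>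
   pull i (\<phi> \<oplus>\<^bsub>ext_cochains R N' M i\<^esub> \<psi>) = pull i \<phi> \<oplus>\<^bsub>ext_cochains R N M i\<^esub> pull i \<psi>"
  by (rule pull_lin)

lemma pull_smult: "r \<in> carrier R \<Longrightarrow> \<phi> \<in> carrier (ext_cochains R N' M i) \<Longrightarrow>
   pull i (r \<odot>\<^bsub>ext_cochains R N' M i\<^esub> \<phi>) = r \<odot>\<^bsub>ext_cochains R N M i\<^esub> pull i \<phi>"
  by (rule pull_lin)

lemma pull_zero: "pull i \<zero>\<^bsub>ext_cochains R N' M i\<^esub> = \<zero>\<^bsub>ext_cochains R N M i\<^esub>"
  by (rule pull_lin)

lemma pull_diff: "pull (Suc i) (ext_diff R N' i \<phi>) = ext_diff R N i (pull i \<phi>)"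
proof -
  have "res_map R N N' f (Suc i) x \<in> carrier (res_module R N' (Suc i))" "res_diff R N i x \<in> carrier (res_module R N i)" if "x \<in> carrier (res_module R N (Suc i))" for x
    using rm_hom'[of "Suc i"] N.diff_hom[of i] that by (auto simp: module_hom_def)
  thus ?thesis by (auto simp: ext_diff_def compose_def fun_eq_iff chain')
qed

lemma pull_cocycle: "\<phi> \<in> ext_cocycles R N' M i \<Longrightarrow> pull i \<phi> \<in> ext_cocycles R N M i"
  using pull_zero[of "Suc i"] by (simp add: ext_cocycles_def pull_closed pull_diff[symmetric])

lemma pull_coboundary: "\<phi> \<in> ext_coboundaries R N' M i \<Longrightarrow> pull i \<phi> \<in> ext_coboundaries R N M i"
  by (cases i) (auto simp: pull_zero pull_diff intro: pull_closed)

abbreviation "cls P i \<phi> \<equiv> ext_coboundaries R P M i +>\<^bsub>ext_cochains R P M i\<^esub> \<phi>"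

lemma Ext_map_class:
  assumes "\<phi> \<in> carrier (ext_cochains R N' M i)"
  shows "Ext_map R N N' f M i (cls N' i \<phi>) = cls N i (pull i \<phi>)"
  unfolding Ext_map_def
proof (rule UN_eq_const)
  interpret C': module R "ext_cochains R N' M i" by (rule E'.cochains_module)
  interpret C: module R "ext_cochains R N M i" by (rule E.cochains_module)
  interpret B': abelian_subgroup "ext_coboundaries R N' M i" "ext_cochains R N' M i" by (rule C'.submodule_abelian_subgroup[OF E'.coboundaries_submodule])
  interpret B: abelian_subgroup "ext_coboundaries R N M i" "ext_cochains R N M i" by (rule C.submodule_abelian_subgroup[OF E.coboundaries_submodule])
  show "\<phi> \<in> cls N' i \<phi>" by (rule B'.a_rcos_self[OF assms])
  fix \<psi> assume "\<psi> \<in> cls N' i \<phi>"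
  then obtain \<beta> where b: "\<beta> \<in> ext_coboundaries R N' M i" "\<psi> = \<beta> \<oplus>\<^bsub>ext_cochains R N' M i\<^esub> \<phi>"
    by (auto simp: a_r_coset_def')
  have "\<beta> \<in> carrier (ext_cochains R N' M i)" using b B'.a_subset by auto
  hence "pull i \<psi> = pull i \<beta> \<oplus>\<^bsub>ext_cochains R N M i\<^esub> pull i \<phi>" using b assms by (simp add: pull_add)
  hence "pull i \<psi> \<in> cls N i (pull i \<phi>)" using pull_coboundary[OF b(1)] by (auto simp: a_r_coset_def')
  thus "cls N i (pull i \<psi>) = cls N i (pull i \<phi>)"
    using C.a_repr_independence[OF _ pull_closed[OF assms] B.a_subgroup] by metis
qed

end

lemma (in ext_pair) Ext_carrier:
  "carrier (Ext_module R N M i) = (\<lambda>\<phi>. ext_coboundaries R N M i +>\<^bsub>ext_cochains R N M i\<^esub> \<phi>) ` ext_cocycles R N M i"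
  using module.quotient_carrier[OF cocycles_module[of i], of "ext_coboundaries R N M i"]
  by (simp add: Ext_module_def a_r_coset_def')

lemma (in ext_pair) Ext_add:
  assumes "\<phi> \<in> ext_cocycles R N M i" "\<psi> \<in> ext_cocycles R N M i"
  shows "(ext_coboundaries R N M i +>\<^bsub>ext_cochains R N M i\<^esub> \<phi>) \<oplus>\<^bsub>Ext_module R N M i\<^esub> (ext_coboundaries R N M i +>\<^bsub>ext_cochains R N M i\<^esub> \<psi>)
    = ext_coboundaries R N M i +>\<^bsub>ext_cochains R N M i\<^esub> (\<phi> \<oplus>\<^bsub>ext_cochains R N M i\<^esub> \<psi>)"
  using module.quotient_add[OF cocycles_module coboundaries_submodule', where y = \<psi> and x = \<phi>] assms
  by (simp add: Ext_module_def a_r_coset_def')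

lemma (in ext_pair) Ext_smult:
  assumes "\<phi> \<in> ext_cocycles R N M i" "r \<in> carrier R"
  shows "r \<odot>\<^bsub>Ext_module R N M i\<^esub> (ext_coboundaries R N M i +>\<^bsub>ext_cochains R N M i\<^esub> \<phi>)
    = ext_coboundaries R N M i +>\<^bsub>ext_cochains R N M i\<^esub> (r \<odot>\<^bsub>ext_cochains R N M i\<^esub> \<phi>)"
  using module.quotient_smult[OF cocycles_module coboundaries_submodule', where r = r and x = \<phi>] assms
  by (simp add: Ext_module_def a_r_coset_def')

lemma (in ext_pair) cocycle_closed:
  "\<phi> \<in> ext_cocycles R N M i \<Longrightarrow> \<phi> \<in> carrier (ext_cochains R N M i)"
  "\<phi> \<in> ext_cocycles R N M i \<Longrightarrow> \<psi> \<in> ext_cocycles R N M i \<Longrightarrow> \<phi> \<oplus>\<^bsub>ext_cochains R N M i\<^esub> \<psi> \<in> ext_cocycles R N M i"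
  "\<phi> \<in> ext_cocycles R N M i \<Longrightarrow> r \<in> carrier R \<Longrightarrow> r \<odot>\<^bsub>ext_cochains R N M i\<^esub> \<phi> \<in> ext_cocycles R N M i"
  using module.submoduleE[OF cochains_module cocycles_submodule] by (auto simp: ext_cocycles_def)

lemma (in ext_lin) Ext_map_linear: "linear_map R (Ext_module R N' M i) (Ext_module R N M i) (Ext_map R N N' f M i)"
proof (intro linear_map.intro linear_map_axioms.intro E.Ext_is_module E'.Ext_is_module)
  note c = E'.Ext_carrier E.Ext_carrier
  show "Ext_map R N N' f M i x \<in> carrier (Ext_module R N M i)" if "x \<in> carrier (Ext_module R N' M i)" for x
    using that by (auto simp: c E'.cocycle_closed Ext_map_class intro!: imageI pull_cocycle)
  show "Ext_map R N N' f M i (x \<oplus>\<^bsub>Ext_module R N' M i\<^esub> y) =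
     Ext_map R N N' f M i x \<oplus>\<^bsub>Ext_module R N M i\<^esub> Ext_map R N N' f M i y"
    if "x \<in> carrier (Ext_module R N' M i)" "y \<in> carrier (Ext_module R N' M i)" for x y
    using that by (auto simp: c E'.Ext_add E.Ext_add E'.cocycle_closed Ext_map_class pull_cocycle pull_add)
  show "Ext_map R N N' f M i (r \<odot>\<^bsub>Ext_module R N' M i\<^esub> x) =
     r \<odot>\<^bsub>Ext_module R N M i\<^esub> Ext_map R N N' f M i x"
    if "r \<in> carrier R" "x \<in> carrier (Ext_module R N' M i)" for r x
    using that by (auto simp: c E'.Ext_smult E.Ext_smult E'.cocycle_closed Ext_map_class pull_cocycle pull_smult)
qed

lemma Ext_map_comp:
  assumes "linear_map R N N' f" "linear_map R N' N'' g" "linear_map R N N'' h" "module R M"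
    and h: "\<And>x. x \<in> carrier N \<Longrightarrow> h x = g (f x)"
    and x: "x \<in> carrier (Ext_module R N'' M i)"
  shows "Ext_map R N N' f M i (Ext_map R N' N'' g M i x) = Ext_map R N N'' h M i x"
proof -
  interpret f: ext_lin R N N' f M using assms by (simp add: ext_lin_def)
  interpret g: ext_lin R N' N'' g M using assms by (simp add: ext_lin_def)
  interpret h: ext_lin R N N'' h M using assms by (simp add: ext_lin_def)
  obtain \<phi> where p: "\<phi> \<in> ext_cocycles R N'' M i" "x = ext_coboundaries R N'' M i +>\<^bsub>ext_cochains R N'' M i\<^esub> \<phi>"
    using x by (auto simp: g.E'.Ext_carrier)
  have "f.pull i (g.pull i \<phi>) = h.pull i \<phi>"
    using f.rm_hom'[of i] by (auto simp: compose_def fun_eq_iff module_hom_def res_map_comp[OF assms(1-3) h])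
  thus ?thesis using p
    by (simp add: g.Ext_map_class h.Ext_map_class g.E'.cocycle_closed f.Ext_map_class g.pull_closed)
qed

lemma Ext_map_id:
  assumes "linear_map R N N f" "module R M"
    and h: "\<And>x. x \<in> carrier N \<Longrightarrow> f x = x"
    and x: "x \<in> carrier (Ext_module R N M i)"
  shows "Ext_map R N N f M i x = x"
proof -
  interpret f: ext_lin R N N f M using assms by (simp add: ext_lin_def)
  obtain \<phi> where p: "\<phi> \<in> ext_cocycles R N M i" "x = ext_coboundaries R N M i +>\<^bsub>ext_cochains R N M i\<^esub> \<phi>"
    using x by (auto simp: f.E.Ext_carrier)
  have "\<phi> \<in> extensional (carrier (res_module R N i))"
    using f.E.cocycle_closed(1)[OF p(1)] by (auto simp: ext_cochains_def hom_module_def module_hom_def PiE_def)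
  hence "f.pull i \<phi> = \<phi>"
    by (auto simp: compose_def fun_eq_iff extensional_def res_map_id[OF assms(1) h])
  thus ?thesis using p by (simp add: f.Ext_map_class f.E.cocycle_closed)
qed

subsection \<open>Direct limits and local cohomology\<close>

locale direct_system =
  fixes R (structure) and I :: "'i::linorder set" and L :: "'i \<Rightarrow> ('a, 'b, 'm) module_scheme" and \<tau>
  assumes nonempty: "I \<noteq> {}" and cring: "cring R"
    and linear: "t \<in> I \<Longrightarrow> u \<in> I \<Longrightarrow> t \<le> u \<Longrightarrow> linear_map R (L t) (L u) (\<tau> t u)"
    and \<tau>_id: "t \<in> I \<Longrightarrow> x \<in> carrier (L t) \<Longrightarrow> \<tau> t t x = x"
    and \<tau>_comp: "t \<in> I \<Longrightarrow> u \<in> I \<Longrightarrow> s \<in> I \<Longrightarrow> t \<le> u \<Longrightarrow> u \<le> s \<Longrightarrow> x \<in> carrier (L t) \<Longrightarrow> \<tau> u s (\<tau> t u x) = \<tau> t s x"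
begin

abbreviation "rel \<equiv> direct_limit_rel I L \<tau>"
abbreviation "cl t x \<equiv> rel `` {(t, x)}"
abbreviation "D \<equiv> direct_limit I L \<tau>"

lemma L_module: "t \<in> I \<Longrightarrow> module R (L t)"
  using linear[of t t] by (auto simp: linear_map_def)

lemmas tc = linear_map.f_closed[OF linear] and ta = linear_map.f_add[OF linear] and ts = linear_map.f_smult[OF linear]
  and tz = linear_map.f_zero[OF linear]

lemma equiv: "equiv (SIGMA t:I. carrier (L t)) rel"
proof (rule equivI)
  show "rel \<subseteq> (SIGMA t:I. carrier (L t)) \<times> (SIGMA t:I. carrier (L t))" by (auto simp: direct_limit_rel_def)
  show "refl_on (SIGMA t:I. carrier (L t)) rel" by (auto simp: refl_on_def direct_limit_rel_def)
  show "sym rel" by (auto simp: sym_def direct_limit_rel_def)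
  show "trans rel"
  proof (rule transI, clarsimp simp: direct_limit_rel_def)
    fix t x u y v z s s'
    assume *: "t \<in> I" "x \<in> carrier (L t)" "u \<in> I" "y \<in> carrier (L u)" "v \<in> I" "z \<in> carrier (L v)"
      "s \<in> I" "t \<le> s" "u \<le> s" "\<tau> t s x = \<tau> u s y" "s' \<in> I" "u \<le> s'" "v \<le> s'" "\<tau> u s' y = \<tau> v s' z"
    let ?m = "max s s'"
    have "\<tau> t ?m x = \<tau> s ?m (\<tau> t s x)" using * by (subst \<tau>_comp) (auto simp: max_def)
    also have "\<dots> = \<tau> u ?m y" using * by (subst \<tau>_comp[symmetric, of u s]) (auto simp: max_def)
    also have "\<dots> = \<tau> s' ?m (\<tau> u s' y)" using * by (subst \<tau>_comp) (auto simp: max_def)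
    also have "\<dots> = \<tau> v ?m z" using * by (subst \<tau>_comp[symmetric, of v s']) (auto simp: max_def)
    finally show "\<exists>s\<in>I. t \<le> s \<and> v \<le> s \<and> \<tau> t s x = \<tau> v s z"
      using * by (intro bexI[of _ ?m]) (auto simp: max_def)
  qed
qed

lemma cl_eq: "t \<in> I \<Longrightarrow> x \<in> carrier (L t) \<Longrightarrow> u \<in> I \<Longrightarrow> y \<in> carrier (L u) \<Longrightarrow>
   cl t x = cl u y \<longleftrightarrow> (\<exists>s \<in> I. t \<le> s \<and> u \<le> s \<and> \<tau> t s x = \<tau> u s y)"
  by (subst eq_equiv_class_iff[OF equiv]) (auto simp: direct_limit_rel_def)

lemma cl_push: "t \<in> I \<Longrightarrow> x \<in> carrier (L t) \<Longrightarrow> u \<in> I \<Longrightarrow> t \<le> u \<Longrightarrow> cl u (\<tau> t u x) = cl t x"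
  using tc[of t u x] by (subst cl_eq) (auto intro!: bexI[of _ u] simp: \<tau>_id)

lemma cl_mem: "(u, y) \<in> cl t x \<longleftrightarrow> t \<in> I \<and> x \<in> carrier (L t) \<and> u \<in> I \<and> y \<in> carrier (L u) \<and> (\<exists>s \<in> I. t \<le> s \<and> u \<le> s \<and> \<tau> t s x = \<tau> u s y)"
  by (auto simp: direct_limit_rel_def)

lemma D_carrier: "C \<in> carrier D \<longleftrightarrow> (\<exists>t x. t \<in> I \<and> x \<in> carrier (L t) \<and> C = cl t x)"
  by (auto simp: direct_limit_def quotient_def)

lemma add_same_cl:
  assumes "t \<in> I" "u \<in> I" "x \<in> carrier (L t)" "y \<in> carrier (L u)" "s \<in> I" "t \<le> s" "u \<le> s"
  shows "cl s (\<tau> t s x \<oplus>\<^bsub>L s\<^esub> \<tau> u s y) = cl (max t u) (\<tau> t (max t u) x \<oplus>\<^bsub>L (max t u)\<^esub> \<tau> u (max t u) y)"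
proof -
  let ?m = "max t u"
  interpret m: module R "L ?m" using assms by (intro L_module) (auto simp: max_def)
  have m: "?m \<in> I" "t \<le> ?m" "u \<le> ?m" "?m \<le> s" using assms by (auto simp: max_def)
  have "\<tau> ?m s (\<tau> t ?m x \<oplus>\<^bsub>L ?m\<^esub> \<tau> u ?m y) = \<tau> ?m s (\<tau> t ?m x) \<oplus>\<^bsub>L s\<^esub> \<tau> ?m s (\<tau> u ?m y)"
    using assms m tc by (intro ta) auto
  also have "\<dots> = \<tau> t s x \<oplus>\<^bsub>L s\<^esub> \<tau> u s y" using assms m by (simp add: \<tau>_comp)
  finally have "\<tau> t s x \<oplus>\<^bsub>L s\<^esub> \<tau> u s y = \<tau> ?m s (\<tau> t ?m x \<oplus>\<^bsub>L ?m\<^esub> \<tau> u ?m y)" by simp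
  thus ?thesis using assms m tc by (simp add: cl_push del: Image_singleton_iff)
qed

lemma UN2_const:
  assumes "(t, x) \<in> A" "\<And>u y. (u, y) \<in> A \<Longrightarrow> f u y = c"
  shows "(\<Union>(u, y)\<in>A. f u y) = c"
  by (rule UN_eq_const[OF assms(1)]) (use assms(2) in auto)

lemma add_cl0:
  assumes "t \<in> I" "u \<in> I" "x \<in> carrier (L t)" "y \<in> carrier (L u)"
  shows "cl t x \<oplus>\<^bsub>D\<^esub> cl u y = cl (max t u) (\<tau> t (max t u) x \<oplus>\<^bsub>L (max t u)\<^esub> \<tau> u (max t u) y)"
proof -
  have eq: "cl (max t' u') (\<tau> t' (max t' u') x' \<oplus>\<^bsub>L (max t' u')\<^esub> \<tau> u' (max t' u') y') =
    cl (max t u) (\<tau> t (max t u) x \<oplus>\<^bsub>L (max t u)\<^esub> \<tau> u (max t u) y)"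
    if 1: "(t', x') \<in> cl t x" and 2: "(u', y') \<in> cl u y" for t' x' u' y'
  proof -
    from 1 obtain s where s: "s \<in> I" "t \<le> s" "t' \<le> s" "\<tau> t s x = \<tau> t' s x'" "t' \<in> I" "x' \<in> carrier (L t')"
      unfolding cl_mem by auto
    from 2 obtain v where v: "v \<in> I" "u \<le> v" "u' \<le> v" "\<tau> u v y = \<tau> u' v y'" "u' \<in> I" "y' \<in> carrier (L u')"
      unfolding cl_mem by auto
    define m where "m = max s v"
    have m: "m \<in> I" "s \<le> m" "v \<le> m" using s v by (auto simp: m_def max_def)
    have "\<tau> s m (\<tau> t s x) = \<tau> s m (\<tau> t' s x')" using s by simp
    hence a: "\<tau> t m x = \<tau> t' m x'" using \<tau>_comp[of t s m x] \<tau>_comp[of t' s m x'] s m assms by simp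
    have "\<tau> v m (\<tau> u v y) = \<tau> v m (\<tau> u' v y')" using v by simp
    hence b: "\<tau> u m y = \<tau> u' m y'" using \<tau>_comp[of u v m y] \<tau>_comp[of u' v m y'] v m assms by simp
    have le: "t \<le> m" "t' \<le> m" "u \<le> m" "u' \<le> m" using s v m by auto
    show ?thesis
      using add_same_cl[of t' u' x' y' m] add_same_cl[of t u x y m] assms s v m le a b by metis
  qed
  have self: "(t, x) \<in> cl t x" "(u, y) \<in> cl u y" using assms unfolding cl_mem by auto
  have "(\<Union>(t, x)\<in>cl t x. \<Union>(u, y)\<in>cl u y. cl (max t u) (\<tau> t (max t u) x \<oplus>\<^bsub>L (max t u)\<^esub> \<tau> u (max t u) y))
     = cl (max t u) (\<tau> t (max t u) x \<oplus>\<^bsub>L (max t u)\<^esub> \<tau> u (max t u) y)"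
    by (rule UN2_const[OF self(1)], rule UN2_const[OF self(2)], rule eq)
  thus ?thesis by (simp add: direct_limit_def)
qed

lemma add_cl:
  assumes "t \<in> I" "u \<in> I" "x \<in> carrier (L t)" "y \<in> carrier (L u)" "s \<in> I" "t \<le> s" "u \<le> s"
  shows "cl t x \<oplus>\<^bsub>D\<^esub> cl u y = cl s (\<tau> t s x \<oplus>\<^bsub>L s\<^esub> \<tau> u s y)"
  using add_same_cl[OF assms] add_cl0[OF assms(1-4)] by simp

lemma smult_cl:
  assumes "r \<in> carrier R" "t \<in> I" "x \<in> carrier (L t)"
  shows "r \<odot>\<^bsub>D\<^esub> cl t x = cl t (r \<odot>\<^bsub>L t\<^esub> x)"
proof -
  have eq: "cl t' (r \<odot>\<^bsub>L t'\<^esub> x') = cl t (r \<odot>\<^bsub>L t\<^esub> x)"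
    if 1: "(t', x') \<in> cl t x" for t' x'
  proof -
    from 1 obtain s where s: "s \<in> I" "t \<le> s" "t' \<le> s" "\<tau> t s x = \<tau> t' s x'" "t' \<in> I" "x' \<in> carrier (L t')"
      unfolding cl_mem by auto
    have "cl t' (r \<odot>\<^bsub>L t'\<^esub> x') = cl s (\<tau> t' s (r \<odot>\<^bsub>L t'\<^esub> x'))"
      using s assms L_module by (intro cl_push[symmetric]) (auto intro: module.smult_closed)
    also have "\<dots> = cl s (\<tau> t s (r \<odot>\<^bsub>L t\<^esub> x))" using s assms by (simp add: ts)
    also have "\<dots> = cl t (r \<odot>\<^bsub>L t\<^esub> x)"
      using s assms L_module by (intro cl_push) (auto intro: module.smult_closed)
    finally show ?thesis .
  qed
  have self: "(t, x) \<in> cl t x" using assms unfolding cl_mem by auto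
  have "(\<Union>(t, x)\<in>cl t x. cl t (r \<odot>\<^bsub>L t\<^esub> x)) = cl t (r \<odot>\<^bsub>L t\<^esub> x)"
    by (rule UN2_const[OF self eq])
  thus ?thesis by (simp add: direct_limit_def)
qed

lemma zero_cl:
  assumes "t \<in> I" shows "\<zero>\<^bsub>D\<^esub> = cl t \<zero>\<^bsub>L t\<^esub>"
proof -
  have z: "\<zero>\<^bsub>L u\<^esub> \<in> carrier (L u)" if "u \<in> I" for u
    using L_module[OF that] by (simp add: module_def abelian_group_def abelian_monoid.zero_closed)
  have "cl u \<zero>\<^bsub>L u\<^esub> = cl t \<zero>\<^bsub>L t\<^esub>" if "u \<in> I" for u
    using assms that z by (subst cl_eq) (auto intro!: bexI[of _ "max t u"] simp: tz max_def)
  hence "(\<Union>u\<in>I. cl u \<zero>\<^bsub>L u\<^esub>) = cl t \<zero>\<^bsub>L t\<^esub>" by (rule UN_eq_const[OF assms])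
  thus ?thesis by (simp add: direct_limit_def)
qed

lemma common:
  assumes "C \<in> carrier D" "C' \<in> carrier D" "C'' \<in> carrier D"
  obtains t x y z where "t \<in> I" "x \<in> carrier (L t)" "y \<in> carrier (L t)" "z \<in> carrier (L t)" "C = cl t x" "C' = cl t y" "C'' = cl t z"
proof -
  from assms obtain t1 x1 t2 x2 t3 x3 where *: "t1 \<in> I" "x1 \<in> carrier (L t1)" "C = cl t1 x1"
    "t2 \<in> I" "x2 \<in> carrier (L t2)" "C' = cl t2 x2" "t3 \<in> I" "x3 \<in> carrier (L t3)" "C'' = cl t3 x3"
    unfolding D_carrier by metis
  define m where "m = max t1 (max t2 t3)"
  have m: "m \<in> I" "t1 \<le> m" "t2 \<le> m" "t3 \<le> m" using * unfolding m_def by (auto simp: max_def)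
  show ?thesis
    by (rule that[of m "\<tau> t1 m x1" "\<tau> t2 m x2" "\<tau> t3 m x3"]) (use * m in \<open>auto simp: tc cl_push\<close>)
qed

lemma add_cl': "t \<in> I \<Longrightarrow> x \<in> carrier (L t) \<Longrightarrow> y \<in> carrier (L t) \<Longrightarrow> cl t x \<oplus>\<^bsub>D\<^esub> cl t y = cl t (x \<oplus>\<^bsub>L t\<^esub> y)"
  by (subst add_cl[of t t x y t]) (auto simp: \<tau>_id)

lemma D_closed: "t \<in> I \<Longrightarrow> x \<in> carrier (L t) \<Longrightarrow> cl t x \<in> carrier D"
  unfolding D_carrier by blast

lemma is_module: "module R D"
proof (rule moduleI[OF cring abelian_groupI], goal_cases)
  case (1 A B)
  obtain t x y where t: "t \<in> I" "x \<in> carrier (L t)" "y \<in> carrier (L t)" "A = cl t x" "B = cl t y" by (rule common[OF 1(1) 1(2) 1(1)])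
  interpret L: module R "L t" by (rule L_module[OF t(1)])
  show ?case unfolding t(4,5) using t(1-3) by (simp add: add_cl' D_closed del: Image_singleton_iff)
next
  case 2
  obtain t where t: "t \<in> I" using nonempty by auto
  interpret L: module R "L t" by (rule L_module[OF t(1)])
  show ?case unfolding zero_cl[OF t] by (rule D_closed) (use t in auto)
next
  case (3 A B C)
  obtain t x y z where t: "t \<in> I" "x \<in> carrier (L t)" "y \<in> carrier (L t)" "z \<in> carrier (L t)" "A = cl t x" "B = cl t y" "C = cl t z" by (rule common[OF 3(1) 3(2) 3(3)])
  interpret L: module R "L t" by (rule L_module[OF t(1)])
  show ?case unfolding t(5-) using t(1-4) by (simp add: add_cl' L.M.a_assoc)
next
  case (4 A B)
  obtain t x y where t: "t \<in> I" "x \<in> carrier (L t)" "y \<in> carrier (L t)" "A = cl t x" "B = cl t y" by (rule common[OF 4(1) 4(2) 4(1)])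
  interpret L: module R "L t" by (rule L_module[OF t(1)])
  show ?case unfolding t(4,5) using t(1-3) by (simp add: add_cl' L.M.a_comm)
next
  case (5 A)
  then obtain t x where t: "t \<in> I" "x \<in> carrier (L t)" "A = cl t x" unfolding D_carrier by auto
  interpret L: module R "L t" by (rule L_module[OF t(1)])
  show ?case unfolding t(3) zero_cl[OF t(1)] using t(1,2) by (simp add: add_cl')
next
  case (6 A)
  then obtain t x where t: "t \<in> I" "x \<in> carrier (L t)" "A = cl t x" unfolding D_carrier by auto
  interpret L: module R "L t" by (rule L_module[OF t(1)])
  have "cl t (\<ominus>\<^bsub>L t\<^esub> x) \<oplus>\<^bsub>D\<^esub> A = \<zero>\<^bsub>D\<^esub>"
    unfolding t(3) zero_cl[OF t(1)] using t(1,2) by (simp add: add_cl' L.M.l_neg)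
  moreover have "cl t (\<ominus>\<^bsub>L t\<^esub> x) \<in> carrier D" by (rule D_closed) (use t in auto)
  ultimately show ?case by (rule bexI)
next
  case (7 r A)
  then obtain t x where t: "t \<in> I" "x \<in> carrier (L t)" "A = cl t x" unfolding D_carrier by auto
  interpret L: module R "L t" by (rule L_module[OF t(1)])
  show ?case unfolding t(3) smult_cl[OF 7(1) t(1,2)] by (rule D_closed) (use t 7 in auto)
next
  case (8 a b A)
  then obtain t x where t: "t \<in> I" "x \<in> carrier (L t)" "A = cl t x" unfolding D_carrier by auto
  interpret L: module R "L t" by (rule L_module[OF t(1)])
  show ?case unfolding t(3) using t(1,2) 8 by (simp add: smult_cl add_cl' L.smult_l_distr)
next
  case (9 a A B)
  obtain t x y where t: "t \<in> I" "x \<in> carrier (L t)" "y \<in> carrier (L t)" "A = cl t x" "B = cl t y" by (rule common[OF 9(2) 9(3) 9(2)])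
  interpret L: module R "L t" by (rule L_module[OF t(1)])
  show ?case unfolding t(4,5) using t(1-3) 9(1) by (simp add: smult_cl add_cl' L.smult_r_distr)
next
  case (10 a b A)
  then obtain t x where t: "t \<in> I" "x \<in> carrier (L t)" "A = cl t x" unfolding D_carrier by auto
  interpret L: module R "L t" by (rule L_module[OF t(1)])
  show ?case unfolding t(3) using t(1,2) 10 by (simp add: smult_cl L.smult_assoc1)
next
  case (11 A)
  then obtain t x where t: "t \<in> I" "x \<in> carrier (L t)" "A = cl t x" unfolding D_carrier by auto
  interpret L: module R "L t" by (rule L_module[OF t(1)])
  show ?case unfolding t(3) using t(1,2) by (simp add: smult_cl)
qed

end

lemma (in module) annihilator_ideal: "ideal (annihilator R M) R"
proof (rule idealI)
  show "subgroup (annihilator R M) (add_monoid R)"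
    by (rule R.add.subgroupI)
      (auto simp: annihilator_def smult_l_distr smult_l_minus a_inv_def[symmetric] intro!: exI[of _ "\<zero>\<^bsub>R\<^esub>"])
qed (auto simp: annihilator_def smult_assoc1 R.m_comm R.ring_axioms)

context cring
begin

lemma ideal_power_ideal: "ideal I R \<Longrightarrow> ideal (ideal_power R I t) R"
  using monoid.nat_pow_closed[OF comm_monoid.axioms(1)[OF ideals_set_is_comm_monoid], of I t]
  by (simp add: ideals_set_def)

lemma ideal_power_antimono:
  assumes I: "ideal I R" and "t \<le> u" shows "ideal_power R I u \<subseteq> ideal_power R I t"
  using assms(2)
proof (induction u rule: dec_induct)
  case (step u)
  have "ideal_power R I (Suc u) = ideal_power R I u \<cdot> I"
    by (simp add: ideals_set_def nat_pow_def)
  also have "\<dots> \<subseteq> ideal_power R I u" using ideal_prod_inter[OF ideal_power_ideal[OF I] I] by auto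
  finally show ?case using step by auto
qed simp

lemma power_submodule: "ideal I R \<Longrightarrow> submodule (ideal_power R I t) R (regular_module R)"
proof -
  assume "ideal I R"
  then interpret J: ideal "ideal_power R I t" R by (rule ideal_power_ideal)
  interpret G: module R "regular_module R" by (rule regular_module_is_module)
  have neg: "\<ominus>\<^bsub>regular_module R\<^esub> a = \<ominus> a" for a by (simp add: a_inv_def m_inv_def regular_module_def)
  show ?thesis
    by (rule G.submoduleI) (auto simp: neg, auto simp: regular_module_def J.a_Hcarr J.I_l_closed)
qed

lemma power_quotient_module: "ideal I R \<Longrightarrow> module R (power_quotient R I t)"
  unfolding power_quotient_def
  by (rule module.quotient_is_module[OF regular_module_is_module power_submodule])

lemma reg_coset: "K +>\<^bsub>regular_module R\<^esub> r = K +> r"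
  by (simp add: a_r_coset_def' regular_module_def)

lemma power_proj:
  assumes I: "ideal I R" and "t \<le> u" and r: "r \<in> carrier R"
  shows "power_projection R I t (ideal_power R I u +> r) = ideal_power R I t +> r"
  unfolding power_projection_def
proof (rule UN_eq_const)
  interpret K: ideal "ideal_power R I u" R by (rule ideal_power_ideal[OF I])
  interpret J: ideal "ideal_power R I t" R by (rule ideal_power_ideal[OF I])
  show "r \<in> ideal_power R I u +> r" by (rule K.a_rcos_self[OF r])
  fix s assume "s \<in> ideal_power R I u +> r"
  hence "s \<in> ideal_power R I t +> r" using ideal_power_antimono[OF I \<open>t \<le> u\<close>] by (auto simp: a_r_coset_def')
  thus "ideal_power R I t +> s = ideal_power R I t +> r"
    using a_repr_independence[OF _ r J.a_subgroup] by metis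
qed

lemma power_projection_linear:
  assumes I: "ideal I R" and tu: "t \<le> u"
  shows "linear_map R (power_quotient R I u) (power_quotient R I t) (power_projection R I t)"
proof -
  interpret G: module R "regular_module R" by (rule regular_module_is_module)
  have c: "carrier (power_quotient R I t) = (\<lambda>r. ideal_power R I t +> r) ` carrier R" for t
    unfolding power_quotient_def G.quotient_carrier reg_coset by (simp add: regular_module_def)
  have a: "(ideal_power R I t +> x) \<oplus>\<^bsub>power_quotient R I t\<^esub> (ideal_power R I t +> y) = ideal_power R I t +> (x \<oplus> y)"
    if "x \<in> carrier R" "y \<in> carrier R" for t x y
    using G.quotient_add[OF power_submodule[OF I], of y x t] that
    by (simp add: reg_coset power_quotient_def) (simp add: regular_module_def)
  have s: "x \<odot>\<^bsub>power_quotient R I t\<^esub> (ideal_power R I t +> y) = ideal_power R I t +> (x \<otimes> y)"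
    if "x \<in> carrier R" "y \<in> carrier R" for t x y
    using G.quotient_smult[OF power_submodule[OF I], of x y t] that
    by (simp add: reg_coset power_quotient_def) (simp add: regular_module_def)
  show ?thesis
    by (intro linear_map.intro linear_map_axioms.intro power_quotient_module I)
      (auto simp: c a s power_proj[OF I tu])
qed

theorem local_cohomology_is_module:
  assumes I: "ideal I R" and M: "module R M"
  shows "module R (local_cohomology R I i M)"
proof -
  interpret G: module R "regular_module R" by (rule regular_module_is_module)
  have c: "carrier (power_quotient R I t) = (\<lambda>r. ideal_power R I t +> r) ` carrier R" for t
    unfolding power_quotient_def G.quotient_carrier reg_coset by (simp add: regular_module_def)
  note pl = power_projection_linear[OF I]
  show ?thesis
    unfolding local_cohomology_def
  proof (rule direct_system.is_module, rule direct_system.intro, goal_cases)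
    case (3 t u)
    have "ext_lin R (power_quotient R I u) (power_quotient R I t) (power_projection R I t) M"
      using pl[OF 3(3)] M by (simp add: ext_lin_def)
    thus ?case by (rule ext_lin.Ext_map_linear)
  next
    case (4 t x)
    show ?case by (rule Ext_map_id[OF pl M _ 4(2)]) (auto simp: c power_proj[OF I])
  next
    case (5 t u s x)
    show ?case
      by (rule Ext_map_comp[OF pl pl pl M _ 5(6)]) (use 5(4,5) in \<open>auto simp: c power_proj[OF I]\<close>)
  qed (simp_all add: is_cring)
qed

end

end

theory Submission
  imports Defs
begin

text \<open>
  Let \<open>a\<close> be the ideal generated by \<open>x\<^sub>1, \<dots>, x\<^sub>n\<close>. The left inclusion holds because an element that
  kills \<open>M\<close> kills every cochain with values in \<open>M\<close>.

  For the right inclusion let \<open>r\<^sub>i\<close> kill \<open>H\<^sup>i\<^sub>a(M)\<close> for \<open>i = 0, \<dots>, n\<close>, let \<open>r = r\<^sub>0 \<dots> r\<^sub>n\<close> and let \<open>m\<close> be an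
  element of \<open>M\<close>. Since the \<open>x\<^sub>j\<close> lie in the maximal ideal, the intersection theorem of Krull
  (\<open>krull_intersection\<close>) applies, and it suffices that \<open>r m\<close> lies in \<open>a\<^sup>s M\<close> for every \<open>s\<close>. Fix \<open>s\<close> and let \<open>K\<close> be the Koszul complex
  \<open>0 \<rightarrow> K\<^sub>n \<rightarrow> \<dots> \<rightarrow> K\<^sub>0 = M\<close> of \<open>x\<^sub>1\<^sup>s, \<dots>, x\<^sub>n\<^sup>s\<close> with coefficients in \<open>M\<close>. The image of \<open>K\<^sub>1\<close> in
  \<open>K\<^sub>0\<close> lies in \<open>a\<^sup>s M\<close>, so it is enough that \<open>r m\<close> is a boundary of \<open>K\<close>. Write \<open>F\<^sup>t\<close> for the canonical
  free resolution of \<open>R/a\<^sup>t\<close>. Two facts are combined.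

  \<^item> For large \<open>t\<close> there is a chain map \<open>z\<close> from \<open>F\<^sup>t\<close> to \<open>K\<close> that sends the generator of \<open>R/a\<^sup>t\<close> to
    \<open>m\<close>. Powers of the \<open>x\<^sub>j\<close> kill the homology of \<open>K\<close>, so by the lemma of Artin and Rees
    (\<open>artin_rees\<close>) a cycle that lies deep enough in the \<open>a\<close>-adic filtration is the boundary of an
    element that is still deep (\<open>koszul_strictly_exact\<close>). Since \<open>K\<close> has only \<open>n + 1\<close> terms, depth
    \<open>t\<close> at the start suffices to construct \<open>z\<close> degree by degree (\<open>lift_to_chain_map\<close>).

  \<^item> After multiplication by \<open>r\<close> and composition with some \<open>F\<^sup>u \<rightarrow> F\<^sup>t\<close>, every chain map from \<open>F\<^sup>t\<close> to
    \<open>K\<close> becomes null-homotopic (\<open>descent\<close>). The component of \<open>z\<close> in the top degree \<open>n\<close> is a cocycle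
    with values in a finite power of \<open>M\<close>, so \<open>r\<^sub>n\<close> times it becomes a coboundary at a later stage; once the
    corresponding homotopy is subtracted, the component in degree \<open>n - 1\<close> is a cocycle, and so on.
    In degree \<open>0\<close> a coboundary vanishes, and evaluation at the generator says that \<open>r m\<close> is a boundary of \<open>K\<close>.

  Together these facts are an elementary form of the spectral sequence from the Koszul cohomology of
  the modules \<open>H\<^sup>q\<^sub>a(M)\<close> to the Koszul cohomology of \<open>M\<close>, whose top group is
  \<open>M/(x\<^sub>1\<^sup>s, \<dots>, x\<^sub>n\<^sup>s)M\<close>.
\<close>

section \<open>Submodules and Noetherian modules\<close>

context module
begin

lemma submodule_zero: "submodule H R M \<Longrightarrow> \<zero>\<^bsub>M\<^esub> \<in> H"
  using subgroup.one_closed[OF submodule.axioms(1)] by force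

lemma submodule_sum:
  assumes H: "submodule H R M" and K: "submodule K R M"
  shows "submodule (H <+>\<^bsub>M\<^esub> K) R M"
proof -
  note h = submoduleE[OF H] and k = submoduleE[OF K]
  have hc: "x \<in> carrier M" if "x \<in> H" for x using h(1) that by auto
  have kc: "x \<in> carrier M" if "x \<in> K" for x using k(1) that by auto
  show ?thesis
    unfolding set_add_def'
  proof (rule submoduleI)
    show "\<zero>\<^bsub>M\<^esub> \<in> (\<Union>h\<in>H. \<Union>k\<in>K. {h \<oplus>\<^bsub>M\<^esub> k})"
      using submodule_zero[OF H] submodule_zero[OF K] by force
    show "\<ominus>\<^bsub>M\<^esub> a \<in> (\<Union>h\<in>H. \<Union>k\<in>K. {h \<oplus>\<^bsub>M\<^esub> k})" if "a \<in> (\<Union>h\<in>H. \<Union>k\<in>K. {h \<oplus>\<^bsub>M\<^esub> k})" for a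
      using that by (auto simp: hc kc M.minus_add) (metis h(3) k(3))
    show "a \<oplus>\<^bsub>M\<^esub> b \<in> (\<Union>h\<in>H. \<Union>k\<in>K. {h \<oplus>\<^bsub>M\<^esub> k})"
      if ab: "a \<in> (\<Union>h\<in>H. \<Union>k\<in>K. {h \<oplus>\<^bsub>M\<^esub> k})" "b \<in> (\<Union>h\<in>H. \<Union>k\<in>K. {h \<oplus>\<^bsub>M\<^esub> k})" for a b
    proof -
      from ab obtain x y x' y' where *: "x \<in> H" "y \<in> K" "a = x \<oplus>\<^bsub>M\<^esub> y" "x' \<in> H" "y' \<in> K" "b = x' \<oplus>\<^bsub>M\<^esub> y'" by auto
      have "a \<oplus>\<^bsub>M\<^esub> b = (x \<oplus>\<^bsub>M\<^esub> x') \<oplus>\<^bsub>M\<^esub> (y \<oplus>\<^bsub>M\<^esub> y')" unfolding *(3,6) using hc[OF *(1)] kc[OF *(2)] hc[OF *(4)] kc[OF *(5)] by (simp add: M.a_ac)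
      thus ?thesis using h(5)[OF *(1,4)] k(5)[OF *(2,5)] by blast
    qed
    show "r \<odot>\<^bsub>M\<^esub> a \<in> (\<Union>h\<in>H. \<Union>k\<in>K. {h \<oplus>\<^bsub>M\<^esub> k})"
      if "r \<in> carrier R" "a \<in> (\<Union>h\<in>H. \<Union>k\<in>K. {h \<oplus>\<^bsub>M\<^esub> k})" for r a
      using that by (auto simp: hc kc smult_r_distr) (metis h(4) k(4))
  qed (use hc kc in auto)
qed

lemma submodule_sum_upper:
  assumes H: "submodule H R M" and K: "submodule K R M"
  shows "H \<subseteq> H <+>\<^bsub>M\<^esub> K" and "K \<subseteq> H <+>\<^bsub>M\<^esub> K"
proof -
  have "h = h \<oplus>\<^bsub>M\<^esub> \<zero>\<^bsub>M\<^esub>" if "h \<in> H" for h using submoduleE(1)[OF H] that by auto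
  thus "H \<subseteq> H <+>\<^bsub>M\<^esub> K" using submodule_zero[OF K] unfolding set_add_def' by blast
  have "k = \<zero>\<^bsub>M\<^esub> \<oplus>\<^bsub>M\<^esub> k" if "k \<in> K" for k using submoduleE(1)[OF K] that by auto
  thus "K \<subseteq> H <+>\<^bsub>M\<^esub> K" using submodule_zero[OF H] unfolding set_add_def' by blast
qed

lemma cyclic_submodule:
  assumes a: "a \<in> carrier M" shows "submodule ((\<lambda>r. r \<odot>\<^bsub>M\<^esub> a) ` carrier R) R M"
proof (rule submoduleI)
  show "\<zero>\<^bsub>M\<^esub> \<in> (\<lambda>r. r \<odot>\<^bsub>M\<^esub> a) ` carrier R" using a by (intro image_eqI[of _ _ \<zero>]) auto
qed (use a in \<open>auto simp: smult_l_minus[symmetric] smult_l_distr[symmetric] smult_assoc1[symmetric]\<close>)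

lemma multiples_submodule:
  assumes c: "c \<in> carrier R" shows "submodule ((\<lambda>x. c \<odot>\<^bsub>M\<^esub> x) ` carrier M) R M"
proof (rule submoduleI)
  show "\<zero>\<^bsub>M\<^esub> \<in> (\<lambda>x. c \<odot>\<^bsub>M\<^esub> x) ` carrier M" using c by (intro image_eqI[of _ _ "\<zero>\<^bsub>M\<^esub>"]) auto
  show "r \<odot>\<^bsub>M\<^esub> y \<in> (\<lambda>x. c \<odot>\<^bsub>M\<^esub> x) ` carrier M"
    if r: "r \<in> carrier R" and y: "y \<in> (\<lambda>x. c \<odot>\<^bsub>M\<^esub> x) ` carrier M" for r y
  proof -
    from y obtain x where x: "x \<in> carrier M" "y = c \<odot>\<^bsub>M\<^esub> x" by auto
    have "r \<odot>\<^bsub>M\<^esub> y = c \<odot>\<^bsub>M\<^esub> (r \<odot>\<^bsub>M\<^esub> x)" using x r c by (simp add: smult_assoc1[symmetric] R.m_comm)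
    thus ?thesis using x r by auto
  qed
qed (use c in \<open>auto simp: smult_r_minus[symmetric] smult_r_distr[symmetric]\<close>)

lemma colon_ideal:
  assumes S: "S \<subseteq> carrier M" and P: "submodule P R M"
  shows "ideal {r \<in> carrier R. \<forall>x \<in> S. r \<odot>\<^bsub>M\<^esub> x \<in> P} R"
proof (rule idealI[OF R.ring_axioms])
  note p = submoduleE[OF P]
  have s: "x \<in> carrier M" if "x \<in> S" for x using S that by auto
  show "subgroup {r \<in> carrier R. \<forall>x \<in> S. r \<odot>\<^bsub>M\<^esub> x \<in> P} (add_monoid R)"
    by (rule R.add.subgroupI)
      (auto simp: s smult_l_distr smult_l_minus a_inv_def[symmetric] p submodule_zero[OF P]
        intro!: exI[of _ "\<zero>\<^bsub>R\<^esub>"])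
  show "b \<otimes> a \<in> {r \<in> carrier R. \<forall>x \<in> S. r \<odot>\<^bsub>M\<^esub> x \<in> P}"
    if "a \<in> {r \<in> carrier R. \<forall>x \<in> S. r \<odot>\<^bsub>M\<^esub> x \<in> P}" "b \<in> carrier R" for a b
    using that S p(4) by (auto simp: subset_iff smult_assoc1)
  thus "a \<otimes> b \<in> {r \<in> carrier R. \<forall>x \<in> S. r \<odot>\<^bsub>M\<^esub> x \<in> P}"
    if "a \<in> {r \<in> carrier R. \<forall>x \<in> S. r \<odot>\<^bsub>M\<^esub> x \<in> P}" "b \<in> carrier R" for a b
    using that by (subst R.m_comm) auto
qed

end

definition ascending_submodules ::
    "('a, 'r) ring_scheme \<Rightarrow> ('a, 'b, 'm) module_scheme \<Rightarrow> (nat \<Rightarrow> 'b set) \<Rightarrow> bool" where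
  "ascending_submodules R M H \<longleftrightarrow> (\<forall>n. submodule (H n) R M) \<and> (\<forall>n. H n \<subseteq> H (Suc n))"

text \<open>
  The ascending chain condition for the intersections with \<open>S\<close> of submodules of \<open>M\<close>. It is
  relative to \<open>S\<close> so that \<open>S\<close> can grow by one generator at a time while the chains stay chains of
  submodules of \<open>M\<close>.
\<close>

definition noetherian_in ::
    "('a, 'r) ring_scheme \<Rightarrow> ('a, 'b, 'm) module_scheme \<Rightarrow> 'b set \<Rightarrow> bool" where
  "noetherian_in R M S \<longleftrightarrow>
     (\<forall>H. ascending_submodules R M H \<longrightarrow> (\<exists>N. \<forall>n\<ge>N. H n \<inter> S \<subseteq> H N))"

abbreviation noetherian_module ::
    "('a, 'r) ring_scheme \<Rightarrow> ('a, 'b, 'm) module_scheme \<Rightarrow> bool" where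
  "noetherian_module R M \<equiv> noetherian_in R M (carrier M)"

lemma ascending_submodules_mono: "ascending_submodules R M H \<Longrightarrow> i \<le> j \<Longrightarrow> H i \<subseteq> H j"
  by (rule lift_Suc_mono_le) (auto simp: ascending_submodules_def)

lemma (in noetherian_ring) ascending_ideals_stable:
  fixes J :: "nat \<Rightarrow> 'a set"
  assumes J: "\<And>n. ideal (J n) R" "\<And>n. J n \<subseteq> J (Suc n)"
  shows "\<exists>N. \<forall>n\<ge>N. J n \<subseteq> J N"
proof -
  have mono: "J i \<subseteq> J j" if "i \<le> j" for i j by (rule lift_Suc_mono_le[of J, OF J(2) that])
  have "\<Union>(range J) \<in> range J"
  proof (rule ideal_chain_is_trivial)
    show "subset.chain {I. ideal I R} (range J)"
    proof -
      have "J i \<subseteq> J j \<or> J j \<subseteq> J i" for i j using mono[of i j] mono[of j i] by linarith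
      thus ?thesis unfolding subset_chain_def using J(1) by auto
    qed
  qed auto
  then obtain N where "\<Union>(range J) = J N" by auto
  thus ?thesis by blast
qed

text \<open>
  A submodule of \<open>Ra + S\<close> is controlled by its intersection with \<open>S\<close> and by the ideal of the
  coefficients \<open>r\<close> for which it meets \<open>ra + S\<close>. Along an ascending chain both become stationary.
\<close>

lemma (in module) noetherian_in_extend:
  assumes R: "noetherian_ring R" and S: "submodule S R M" "noetherian_in R M S" and a: "a \<in> carrier M"
  shows "noetherian_in R M ((\<lambda>r. r \<odot>\<^bsub>M\<^esub> a) ` carrier R <+>\<^bsub>M\<^esub> S)"
  unfolding noetherian_in_def
proof (intro allI impI)
  fix H assume H: "ascending_submodules R M H"
  hence Hs: "submodule (H n) R M" and Hm: "H n \<subseteq> H (Suc n)" for n by (auto simp: ascending_submodules_def)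
  have sc: "x \<in> carrier M" if "x \<in> S" for x using submoduleE(1)[OF S(1)] that by auto
  have hc: "x \<in> carrier M" if "x \<in> H n" for x n using submoduleE(1)[OF Hs] that by auto
  define J where "J n = {r \<in> carrier R. \<forall>x \<in> {a}. r \<odot>\<^bsub>M\<^esub> x \<in> H n <+>\<^bsub>M\<^esub> S}" for n
  have "ideal (J n) R" for n
    unfolding J_def by (rule colon_ideal) (use a in \<open>auto intro: submodule_sum Hs S\<close>)
  moreover have "J n \<subseteq> J (Suc n)" for n unfolding J_def set_add_def' using Hm[of n] by blast
  ultimately obtain N1 where N1: "J n \<subseteq> J N1" if "n \<ge> N1" for n
    using noetherian_ring.ascending_ideals_stable[OF R, of J] by blast
  obtain N2 where N2: "H n \<inter> S \<subseteq> H N2" if "n \<ge> N2" for n using S(2) H unfolding noetherian_in_def by blast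
  define N where "N = max N1 N2"
  have le: "H N1 \<subseteq> H N" "H N2 \<subseteq> H N" using ascending_submodules_mono[OF H] by (auto simp: N_def)
  have "h \<in> H N" if "n \<ge> N" "h \<in> H n" and hh: "h \<in> (\<lambda>r. r \<odot>\<^bsub>M\<^esub> a) ` carrier R <+>\<^bsub>M\<^esub> S" for n h
  proof -
    from hh obtain r s where rs: "r \<in> carrier R" "s \<in> S" "h = r \<odot>\<^bsub>M\<^esub> a \<oplus>\<^bsub>M\<^esub> s" by (auto simp: set_add_def')
    have nn: "n \<ge> N1" "n \<ge> N2" "H N \<subseteq> H n" using that ascending_submodules_mono[OF H] by (auto simp: N_def)
    have ms: "\<ominus>\<^bsub>M\<^esub> s \<in> S" using rs submoduleE(3)[OF S(1)] by auto
    have "r \<odot>\<^bsub>M\<^esub> a = h \<oplus>\<^bsub>M\<^esub> \<ominus>\<^bsub>M\<^esub> s" using rs a sc by (simp add: M.a_assoc M.r_neg)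
    hence "r \<in> J n" unfolding J_def set_add_def' using rs ms that by auto
    hence "r \<in> J N1" using N1 nn by blast
    then obtain h' s' where h': "h' \<in> H N1" "s' \<in> S" "r \<odot>\<^bsub>M\<^esub> a = h' \<oplus>\<^bsub>M\<^esub> s'" by (auto simp: J_def set_add_def')
    have h'N: "h' \<in> H N" using le h' by auto
    have eq: "h = h' \<oplus>\<^bsub>M\<^esub> (s' \<oplus>\<^bsub>M\<^esub> s)" using rs h' hc sc by (simp add: M.a_assoc)
    have ss: "s' \<oplus>\<^bsub>M\<^esub> s \<in> S" using rs h' submoduleE(5)[OF S(1)] by auto
    have "s' \<oplus>\<^bsub>M\<^esub> s = \<ominus>\<^bsub>M\<^esub> h' \<oplus>\<^bsub>M\<^esub> h"
      unfolding eq using hc[OF h'N] sc[OF ss] by (simp add: M.a_assoc[symmetric] M.l_neg)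
    also have "\<dots> \<in> H n" using h'N nn that by (intro submoduleE(3,5)[OF Hs]) auto
    finally have "s' \<oplus>\<^bsub>M\<^esub> s \<in> H N" using ss N2 nn le by blast
    thus ?thesis unfolding eq by (rule submoduleE(5)[OF Hs h'N])
  qed
  thus "\<exists>N. \<forall>n\<ge>N. H n \<inter> ((\<lambda>r. r \<odot>\<^bsub>M\<^esub> a) ` carrier R <+>\<^bsub>M\<^esub> S) \<subseteq> H N"
    by (intro exI[of _ N]) auto
qed

theorem (in module) finitely_generated_imp_noetherian:
  assumes R: "noetherian_ring R" and fg: "finitely_generated_module R M"
  shows "noetherian_module R M"
proof -
  have "\<exists>S. submodule S R M \<and> A \<subseteq> S \<and> noetherian_in R M S" if "finite A" "A \<subseteq> carrier M" for A
    using that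
  proof (induction A rule: finite_induct)
    case empty
    have "submodule {\<zero>\<^bsub>M\<^esub>} R M" by (rule submoduleI) auto
    moreover have "noetherian_in R M {\<zero>\<^bsub>M\<^esub>}"
      unfolding noetherian_in_def ascending_submodules_def using submodule_zero by blast
    ultimately show ?case by blast
  next
    case (insert a A)
    then obtain S where S: "submodule S R M" "A \<subseteq> S" "noetherian_in R M S" by auto
    let ?C = "(\<lambda>r. r \<odot>\<^bsub>M\<^esub> a) ` carrier R"
    have a: "a \<in> carrier M" using insert by auto
    note C = cyclic_submodule[OF a]
    have "a \<in> ?C" using a by (intro image_eqI[of _ _ \<one>]) auto
    hence "insert a A \<subseteq> ?C <+>\<^bsub>M\<^esub> S" using S(2) submodule_sum_upper[OF C S(1)] by blast
    thus ?case using submodule_sum[OF C S(1)] noetherian_in_extend[OF R S(1,3) a] by blast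
  qed
  thus ?thesis using fg unfolding finitely_generated_module_def by metis
qed

text \<open>
  Without a maximal element, dependent choice would give a strictly ascending chain.
\<close>

lemma (in module) noetherian_maximal_submodule:
  assumes M: "noetherian_module R M" and P: "submodule N0 R M" "P N0"
  obtains N where "submodule N R M" "P N" "N0 \<subseteq> N"
    "\<And>N'. submodule N' R M \<Longrightarrow> P N' \<Longrightarrow> N \<subseteq> N' \<Longrightarrow> N' = N"
proof -
  have False if "\<And>N. submodule N R M \<Longrightarrow> P N \<Longrightarrow> N0 \<subseteq> N \<Longrightarrow> \<exists>N'. submodule N' R M \<and> P N' \<and> N \<subset> N'"
  proof -
    have "\<exists>H. \<forall>n. (submodule (H n) R M \<and> P (H n) \<and> N0 \<subseteq> H n) \<and> H n \<subset> H (Suc n)"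
      by (rule dependent_nat_choice) (use P that in \<open>blast+\<close>)
    then obtain H where H: "\<And>n. submodule (H n) R M" "\<And>n. H n \<subset> H (Suc n)" by blast
    hence "ascending_submodules R M H" by (auto simp: ascending_submodules_def)
    then obtain N where "\<forall>n\<ge>N. H n \<inter> carrier M \<subseteq> H N" using M unfolding noetherian_in_def by blast
    hence "H (Suc N) \<inter> carrier M \<subseteq> H N" using le_SucI by blast
    thus False using H(2)[of N] submoduleE(1)[OF H(1)[of "Suc N"]] by blast
  qed
  then obtain N where "submodule N R M" "P N" "N0 \<subseteq> N"
    "\<not> (\<exists>N'. submodule N' R M \<and> P N' \<and> N \<subset> N')" by blast
  thus ?thesis by (intro that[of N]) auto
qed

section \<open>Powers of ideals\<close>

context cring
begin

lemma ideals_set_simps: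
  "\<one>\<^bsub>ideals_set R\<^esub> = carrier R" "I \<otimes>\<^bsub>ideals_set R\<^esub> J = I \<cdot> J"
  by (simp_all add: ideals_set_def)

lemma regular_submodule_iff_ideal: "submodule H R (regular_module R) \<longleftrightarrow> ideal H R"
proof
  interpret G: module R "regular_module R" by (rule regular_module_is_module)
  have neg: "\<ominus>\<^bsub>regular_module R\<^esub> a = \<ominus> a" for a by (simp add: a_inv_def m_inv_def regular_module_def)
  assume H: "submodule H R (regular_module R)"
  note h = G.submoduleE[OF H] 
  show "ideal H R"
  proof (rule idealI)
    show "subgroup H (add_monoid R)"
      by (rule add.subgroupI)
        (use h(1,2,5) h(3)[unfolded neg] in \<open>auto simp: regular_module_def a_inv_def[symmetric]\<close>)
    show "x \<otimes> a \<in> H" if "a \<in> H" "x \<in> carrier R" for a x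
      using h(4)[OF that(2,1)] by (simp add: regular_module_def)
    thus "a \<otimes> x \<in> H" if "a \<in> H" "x \<in> carrier R" for a x
      using that h(1) m_comm[of a x] by (auto simp: regular_module_def)
  qed (rule ring_axioms)
next
  assume "ideal H R"
  from power_submodule[OF this, of 1] ideal_prod_one[OF this] ideal_prod_commute[OF oneideal this]
  show "submodule H R (regular_module R)" by (simp add: ideals_set_simps)
qed

lemma ideal_power_0: "ideal_power R I 0 = carrier R"
  by (simp add: ideals_set_def nat_pow_def)

lemma ideal_power_Suc: "ideal_power R I (Suc t) = ideal_power R I t \<cdot> I"
  by (simp add: ideals_set_def nat_pow_def)

lemma ideal_prod_subset:
  assumes "ideal A R" "\<And>i j. i \<in> I \<Longrightarrow> j \<in> J \<Longrightarrow> i \<otimes> j \<in> A"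
  shows "I \<cdot> J \<subseteq> A"
proof
  fix s assume "s \<in> I \<cdot> J"
  thus "s \<in> A"
    by (induction s rule: ideal_prod.induct)
      (use assms(2) additive_subgroup.a_closed[OF ideal.axioms(1)[OF assms(1)]] in auto)
qed

lemma power_mem_ideal_power:
  assumes "ideal I R" "x \<in> I" shows "x [^] t \<in> ideal_power R I t"
proof (induction t)
  case 0 thus ?case by (simp add: ideals_set_simps)
next
  case (Suc t) thus ?case using assms by (auto simp: ideals_set_simps intro: ideal_prod.prod)
qed

lemma ideal_sum_upper:
  assumes I: "ideal I R" and J: "ideal J R"
  shows "I \<subseteq> I <+>\<^bsub>R\<^esub> J" "J \<subseteq> I <+>\<^bsub>R\<^esub> J"
proof -
  have "I \<union> J \<subseteq> carrier R" using ideal.Icarr[OF I] ideal.Icarr[OF J] by blast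
  thus "I \<subseteq> I <+>\<^bsub>R\<^esub> J" "J \<subseteq> I <+>\<^bsub>R\<^esub> J" using genideal_self unfolding union_genideal[OF I J, symmetric] by blast+
qed

text \<open>
  In a product of \<open>p + q\<close> factors from \<open>I + J\<close>, every term of the expansion has \<open>p\<close> factors from \<open>I\<close>
  or \<open>q\<close> factors from \<open>J\<close>.
\<close>

lemma ideal_power_sum_subset:
  assumes I: "ideal I R" and J: "ideal J R"
  shows "ideal_power R (I <+>\<^bsub>R\<^esub> J) (p + q) \<subseteq> ideal_power R I p <+>\<^bsub>R\<^esub> ideal_power R J q"
proof (induction "p + q" arbitrary: p q)
  case 0
  thus ?case by (auto simp: ideals_set_simps set_add_def' intro!: bexI[of _ \<zero>])
next
  case (Suc n)
  note IJ = add_ideals[OF I J]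
  let ?A = "ideal_power R I" and ?B = "ideal_power R J"
  note id = ideal_power_ideal[OF I] ideal_power_ideal[OF J]
  have up: "?A p \<subseteq> ?A p <+>\<^bsub>R\<^esub> ?B q" "?B q \<subseteq> ?A p <+>\<^bsub>R\<^esub> ?B q"
    by (rule ideal_sum_upper[OF id])+
  have pq: "p + q = Suc n" using Suc by simp
  have main: "i \<otimes> j \<in> ?A p <+>\<^bsub>R\<^esub> ?B q" if i: "i \<in> ideal_power R (I <+>\<^bsub>R\<^esub> J) n" and j: "j \<in> I <+>\<^bsub>R\<^esub> J" for i j
  proof -
    interpret T: ideal "?A p <+>\<^bsub>R\<^esub> ?B q" R by (rule add_ideals[OF id])
    have ic: "i \<in> carrier R" using ideal.Icarr[OF ideal_power_ideal[OF IJ] i] .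
    obtain a b where ab: "a \<in> I" "b \<in> J" "j = a \<oplus> b" using j by (auto simp: set_add_def')
    have abc: "a \<in> carrier R" "b \<in> carrier R" using ab ideal.Icarr[OF I] ideal.Icarr[OF J] by auto
    have "i \<otimes> a \<in> ?A p <+>\<^bsub>R\<^esub> ?B q"
    proof (cases p)
      case 0 thus ?thesis using up(1) ic abc by (auto simp: ideals_set_simps)
    next
      case (Suc p')
      hence "i \<in> ?A p' <+>\<^bsub>R\<^esub> ?B q" using Suc.hyps(1)[of p' q] pq i by auto
      then obtain u v where uv: "u \<in> ?A p'" "v \<in> ?B q" "i = u \<oplus> v" by (auto simp: set_add_def')
      have uvc: "u \<in> carrier R" "v \<in> carrier R" using uv ideal.Icarr[OF id(1)] ideal.Icarr[OF id(2)] by auto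
      have "u \<otimes> a \<in> ?A p" unfolding Suc ideal_power_Suc using uv ab by (auto intro: ideal_prod.prod)
      moreover have "v \<otimes> a \<in> ?B q" using uv abc ideal.I_r_closed[OF id(2)] by auto
      moreover have "i \<otimes> a = u \<otimes> a \<oplus> v \<otimes> a" using uv uvc abc by (simp add: l_distr)
      ultimately show ?thesis by (auto simp: set_add_def')
    qed
    moreover have "i \<otimes> b \<in> ?A p <+>\<^bsub>R\<^esub> ?B q"
    proof (cases q)
      case 0 thus ?thesis using up(2) ic abc by (auto simp: ideals_set_simps)
    next
      case (Suc q')
      hence "i \<in> ?A p <+>\<^bsub>R\<^esub> ?B q'" using Suc.hyps(1)[of p q'] pq i by auto
      then obtain u v where uv: "u \<in> ?A p" "v \<in> ?B q'" "i = u \<oplus> v" by (auto simp: set_add_def')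
      have uvc: "u \<in> carrier R" "v \<in> carrier R" using uv ideal.Icarr[OF id(1)] ideal.Icarr[OF id(2)] by auto
      have "v \<otimes> b \<in> ?B q" unfolding Suc ideal_power_Suc using uv ab by (auto intro: ideal_prod.prod)
      moreover have "u \<otimes> b \<in> ?A p" using uv abc ideal.I_r_closed[OF id(1)] by auto
      moreover have "i \<otimes> b = u \<otimes> b \<oplus> v \<otimes> b" using uv uvc abc by (simp add: l_distr)
      ultimately show ?thesis by (auto simp: set_add_def')
    qed
    ultimately show ?thesis using ab abc ic by (simp add: r_distr T.a_closed)
  qed
  show ?case unfolding pq ideal_power_Suc by (rule ideal_prod_subset[OF add_ideals[OF id] main])
qed

lemma principal_power_subset:
  assumes J: "ideal J R" and x: "x \<in> carrier R" "x [^] (e::nat) \<in> J"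
  shows "ideal_power R (Idl {x}) e \<subseteq> J"
proof -
  have "ideal_power R (Idl {x}) k \<subseteq> PIdl (x [^] k)" for k :: nat
  proof (induction k)
    case 0
    have "y = y \<otimes> x [^] (0::nat)" if "y \<in> carrier R" for y using that by simp
    thus ?case unfolding ideal_power_0 cgenideal_def by blast
  next
    case (Suc k)
    show ?case unfolding ideal_power_Suc
    proof (rule ideal_prod_subset)
      show "ideal (PIdl (x [^] Suc k)) R" using x by (intro cgenideal_ideal) auto
      fix i j assume "i \<in> ideal_power R (Idl {x}) k" "j \<in> Idl {x}"
      then obtain r s where "r \<in> carrier R" "s \<in> carrier R" "i = r \<otimes> x [^] k" "j = s \<otimes> x"
        using Suc unfolding cgenideal_eq_genideal[OF x(1), symmetric] cgenideal_def by blast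
      moreover from this have "i \<otimes> j = (r \<otimes> s) \<otimes> (x [^] Suc k)" using x by (simp add: m_ac)
      ultimately show "i \<otimes> j \<in> PIdl (x [^] Suc k)" unfolding cgenideal_def by blast
    qed
  qed
  thus ?thesis using cgenideal_minimal[OF J x(2)] by blast
qed

text \<open>
  Chain conditions yield statements about powers of a single generator; local cohomology is defined by
  powers of the ideal. By the previous lemmas the ideals with a power in \<open>J\<close> are closed under sums.
\<close>

lemma ideal_power_subset_if_generator_powers:
  assumes "finite X" "X \<subseteq> carrier R" "ideal J R" "\<And>x. x \<in> X \<Longrightarrow> \<exists>e::nat. x [^] e \<in> J"
  shows "\<exists>t. ideal_power R (Idl X) t \<subseteq> J"
  using assms(1,2,4)
proof (induction X rule: finite_induct)
  case empty
  have "Idl {} \<subseteq> J" using genideal_minimal[OF assms(3)] by auto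
  moreover have "ideal_power R (Idl {}) 1 \<subseteq> Idl {}"
    using ideal_prod_inter[OF oneideal genideal_ideal[of "{}"]] by (simp add: ideals_set_simps)
  ultimately show ?case by blast
next
  case (insert x X)
  obtain t where t: "ideal_power R (Idl X) t \<subseteq> J" using insert by auto
  obtain e :: nat where e: "x [^] e \<in> J" using insert.prems(2)[of x] by blast
  have x: "x \<in> carrier R" using insert by auto
  have Ix: "ideal (Idl {x}) R" "ideal (Idl X) R" using x insert by (auto intro: genideal_ideal)
  have "insert x X \<subseteq> Idl {x} <+>\<^bsub>R\<^esub> Idl X"
    using ideal_sum_upper[OF Ix] genideal_self[of "{x}"] genideal_self[of X] x insert.prems(1) by blast
  hence "Idl (insert x X) \<subseteq> Idl {x} <+>\<^bsub>R\<^esub> Idl X" by (rule genideal_minimal[OF add_ideals[OF Ix]])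
  moreover have "Idl {x} <+>\<^bsub>R\<^esub> Idl X \<subseteq> Idl (insert x X)"
  proof -
    have *: "ideal (Idl (insert x X)) R" "insert x X \<subseteq> Idl (insert x X)"
      using insert.prems(1) by (intro genideal_ideal genideal_self, simp)+
    hence "Idl {x} \<union> Idl X \<subseteq> Idl (insert x X)" by (intro Un_least genideal_minimal) auto
    thus ?thesis unfolding union_genideal[OF Ix, symmetric] using *(1) by (intro genideal_minimal)
  qed
  ultimately have eq: "Idl (insert x X) = Idl {x} <+>\<^bsub>R\<^esub> Idl X" by blast
  have "ideal_power R (Idl (insert x X)) (e + t) \<subseteq> ideal_power R (Idl {x}) e <+>\<^bsub>R\<^esub> ideal_power R (Idl X) t"
    unfolding eq by (rule ideal_power_sum_subset[OF Ix])
  also have "\<dots> \<subseteq> J"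
  proof
    fix y assume "y \<in> ideal_power R (Idl {x}) e <+>\<^bsub>R\<^esub> ideal_power R (Idl X) t"
    then obtain u v where "u \<in> ideal_power R (Idl {x}) e" "v \<in> ideal_power R (Idl X) t" "y = u \<oplus> v"
      by (auto simp: set_add_def')
    moreover from this have "u \<in> J" "v \<in> J" using principal_power_subset[OF assms(3) x e] t by blast+
    ultimately show "y \<in> J" using additive_subgroup.a_closed[OF ideal.axioms(1)[OF assms(3)]] by simp
  qed
  finally show ?case by blast
qed

text \<open>
  The product of ideals is generated by the products of their elements. The induction replaces the
  target \<open>A\<close> by \<open>A : j\<close> for an element \<open>j\<close> of the last factor.
\<close>

lemma ideal_finprod_subset:
  fixes J :: "nat \<Rightarrow> 'a set"
  assumes J: "\<And>i. ideal (J i) R" and A: "ideal A R"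
    and r: "\<And>r. (\<And>i. r i \<in> J i) \<Longrightarrow> (\<Otimes>i\<in>{..n}. r i) \<in> A"
  shows "(\<Otimes>\<^bsub>ideals_set R\<^esub> i\<in>{..n}. J i) \<subseteq> A"
  using A r
proof (induction n arbitrary: A)
  interpret S: comm_monoid "ideals_set R" by (rule ideals_set_is_comm_monoid)
  have Jc: "J \<in> UNIV \<rightarrow> carrier (ideals_set R)" using J by (auto simp: ideals_set_def)
  have z: "\<zero> \<in> J i" for i using J by (simp add: additive_subgroup.zero_closed ideal.axioms(1))
  have c: "x \<in> carrier R" if "x \<in> J i" for x i using ideal.Icarr[OF J that] .
  {
    case 0
    have "x \<in> A" if "x \<in> J 0" for x
      using 0(2)[of "(\<lambda>_. \<zero>)(0 := x)"] that z c by simp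
    moreover have "(\<Otimes>\<^bsub>ideals_set R\<^esub> i\<in>{..0}. J i) = J 0" by (rule S.finprod_0) (use Jc in auto)
    ultimately show ?case by blast
  next
    case (Suc n)
    have m: "(\<otimes>\<^bsub>ideals_set R\<^esub>) = ideal_prod R" by (simp add: ideals_set_def)
    have "j \<otimes> i \<in> A" if i: "i \<in> (\<Otimes>\<^bsub>ideals_set R\<^esub> i\<in>{..n}. J i)" and j: "j \<in> J (Suc n)" for i j
    proof -
      have "(\<Otimes>\<^bsub>ideals_set R\<^esub> i\<in>{..n}. J i) \<subseteq> {r \<in> carrier R. \<forall>x\<in>{j}. r \<odot>\<^bsub>regular_module R\<^esub> x \<in> A}"
      proof (rule Suc.IH)
        show "ideal {r \<in> carrier R. \<forall>x\<in>{j}. r \<odot>\<^bsub>regular_module R\<^esub> x \<in> A} R"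
        proof (rule module.colon_ideal[OF regular_module_is_module])
          show "{j} \<subseteq> carrier (regular_module R)" using c[OF j] by (simp add: regular_module_def)
          show "submodule A R (regular_module R)"
            unfolding regular_submodule_iff_ideal by (rule Suc.prems(1))
        qed
        fix r assume r: "\<And>i. r i \<in> J i"
        let ?r = "r(Suc n := j)"
        have "(\<Otimes>i\<in>{..Suc n}. ?r i) = ?r (Suc n) \<otimes> (\<Otimes>i\<in>{..n}. ?r i)"
          by (rule finprod_Suc) (use j c in \<open>auto intro: c[OF r]\<close>)
        also have "(\<Otimes>i\<in>{..n}. ?r i) = (\<Otimes>i\<in>{..n}. r i)"
          by (rule finprod_cong') (auto intro: c[OF r])
        finally have "j \<otimes> (\<Otimes>i\<in>{..n}. r i) \<in> A" using Suc.prems(2)[of ?r] r j by auto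
        moreover have "(\<Otimes>i\<in>{..n}. r i) \<in> carrier R" by (rule finprod_closed) (auto intro: c[OF r])
        ultimately show "(\<Otimes>i\<in>{..n}. r i) \<in> {r \<in> carrier R. \<forall>x\<in>{j}. r \<odot>\<^bsub>regular_module R\<^esub> x \<in> A}"
          using c[OF j] by (auto simp: regular_module_def m_comm)
      qed
      thus ?thesis using i c[OF j] by (auto simp: regular_module_def m_comm)
    qed
    hence "J (Suc n) \<cdot> (\<Otimes>\<^bsub>ideals_set R\<^esub> i\<in>{..n}. J i) \<subseteq> A"
      by (intro ideal_prod_subset[OF Suc.prems(1)])
    thus ?case using Jc by (subst S.finprod_Suc) (auto simp: m)
  }
qed

lemma ideal_power_finprod_mono:
  fixes J :: "nat \<Rightarrow> 'a set"
  assumes A: "ideal A R" and J: "\<And>i. ideal (J i) R" "\<And>i. A \<subseteq> J i"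
  shows "ideal_power R A (Suc n) \<subseteq> (\<Otimes>\<^bsub>ideals_set R\<^esub> i\<in>{..n}. J i)"
proof (induction n)
  interpret S: comm_monoid "ideals_set R" by (rule ideals_set_is_comm_monoid)
  have Jc: "J \<in> UNIV \<rightarrow> carrier (ideals_set R)" using J by (auto simp: ideals_set_def)
  have m: "(\<otimes>\<^bsub>ideals_set R\<^esub>) = ideal_prod R" by (simp add: ideals_set_def)
  {
    case 0
    have "ideal_power R A (Suc 0) \<subseteq> A"
      using ideal_prod_inter[OF oneideal A] by (simp add: ideals_set_simps)
    moreover have "(\<Otimes>\<^bsub>ideals_set R\<^esub> i\<in>{..0}. J i) = J 0" by (rule S.finprod_0) (use Jc in auto)
    ultimately show ?case using J(2)[of 0] by blast
  next
    case (Suc n)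
    have P: "ideal (\<Otimes>\<^bsub>ideals_set R\<^esub> i\<in>{..n}. J i) R"
      using S.finprod_closed[of J "{..n}"] Jc by (auto simp: ideals_set_def)
    have "ideal_power R A (Suc (Suc n)) \<subseteq> (\<Otimes>\<^bsub>ideals_set R\<^esub> i\<in>{..n}. J i) \<cdot> J (Suc n)"
      unfolding ideal_power_Suc[of A "Suc n"]
    proof (rule ideal_prod_subset[OF ideal_prod_is_ideal[OF P J(1)]])
      fix i j assume "i \<in> ideal_power R A (Suc n)" "j \<in> A"
      thus "i \<otimes> j \<in> (\<Otimes>\<^bsub>ideals_set R\<^esub> i\<in>{..n}. J i) \<cdot> J (Suc n)"
        using Suc J(2)[of "Suc n"] by (intro ideal_prod.prod) blast+
    qed
    also have "\<dots> = J (Suc n) \<cdot> (\<Otimes>\<^bsub>ideals_set R\<^esub> i\<in>{..n}. J i)" by (rule ideal_prod_commute[OF P J(1)])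
    also have "\<dots> = (\<Otimes>\<^bsub>ideals_set R\<^esub> i\<in>{..Suc n}. J i)" using Jc by (subst S.finprod_Suc) (auto simp: m)
    finally show ?case .
  }
qed

end

section \<open>The lemma of Artin and Rees and the intersection theorem of Krull\<close>

definition ideal_times_module ::
    "('a, 'r) ring_scheme \<Rightarrow> 'a set \<Rightarrow> ('a, 'b, 'm) module_scheme \<Rightarrow> 'b set" where
  "ideal_times_module R I M =
     \<Inter>{H. submodule H R M \<and> (\<forall>r \<in> I. \<forall>x \<in> carrier M. r \<odot>\<^bsub>M\<^esub> x \<in> H)}"

context module
begin

lemma ideal_times_module_subset:
  assumes "submodule H R M" "\<And>r x. r \<in> I \<Longrightarrow> x \<in> carrier M \<Longrightarrow> r \<odot>\<^bsub>M\<^esub> x \<in> H"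
  shows "ideal_times_module R I M \<subseteq> H"
  using assms unfolding ideal_times_module_def by blast

lemma smult_mem_ideal_times_module:
  "r \<in> I \<Longrightarrow> x \<in> carrier M \<Longrightarrow> r \<odot>\<^bsub>M\<^esub> x \<in> ideal_times_module R I M"
  unfolding ideal_times_module_def by blast

lemma ideal_times_module_submodule:
  assumes "I \<subseteq> carrier R" shows "submodule (ideal_times_module R I M) R M"
proof (rule submoduleI)
  have "ideal_times_module R I M \<subseteq> carrier M"
    using assms by (intro ideal_times_module_subset carrier_is_submodule) auto
  thus "ideal_times_module R I M \<subseteq> carrier M" .
qed (auto simp: ideal_times_module_def submodule_zero submoduleE(3-5))

text \<open>
  Choose \<open>N\<close> maximal among the submodules with \<open>N \<inter> L \<subseteq> P\<close>. Enlarging \<open>N\<close> by \<open>x\<^sup>e M\<close> preserves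
  this property once \<open>N : x\<^sup>e\<close> is stationary, so \<open>x\<^sup>e M \<subseteq> N\<close> for each generator \<open>x\<close>, and
  hence \<open>a\<^sup>t M \<subseteq> N\<close> for some \<open>t\<close>. For \<open>P = a\<^sup>k L\<close> this is the classical weak form of the
  lemma of Artin and Rees.
\<close>

theorem artin_rees:
  assumes M: "noetherian_module R M" and X: "finite X" "X \<subseteq> carrier R"
    and L: "submodule L R M" and P: "submodule P R M" "P \<subseteq> L"
    and pow: "\<And>x. x \<in> X \<Longrightarrow> \<exists>e::nat. \<forall>l \<in> L. (x [^] e) \<odot>\<^bsub>M\<^esub> l \<in> P"
  shows "\<exists>t. ideal_times_module R (ideal_power R (Idl X) t) M \<inter> L \<subseteq> P"
proof -
  have "P \<inter> L \<subseteq> P" by blast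
  from noetherian_maximal_submodule[OF M P(1), of "\<lambda>N. N \<inter> L \<subseteq> P", OF this]
  obtain N where N: "submodule N R M" "N \<inter> L \<subseteq> P" "P \<subseteq> N"
    and Nmax: "\<And>N'. submodule N' R M \<Longrightarrow> N' \<inter> L \<subseteq> P \<Longrightarrow> N \<subseteq> N' \<Longrightarrow> N' = N" by metis
  have nc: "y \<in> carrier M" if "y \<in> N" for y using submoduleE(1)[OF N(1)] that by auto
  define J where "J = {r \<in> carrier R. \<forall>m \<in> carrier M. r \<odot>\<^bsub>M\<^esub> m \<in> N}"
  have J: "ideal J R" unfolding J_def by (rule colon_ideal[OF subset_refl N(1)])
  have "\<exists>e::nat. x [^] e \<in> J" if xX: "x \<in> X" for x
  proof -
    have x: "x \<in> carrier R" using xX X by auto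
    obtain k :: nat where k: "\<And>l. l \<in> L \<Longrightarrow> (x [^] k) \<odot>\<^bsub>M\<^esub> l \<in> P" using pow[OF xX] by blast
    \<comment> \<open>the submodules of elements that some power of \<open>x\<close> moves into \<open>N\<close> become stationary\<close>
    define H where "H e = {m \<in> carrier M. (x [^] (e::nat)) \<odot>\<^bsub>M\<^esub> m \<in> N}" for e
    have "submodule (H e) R M" for e
    proof (rule submoduleI)
      fix r m assume "r \<in> carrier R" "m \<in> H e"
      moreover have "(x [^] e) \<odot>\<^bsub>M\<^esub> (r \<odot>\<^bsub>M\<^esub> m) = r \<odot>\<^bsub>M\<^esub> ((x [^] e) \<odot>\<^bsub>M\<^esub> m)"
        if "r \<in> carrier R" "m \<in> carrier M" using that x by (simp add: smult_assoc1[symmetric] R.m_comm)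
      ultimately show "r \<odot>\<^bsub>M\<^esub> m \<in> H e" by (auto simp: H_def submoduleE(4)[OF N(1)])
    qed (use x in \<open>auto simp: H_def submodule_zero[OF N(1)] smult_r_minus smult_r_distr submoduleE(3,5)[OF N(1)]\<close>)
    moreover have "H e \<subseteq> H (Suc e)" for e
    proof
      fix m assume m: "m \<in> H e"
      have "(x [^] Suc e) \<odot>\<^bsub>M\<^esub> m = x \<odot>\<^bsub>M\<^esub> ((x [^] e) \<odot>\<^bsub>M\<^esub> m)"
        using m x by (simp add: H_def smult_assoc1[symmetric] R.m_comm)
      thus "m \<in> H (Suc e)" using m x submoduleE(4)[OF N(1)] by (simp add: H_def)
    qed
    ultimately have asc: "ascending_submodules R M H" by (auto simp: ascending_submodules_def)
    then obtain E where "\<forall>n\<ge>E. H n \<inter> carrier M \<subseteq> H E" using M unfolding noetherian_in_def by blast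
    hence E: "m \<in> H E" if "m \<in> H n" "n \<ge> E" for m n using that unfolding H_def by blast
    define K where "K = (\<lambda>m. (x [^] E) \<odot>\<^bsub>M\<^esub> m) ` carrier M"
    have K: "submodule K R M" unfolding K_def by (rule multiples_submodule) (use x in auto)
    \<comment> \<open>if \<open>y = n + x\<^sup>E m\<close> lies in \<open>L\<close>, then \<open>x\<^sup>k y\<close> lies in \<open>P\<close>, so \<open>x\<^sup>k\<^sup>+\<^sup>E m\<close> and already \<open>x\<^sup>E m\<close> lie in \<open>N\<close>\<close>
    have "(N <+>\<^bsub>M\<^esub> K) \<inter> L \<subseteq> P"
    proof
      fix y assume "y \<in> (N <+>\<^bsub>M\<^esub> K) \<inter> L"
      then obtain n m where y: "y \<in> L" "n \<in> N" "m \<in> carrier M" "y = n \<oplus>\<^bsub>M\<^esub> (x [^] E) \<odot>\<^bsub>M\<^esub> m"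
        by (auto simp: set_add_def' K_def)
      have c: "n \<in> carrier M" "y \<in> carrier M" "x [^] k \<in> carrier R" "x [^] E \<in> carrier R"
        using y nc x submoduleE(1)[OF L] by auto
      have xn: "(x [^] k) \<odot>\<^bsub>M\<^esub> n \<in> N" using c y submoduleE(4)[OF N(1)] by auto
      have "(x [^] (k + E)) \<odot>\<^bsub>M\<^esub> m = (x [^] k) \<odot>\<^bsub>M\<^esub> ((x [^] E) \<odot>\<^bsub>M\<^esub> m)"
        using c x y by (simp add: smult_assoc1[symmetric] R.nat_pow_mult)
      also have "(x [^] E) \<odot>\<^bsub>M\<^esub> m = \<ominus>\<^bsub>M\<^esub> n \<oplus>\<^bsub>M\<^esub> y"
        using c y by (simp add: M.a_assoc[symmetric] M.l_neg)
      also have "(x [^] k) \<odot>\<^bsub>M\<^esub> (\<ominus>\<^bsub>M\<^esub> n \<oplus>\<^bsub>M\<^esub> y) = \<ominus>\<^bsub>M\<^esub> ((x [^] k) \<odot>\<^bsub>M\<^esub> n) \<oplus>\<^bsub>M\<^esub> (x [^] k) \<odot>\<^bsub>M\<^esub> y"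
        using c by (simp add: smult_r_distr smult_r_minus)
      also have "\<dots> \<in> N" using xn k[OF y(1)] N(3) by (intro submoduleE(5)[OF N(1)] submoduleE(3)[OF N(1)]) auto
      finally have "m \<in> H (k + E)" using y by (simp add: H_def)
      hence "(x [^] E) \<odot>\<^bsub>M\<^esub> m \<in> N" using E[of m "k + E"] by (simp add: H_def)
      hence "y \<in> N" unfolding y(4) using y(2) by (intro submoduleE(5)[OF N(1)])
      thus "y \<in> P" using N(2) y(1) by blast
    qed
    hence "N <+>\<^bsub>M\<^esub> K = N" by (intro Nmax submodule_sum N(1) K submodule_sum_upper)
    hence "K \<subseteq> N" using submodule_sum_upper(2)[OF N(1) K] by simp
    hence "x [^] E \<in> J" using x by (auto simp: J_def K_def)
    thus ?thesis ..
  qed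
  from R.ideal_power_subset_if_generator_powers[OF X J this]
  obtain t where "ideal_power R (Idl X) t \<subseteq> J" by blast
  hence "ideal_times_module R (ideal_power R (Idl X) t) M \<subseteq> N"
    by (intro ideal_times_module_subset N(1)) (auto simp: J_def)
  thus ?thesis using N(2) by blast
qed

end

context noetherian_local_ring
begin

text \<open>
  The maximal ideal above \<open>A\<close> comes from the maximal condition on the submodules of \<open>R\<close> itself.
\<close>

lemma proper_ideal_subset_maximal:
  assumes A: "ideal A R" "\<one> \<notin> A" shows "A \<subseteq> \<mm>"
proof -
  interpret G: module R "regular_module R" by (rule regular_module_is_module)
  have "H = carrier R" if "ideal H R" "\<one> \<in> H" for H using ideal.one_imp_carrier[OF that] .
  hence "finitely_generated_module R (regular_module R)"
    unfolding finitely_generated_module_def regular_submodule_iff_ideal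
    by (intro exI[of _ "{\<one>}"]) (auto simp: regular_module_def)
  hence "noetherian_module R (regular_module R)"
    by (rule G.finitely_generated_imp_noetherian[OF noetherian_ring_axioms])
  from G.noetherian_maximal_submodule[OF this, of A "\<lambda>N. \<one> \<notin> N"] A
  obtain N where N: "ideal N R" "\<one> \<notin> N" "A \<subseteq> N"
    and max: "\<And>N'. ideal N' R \<Longrightarrow> \<one> \<notin> N' \<Longrightarrow> N \<subseteq> N' \<Longrightarrow> N' = N"
    unfolding regular_submodule_iff_ideal by metis
  have "maximalideal N R"
  proof (rule maximalidealI[OF N(1)])
    show "carrier R \<noteq> N" using N(2) one_closed by blast
    fix J assume "ideal J R" "N \<subseteq> J" "J \<subseteq> carrier R"
    thus "J = N \<or> J = carrier R" using max[of J] ideal.one_imp_carrier[of J R] by blast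
  qed
  from unique[OF this] N(3) show ?thesis by simp
qed

lemma one_minus_notin_maximal:
  assumes "\<alpha> \<in> \<mm>" shows "\<one> \<oplus> \<ominus> \<alpha> \<notin> \<mm>"
proof
  interpret mm: maximalideal \<mm> R by (rule maximalideal)
  assume "\<one> \<oplus> \<ominus> \<alpha> \<in> \<mm>"
  hence "(\<one> \<oplus> \<ominus> \<alpha>) \<oplus> \<alpha> \<in> \<mm>" using assms by simp
  hence "\<one> \<in> \<mm>" using assms by (simp add: a_assoc l_neg)
  thus False using mm.one_imp_carrier mm.I_notcarr by simp
qed

text \<open>
  Let \<open>a\<close> be the ideal generated by \<open>X\<close>. The lemma of Artin and Rees for \<open>Rl\<close> and its submodule \<open>al\<close>
  gives \<open>l = \<alpha>l\<close> with \<open>\<alpha>\<close> in \<open>a\<close>. So the annihilator of \<open>l\<close> contains \<open>1 - \<alpha>\<close>, which lies outside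
  the maximal ideal and hence in no proper ideal.
\<close>

theorem krull_intersection:
  assumes "module R M" and M: "noetherian_module R M"
    and X: "finite X" "X \<subseteq> \<mm>" and l: "l \<in> carrier M"
    and mem: "\<And>t. l \<in> ideal_times_module R (ideal_power R (Idl X) t) M"
  shows "l = \<zero>\<^bsub>M\<^esub>"
proof -
  interpret module R M by fact
  interpret mm: maximalideal \<mm> R by (rule maximalideal)
  have Xc: "X \<subseteq> carrier R" using X mm.a_subset by blast
  interpret a: ideal "Idl X" R by (rule genideal_ideal[OF Xc])
  define L where "L = (\<lambda>r. r \<odot>\<^bsub>M\<^esub> l) ` carrier R"
  define P where "P = (\<lambda>r. r \<odot>\<^bsub>M\<^esub> l) ` (Idl X)"
  have L: "submodule L R M" unfolding L_def by (rule cyclic_submodule[OF l])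
  have P: "submodule P R M" unfolding P_def
  proof (rule submoduleI)
    show "\<zero>\<^bsub>M\<^esub> \<in> (\<lambda>r. r \<odot>\<^bsub>M\<^esub> l) ` (Idl X)" using l by (intro image_eqI[of _ _ \<zero>]) auto
  qed (use l in \<open>auto simp: smult_l_minus[symmetric] smult_l_distr[symmetric] smult_assoc1[symmetric] a.I_l_closed\<close>)
  have "\<exists>t. ideal_times_module R (ideal_power R (Idl X) t) M \<inter> L \<subseteq> P"
  proof (rule artin_rees[OF M X(1) Xc L P])
    show "P \<subseteq> L" unfolding L_def P_def using a.a_subset by blast
    fix x assume x: "x \<in> X"
    have xa: "x \<in> Idl X" using genideal_self[OF Xc] x by blast
    have "(x [^] (1::nat)) \<odot>\<^bsub>M\<^esub> y \<in> P" if "y \<in> L" for y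
      using that x Xc xa l unfolding L_def P_def
      by (auto simp: smult_assoc1[symmetric] a.I_r_closed subset_iff intro!: imageI)
    thus "\<exists>e::nat. \<forall>l\<in>L. (x [^] e) \<odot>\<^bsub>M\<^esub> l \<in> P" by blast
  qed
  moreover have "l \<in> L" unfolding L_def using l by (intro image_eqI[of _ _ \<one>]) auto
  ultimately have "l \<in> P" using mem by blast
  then obtain \<alpha> where \<alpha>: "\<alpha> \<in> Idl X" "l = \<alpha> \<odot>\<^bsub>M\<^esub> l" unfolding P_def by blast
  have \<alpha>m: "\<alpha> \<in> \<mm>" using genideal_minimal[OF mm.is_ideal X(2)] \<alpha>(1) by blast
  have \<alpha>c: "\<alpha> \<in> carrier R" using \<alpha>(1) by simp
  define A where "A = {r \<in> carrier R. \<forall>x \<in> {l}. r \<odot>\<^bsub>M\<^esub> x \<in> {\<zero>\<^bsub>M\<^esub>}}"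
  have z: "submodule {\<zero>\<^bsub>M\<^esub>} R M" by (rule submoduleI) auto
  have A: "ideal A R" unfolding A_def by (rule colon_ideal[OF _ z]) (use l in auto)
  have "(\<one> \<oplus> \<ominus> \<alpha>) \<odot>\<^bsub>M\<^esub> l = \<one> \<odot>\<^bsub>M\<^esub> l \<oplus>\<^bsub>M\<^esub> \<ominus>\<^bsub>M\<^esub> (\<alpha> \<odot>\<^bsub>M\<^esub> l)"
    using l \<alpha>c by (subst smult_l_distr) (auto simp: smult_l_minus)
  also have "\<dots> = \<zero>\<^bsub>M\<^esub>" unfolding \<alpha>(2)[symmetric] using l by (simp add: M.r_neg)
  finally have in_A: "\<one> \<oplus> \<ominus> \<alpha> \<in> A" using \<alpha>c by (simp add: A_def)
  have "\<one> \<in> A"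
  proof (rule ccontr)
    assume "\<one> \<notin> A"
    hence "\<one> \<oplus> \<ominus> \<alpha> \<in> \<mm>" using proper_ideal_subset_maximal[OF A] in_A by blast
    thus False using one_minus_notin_maximal[OF \<alpha>m] by blast
  qed
  thus ?thesis using l by (simp add: A_def)
qed

end

section \<open>Finite powers of a module\<close>

text \<open>
  The direct product of copies of \<open>M\<close>, one for each element of \<open>B\<close>. Its elements vanish off \<open>B\<close>, so
  that addition, scalar multiplication and the Koszul differential are given by the same formulas for
  every \<open>B\<close>.
\<close>

definition function_module ::
    "('a, 'b, 'm) module_scheme \<Rightarrow> 'g set \<Rightarrow> ('a, 'g \<Rightarrow> 'b) module" where
  "function_module M B = \<lparr>carrier = {f. (\<forall>b \<in> B. f b \<in> carrier M) \<and> (\<forall>b. b \<notin> B \<longrightarrow> f b = \<zero>\<^bsub>M\<^esub>)},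
     monoid.mult = undefined, one = undefined,
     ring.zero = (\<lambda>_. \<zero>\<^bsub>M\<^esub>), ring.add = (\<lambda>f g b. f b \<oplus>\<^bsub>M\<^esub> g b), smult = (\<lambda>r f b. r \<odot>\<^bsub>M\<^esub> f b)\<rparr>"

lemma function_module_sel [simp]:
  "\<zero>\<^bsub>function_module M B\<^esub> = (\<lambda>_. \<zero>\<^bsub>M\<^esub>)"
  "f \<oplus>\<^bsub>function_module M B\<^esub> g = (\<lambda>b. f b \<oplus>\<^bsub>M\<^esub> g b)"
  "r \<odot>\<^bsub>function_module M B\<^esub> f = (\<lambda>b. r \<odot>\<^bsub>M\<^esub> f b)"
  by (simp_all add: function_module_def)

context module
begin

lemma function_module_carrier:
  "f \<in> carrier (function_module M B) \<longleftrightarrow> (\<forall>b. f b \<in> carrier M) \<and> (\<forall>b. b \<notin> B \<longrightarrow> f b = \<zero>\<^bsub>M\<^esub>)"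
  unfolding function_module_def by auto

lemma function_module_is_module: "module R (function_module M B)"
proof (rule moduleI[OF is_cring abelian_groupI], goal_cases)
  case (6 f)
  thus ?case
    by (intro bexI[of _ "\<lambda>b. \<ominus>\<^bsub>M\<^esub> f b"]) (auto simp: function_module_carrier M.l_neg)
qed (auto simp: function_module_carrier M.a_ac smult_l_distr smult_r_distr smult_assoc1)

lemma function_module_finitely_generated:
  fixes B :: "'g set"
  assumes fg: "finitely_generated_module R M" and B: "finite B"
  shows "finitely_generated_module R (function_module M B)"
proof -
  from fg obtain A where A: "finite A" "A \<subseteq> carrier M"
    and gen: "\<And>H. submodule H R M \<Longrightarrow> A \<subseteq> H \<Longrightarrow> H = carrier M"
    unfolding finitely_generated_module_def by blast
  interpret F: module R "function_module M B" by (rule function_module_is_module)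
  \<comment> \<open>the inclusion of the factor \<open>M\<close> with index \<open>b\<close>\<close>
  define \<delta> where "\<delta> b m = (\<lambda>c. if c = b then m else \<zero>\<^bsub>M\<^esub>)" for b :: 'g and m
  define S where "S = (\<Union>b\<in>B. \<delta> b ` A)"
  have \<delta>c: "\<delta> b m \<in> carrier (function_module M B)" if "b \<in> B" "m \<in> carrier M" for b m
    using that by (auto simp: function_module_carrier \<delta>_def)
  have "H = carrier (function_module M B)"
    if H: "submodule H R (function_module M B)" and SH: "S \<subseteq> H" for H
  proof
    note h = F.submoduleE[OF H]
    show "H \<subseteq> carrier (function_module M B)" by (rule h(1))
    have \<delta>H: "\<delta> b m \<in> H" if b: "b \<in> B" and m: "m \<in> carrier M" for b m
    proof -
      have "submodule {m \<in> carrier M. \<delta> b m \<in> H} R M"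
      proof (rule submoduleI)
        have e: "\<delta> b \<zero>\<^bsub>M\<^esub> = \<zero>\<^bsub>function_module M B\<^esub>" by (auto simp: \<delta>_def)
        show "\<zero>\<^bsub>M\<^esub> \<in> {m \<in> carrier M. \<delta> b m \<in> H}" using F.submodule_zero[OF H] unfolding e[symmetric] by simp
        have s: "\<delta> b (r \<odot>\<^bsub>M\<^esub> x) = r \<odot>\<^bsub>function_module M B\<^esub> \<delta> b x" if "r \<in> carrier R" for r x
          using that by (auto simp: \<delta>_def)
        show sm: "r \<odot>\<^bsub>M\<^esub> x \<in> {m \<in> carrier M. \<delta> b m \<in> H}"
          if "r \<in> carrier R" "x \<in> {m \<in> carrier M. \<delta> b m \<in> H}" for r x
          using that h(4)[of r "\<delta> b x"] s by simp
        show "\<ominus>\<^bsub>M\<^esub> x \<in> {m \<in> carrier M. \<delta> b m \<in> H}" if "x \<in> {m \<in> carrier M. \<delta> b m \<in> H}" for x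
          using sm[of "\<ominus> \<one>" x] that by (simp add: smult_l_minus)
        show "x \<oplus>\<^bsub>M\<^esub> y \<in> {m \<in> carrier M. \<delta> b m \<in> H}"
          if x: "x \<in> {m \<in> carrier M. \<delta> b m \<in> H}" and y: "y \<in> {m \<in> carrier M. \<delta> b m \<in> H}" for x y
        proof -
          have "\<delta> b (x \<oplus>\<^bsub>M\<^esub> y) = \<delta> b x \<oplus>\<^bsub>function_module M B\<^esub> \<delta> b y" by (auto simp: \<delta>_def)
          thus ?thesis using x y h(5)[of "\<delta> b x" "\<delta> b y"] by simp
        qed
      qed auto
      moreover have "A \<subseteq> {m \<in> carrier M. \<delta> b m \<in> H}" using A SH b by (auto simp: S_def)
      ultimately show ?thesis using gen[of "{m \<in> carrier M. \<delta> b m \<in> H}"] m by blast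
    qed
    have "f \<in> H" if "finite C" "C \<subseteq> B" "\<And>b. f b \<in> carrier M" "\<And>b. b \<notin> C \<Longrightarrow> f b = \<zero>\<^bsub>M\<^esub>" for f C
      using that
    proof (induction C arbitrary: f rule: finite_induct)
      case empty
      hence "f = \<zero>\<^bsub>function_module M B\<^esub>" by auto
      thus ?case using F.submodule_zero[OF H] by simp
    next
      case (insert b C)
      have "f(b := \<zero>\<^bsub>M\<^esub>) \<in> H" by (rule insert.IH) (use insert.prems in auto)
      moreover have "\<delta> b (f b) \<in> H" using insert.prems by (intro \<delta>H) auto
      moreover have "f = \<delta> b (f b) \<oplus>\<^bsub>function_module M B\<^esub> f(b := \<zero>\<^bsub>M\<^esub>)"
        using insert.prems by (auto simp: \<delta>_def fun_eq_iff)
      ultimately show ?case using h(5)[of "\<delta> b (f b)" "f(b := \<zero>\<^bsub>M\<^esub>)"] by simp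
    qed
    thus "carrier (function_module M B) \<subseteq> H" using B by (auto simp: function_module_carrier)
  qed
  moreover have "finite S" using A B by (auto simp: S_def)
  moreover have "S \<subseteq> carrier (function_module M B)" using A \<delta>c by (auto simp: S_def)
  ultimately show ?thesis unfolding finitely_generated_module_def by blast
qed

end

section \<open>The Koszul complex\<close>

text \<open>
  A word of length \<open>n\<close> with \<open>i\<close> entries \<^const>\<open>True\<close> stands for a subset of \<open>{1, \<dots>, n}\<close> with \<open>i\<close>
  elements, that is, for a basis vector of the \<open>i\<close>-th exterior power of a free module of rank \<open>n\<close>.
\<close>

definition koszul_index :: "nat \<Rightarrow> nat \<Rightarrow> bool list set" where
  "koszul_index n i = {T. length T = n \<and> count_list T True = i}"

text \<open>
  The recursion builds the Koszul complex of \<open>y, ys\<close> as the mapping cone of multiplication by \<open>y\<close> on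
  the Koszul complex of \<open>ys\<close>: a chain is a pair of chains for \<open>ys\<close>, indexed by the first letter. One
  function serves all degrees.
\<close>

fun koszul_diff :: "('a, 'b, 'm) module_scheme \<Rightarrow> 'a list \<Rightarrow> (bool list \<Rightarrow> 'b) \<Rightarrow> bool list \<Rightarrow> 'b" where
  "koszul_diff M [] f T = \<zero>\<^bsub>M\<^esub>"
| "koszul_diff M (y # ys) f [] = \<zero>\<^bsub>M\<^esub>"
| "koszul_diff M (y # ys) f (False # T) =
     koszul_diff M ys (\<lambda>S. f (False # S)) T \<oplus>\<^bsub>M\<^esub> y \<odot>\<^bsub>M\<^esub> f (True # T)"
| "koszul_diff M (y # ys) f (True # T) = \<ominus>\<^bsub>M\<^esub> koszul_diff M ys (\<lambda>S. f (True # S)) T"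

definition koszul_module ::
    "('a, 'b, 'm) module_scheme \<Rightarrow> 'a list \<Rightarrow> nat \<Rightarrow> ('a, bool list \<Rightarrow> 'b) module" where
  "koszul_module M ys i = function_module M (koszul_index (length ys) i)"

lemma finite_koszul_index: "finite (koszul_index n i)"
  using finite_lists_length_eq[of "UNIV :: bool set" n]
  by (rule rev_finite_subset) (auto simp: koszul_index_def)

lemma koszul_index_Cons [simp]:
  "[] \<in> koszul_index n i \<longleftrightarrow> n = 0 \<and> i = 0"
  "False # T \<in> koszul_index (Suc n) i \<longleftrightarrow> T \<in> koszul_index n i"
  "True # T \<in> koszul_index (Suc n) (Suc i) \<longleftrightarrow> T \<in> koszul_index n i"
  "True # T \<notin> koszul_index (Suc n) 0"
  by (auto simp: koszul_index_def)

lemma koszul_index_empty: "n < i \<Longrightarrow> koszul_index n i = {}"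
  using count_le_length[of _ True] by (auto simp: koszul_index_def) (metis leD)

lemma bool_list_cases:
  obtains "T = []" | S where "T = False # S" | S where "T = True # S"
  by (metis (full_types) list.exhaust)

context module
begin

lemma koszul_diff_closed:
  "set ys \<subseteq> carrier R \<Longrightarrow> (\<And>T. f T \<in> carrier M) \<Longrightarrow> koszul_diff M ys f T \<in> carrier M"
proof (induction ys arbitrary: f T)
  case (Cons y ys) thus ?case by (cases T rule: bool_list_cases) auto
qed simp

lemma koszul_diff_add:
  assumes "set ys \<subseteq> carrier R" "\<And>T. f T \<in> carrier M" "\<And>T. g T \<in> carrier M"
  shows "koszul_diff M ys (\<lambda>T. f T \<oplus>\<^bsub>M\<^esub> g T) T = koszul_diff M ys f T \<oplus>\<^bsub>M\<^esub> koszul_diff M ys g T"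
  using assms
proof (induction ys arbitrary: f g T)
  case (Cons y ys)
  have IH: "koszul_diff M ys (\<lambda>S. f (b # S) \<oplus>\<^bsub>M\<^esub> g (b # S)) T
      = koszul_diff M ys (\<lambda>S. f (b # S)) T \<oplus>\<^bsub>M\<^esub> koszul_diff M ys (\<lambda>S. g (b # S)) T" for b T
    by (rule Cons.IH) (use Cons.prems in auto)
  have c: "koszul_diff M ys (\<lambda>S. f (b # S)) T \<in> carrier M" "koszul_diff M ys (\<lambda>S. g (b # S)) T \<in> carrier M" for b T
    using Cons.prems by (auto intro!: koszul_diff_closed)
  show ?case
    using Cons.prems c by (cases T rule: bool_list_cases) (auto simp: IH M.minus_add smult_r_distr M.a_ac)
qed auto

lemma koszul_diff_smult:
  assumes "set ys \<subseteq> carrier R" "\<And>T. f T \<in> carrier M" "r \<in> carrier R"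
  shows "koszul_diff M ys (\<lambda>T. r \<odot>\<^bsub>M\<^esub> f T) T = r \<odot>\<^bsub>M\<^esub> koszul_diff M ys f T"
  using assms
proof (induction ys arbitrary: f T)
  case (Cons y ys)
  have IH: "koszul_diff M ys (\<lambda>S. r \<odot>\<^bsub>M\<^esub> f (b # S)) T = r \<odot>\<^bsub>M\<^esub> koszul_diff M ys (\<lambda>S. f (b # S)) T" for b T
    by (rule Cons.IH) (use Cons.prems in auto)
  have c: "koszul_diff M ys (\<lambda>S. f (b # S)) T \<in> carrier M" for b T
    using Cons.prems by (auto intro!: koszul_diff_closed)
  have "y \<odot>\<^bsub>M\<^esub> (r \<odot>\<^bsub>M\<^esub> x) = r \<odot>\<^bsub>M\<^esub> (y \<odot>\<^bsub>M\<^esub> x)" if "x \<in> carrier M" for x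
    using that Cons.prems by (simp add: smult_assoc1[symmetric] R.m_comm)
  thus ?case
    using Cons.prems c by (cases T rule: bool_list_cases) (auto simp: IH smult_r_minus smult_r_distr)
qed auto

lemma koszul_diff_minus:
  assumes "set ys \<subseteq> carrier R" "\<And>T. f T \<in> carrier M"
  shows "koszul_diff M ys (\<lambda>T. \<ominus>\<^bsub>M\<^esub> f T) T = \<ominus>\<^bsub>M\<^esub> koszul_diff M ys f T"
  using koszul_diff_smult[OF assms, of "\<ominus> \<one>"] assms koszul_diff_closed[OF assms]
  by (simp add: smult_l_minus)

lemma koszul_diff_zero: "set ys \<subseteq> carrier R \<Longrightarrow> koszul_diff M ys (\<lambda>_. \<zero>\<^bsub>M\<^esub>) T = \<zero>\<^bsub>M\<^esub>"
  using koszul_diff_smult[of ys "\<lambda>_. \<zero>\<^bsub>M\<^esub>" \<zero> T] koszul_diff_closed[of ys "\<lambda>_. \<zero>\<^bsub>M\<^esub>" T] by simp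

lemma koszul_diff_diff:
  assumes "set ys \<subseteq> carrier R" "\<And>T. f T \<in> carrier M"
  shows "koszul_diff M ys (koszul_diff M ys f) T = \<zero>\<^bsub>M\<^esub>"
  using assms
proof (induction ys arbitrary: f T)
  case (Cons y ys)
  have ys: "set ys \<subseteq> carrier R" and y: "y \<in> carrier R" using Cons.prems by auto
  have f: "f (b # T) \<in> carrier M" for b T using Cons.prems by auto
  have c: "koszul_diff M ys (\<lambda>S. f (b # S)) T \<in> carrier M" for b T
    using Cons.prems by (auto intro!: koszul_diff_closed)
  have IH: "koszul_diff M ys (koszul_diff M ys (\<lambda>S. f (b # S))) T = \<zero>\<^bsub>M\<^esub>" for b T
    by (rule Cons.IH) (use Cons.prems in auto)
  show ?case
  proof (cases T rule: bool_list_cases)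
    case (2 U)
    have "koszul_diff M ys (\<lambda>S. koszul_diff M ys (\<lambda>S. f (False # S)) S \<oplus>\<^bsub>M\<^esub> y \<odot>\<^bsub>M\<^esub> f (True # S)) U =
        y \<odot>\<^bsub>M\<^esub> koszul_diff M ys (\<lambda>S. f (True # S)) U"
      using f c y ys koszul_diff_closed[OF ys, of "\<lambda>S. f (True # S)"]
      by (simp add: koszul_diff_add koszul_diff_smult IH)
    thus ?thesis using f c y 2 by (simp add: smult_r_minus M.r_neg)
  next
    case (3 U)
    thus ?thesis using f c y ys by (simp add: koszul_diff_minus IH)
  qed simp
qed simp

lemma koszul_diff_degree_0:
  assumes "set ys \<subseteq> carrier R" "\<And>T. T \<notin> koszul_index (length ys) 0 \<Longrightarrow> f T = \<zero>\<^bsub>M\<^esub>"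
  shows "koszul_diff M ys f T = \<zero>\<^bsub>M\<^esub>"
  using assms
proof (induction ys arbitrary: f T)
  case (Cons y ys)
  have IH: "koszul_diff M ys (\<lambda>S. f (b # S)) T = \<zero>\<^bsub>M\<^esub>" for b T
    by (rule Cons.IH) (use Cons.prems in \<open>cases b; auto\<close>)+
  show ?case using Cons.prems by (cases T rule: bool_list_cases) (auto simp: IH koszul_diff_zero)
qed simp

lemma koszul_diff_degree:
  assumes "set ys \<subseteq> carrier R" "\<And>T. T \<notin> koszul_index (length ys) (Suc i) \<Longrightarrow> f T = \<zero>\<^bsub>M\<^esub>"
    and "T \<notin> koszul_index (length ys) i"
  shows "koszul_diff M ys f T = \<zero>\<^bsub>M\<^esub>"
  using assms
proof (induction ys arbitrary: f T i)
  case (Cons y ys)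
  have ys: "set ys \<subseteq> carrier R" and y: "y \<in> carrier R" using Cons.prems by auto
  show ?case
  proof (cases T rule: bool_list_cases)
    case (2 U)
    have "koszul_diff M ys (\<lambda>S. f (False # S)) U = \<zero>\<^bsub>M\<^esub>"
      by (rule Cons.IH[OF ys, of i]) (use 2 Cons.prems in auto)
    moreover have "f (True # U) = \<zero>\<^bsub>M\<^esub>" using 2 Cons.prems by auto
    ultimately show ?thesis using y 2 by simp
  next
    case (3 U)
    have "koszul_diff M ys (\<lambda>S. f (True # S)) U = \<zero>\<^bsub>M\<^esub>"
    proof (cases i)
      case 0 thus ?thesis by (intro koszul_diff_degree_0[OF ys]) (use Cons.prems in auto)
    next
      case (Suc j) thus ?thesis by (intro Cons.IH[OF ys, of j]) (use 3 Cons.prems in auto)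
    qed
    thus ?thesis using 3 by simp
  qed simp
qed simp

lemma koszul_diff_augmentation:
  assumes "set ys \<subseteq> carrier R" "\<And>T. f T \<in> carrier M" and H: "submodule H R M"
    and "\<And>y x. y \<in> set ys \<Longrightarrow> x \<in> carrier M \<Longrightarrow> y \<odot>\<^bsub>M\<^esub> x \<in> H"
  shows "koszul_diff M ys f (replicate (length ys) False) \<in> H"
  using assms(1,2,4)
proof (induction ys arbitrary: f)
  case Nil thus ?case using submodule_zero[OF H] by simp
next
  case (Cons y ys) thus ?case by (auto intro!: submoduleE(5)[OF H])
qed

text \<open>
  A power of each \<open>z\<close> in \<open>ys\<close> kills the homology. If \<open>z\<close> is the first element, moving the component
  without \<open>z\<close> to the component with \<open>z\<close> is a homotopy from multiplication by \<open>z\<close> to zero. If \<open>z\<close>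
  occurs later, a power \<open>c\<close> of it works for each of the two copies in the mapping cone, so \<open>c\<^sup>2\<close> works
  for the cone: first make \<open>c f\<^sub>1\<close> a boundary, then correct \<open>c f\<^sub>0\<close> to a cycle.
\<close>

lemma koszul_homology_killed:
  assumes "set ys \<subseteq> carrier R" "z \<in> set ys"
  shows "\<exists>N::nat. \<forall>i. \<forall>f \<in> carrier (koszul_module M ys i). koszul_diff M ys f = (\<lambda>_. \<zero>\<^bsub>M\<^esub>) \<longrightarrow>
     (\<exists>w \<in> carrier (koszul_module M ys (Suc i)). koszul_diff M ys w = (\<lambda>T. (z [^] N) \<odot>\<^bsub>M\<^esub> f T))"
  using assms
proof (induction ys)
  case (Cons y ys)
  have ys: "set ys \<subseteq> carrier R" and y: "y \<in> carrier R" and z: "z \<in> carrier R" using Cons.prems by auto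
  show ?case
  proof (cases "z \<in> set ys")
    case False
    hence zy: "z = y" using Cons.prems by auto
    show ?thesis
    proof (intro exI[of _ 1] allI ballI impI)
      fix i f assume f: "f \<in> carrier (koszul_module M (y # ys) i)" and df: "koszul_diff M (y # ys) f = (\<lambda>_. \<zero>\<^bsub>M\<^esub>)"
      have fc: "f T \<in> carrier M" for T using f by (auto simp: koszul_module_def function_module_carrier)
      define w where "w T = (case T of True # S \<Rightarrow> f (False # S) | _ \<Rightarrow> \<zero>\<^bsub>M\<^esub>)" for T
      have w: "w [] = \<zero>\<^bsub>M\<^esub>" "w (False # S) = \<zero>\<^bsub>M\<^esub>" "w (True # S) = f (False # S)" for S
        by (simp_all add: w_def)
      have "w T \<in> carrier M \<and> (T \<notin> koszul_index (Suc (length ys)) (Suc i) \<longrightarrow> w T = \<zero>\<^bsub>M\<^esub>)" for T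
        using f by (cases T rule: bool_list_cases) (auto simp: w koszul_module_def function_module_carrier)
      hence wK: "w \<in> carrier (koszul_module M (y # ys) (Suc i))"
        by (auto simp: koszul_module_def function_module_carrier)
      have "koszul_diff M (y # ys) w T = y \<odot>\<^bsub>M\<^esub> f T" for T
      proof (cases T rule: bool_list_cases)
        case 1 thus ?thesis using f y by (auto simp: koszul_module_def function_module_carrier)
      next
        case (2 S) thus ?thesis using fc y ys by (simp add: w koszul_diff_zero)
      next
        case (3 S)
        have c: "koszul_diff M ys (\<lambda>S. f (False # S)) S \<in> carrier M" using fc ys by (intro koszul_diff_closed)
        have "koszul_diff M ys (\<lambda>S. f (False # S)) S \<oplus>\<^bsub>M\<^esub> y \<odot>\<^bsub>M\<^esub> f (True # S) = \<zero>\<^bsub>M\<^esub>"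
          using fun_cong[OF df, of "False # S"] by simp
        hence "\<ominus>\<^bsub>M\<^esub> koszul_diff M ys (\<lambda>S. f (False # S)) S = y \<odot>\<^bsub>M\<^esub> f (True # S)"
          using c fc y M.minus_equality[of "y \<odot>\<^bsub>M\<^esub> f (True # S)"] by (simp add: M.a_comm)
        thus ?thesis by (simp add: w 3)
      qed
      hence "koszul_diff M (y # ys) w = (\<lambda>T. (z [^] (1::nat)) \<odot>\<^bsub>M\<^esub> f T)" using zy y by auto
      thus "\<exists>w\<in>carrier (koszul_module M (y # ys) (Suc i)). koszul_diff M (y # ys) w = (\<lambda>T. (z [^] (1::nat)) \<odot>\<^bsub>M\<^esub> f T)"
        using wK by blast
    qed
  next
    case True
    then obtain N :: nat where N: "\<And>i f. f \<in> carrier (koszul_module M ys i) \<Longrightarrow> koszul_diff M ys f = (\<lambda>_. \<zero>\<^bsub>M\<^esub>) \<Longrightarrow>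
       \<exists>w \<in> carrier (koszul_module M ys (Suc i)). koszul_diff M ys w = (\<lambda>T. (z [^] N) \<odot>\<^bsub>M\<^esub> f T)"
      using Cons.IH[OF ys] by blast
    define c where "c = z [^] N"
    have cR: "c \<in> carrier R" using z by (simp add: c_def)
    show ?thesis
    proof (intro exI[of _ "N + N"] allI ballI impI)
      fix i f assume f: "f \<in> carrier (koszul_module M (y # ys) i)" and df: "koszul_diff M (y # ys) f = (\<lambda>_. \<zero>\<^bsub>M\<^esub>)"
      have fc: "f T \<in> carrier M" for T using f by (auto simp: koszul_module_def function_module_carrier)
      define f0 where "f0 S = f (False # S)" for S
      define f1 where "f1 S = f (True # S)" for S
      have f01c: "f0 S \<in> carrier M" "f1 S \<in> carrier M" for S using fc by (auto simp: f0_def f1_def)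
      have d01: "koszul_diff M ys f0 S \<in> carrier M" "koszul_diff M ys f1 S \<in> carrier M" for S
        using f01c ys by (auto intro: koszul_diff_closed)
      have df0: "koszul_diff M ys f0 S \<oplus>\<^bsub>M\<^esub> y \<odot>\<^bsub>M\<^esub> f1 S = \<zero>\<^bsub>M\<^esub>" for S
        using fun_cong[OF df, of "False # S"] by (simp add: f0_def[abs_def] f1_def)
      have "\<ominus>\<^bsub>M\<^esub> koszul_diff M ys f1 S = \<zero>\<^bsub>M\<^esub>" for S
        using fun_cong[OF df, of "True # S"] by (simp add: f1_def[abs_def])
      hence "koszul_diff M ys f1 S = \<zero>\<^bsub>M\<^esub>" for S using M.r_neg[OF d01(2)[of S]] d01(2)[of S] by simp
      hence df1: "koszul_diff M ys f1 = (\<lambda>_. \<zero>\<^bsub>M\<^esub>)" by blast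
      have "\<exists>w1 \<in> carrier (koszul_module M ys i). koszul_diff M ys w1 = (\<lambda>T. c \<odot>\<^bsub>M\<^esub> f1 T)"
      proof (cases i)
        case 0
        have "f1 = (\<lambda>_. \<zero>\<^bsub>M\<^esub>)" using f by (auto simp: 0 f1_def koszul_module_def function_module_carrier)
        thus ?thesis using cR ys
          by (intro bexI[of _ "\<lambda>_. \<zero>\<^bsub>M\<^esub>"]) (auto simp: koszul_diff_zero koszul_module_def function_module_carrier)
      next
        case (Suc j)
        have "f1 \<in> carrier (koszul_module M ys j)"
          using f by (auto simp: Suc f1_def koszul_module_def function_module_carrier)
        thus ?thesis using N[of f1 j] df1 by (simp add: Suc c_def)
      qed
      then obtain w1 where w1: "w1 \<in> carrier (koszul_module M ys i)" "koszul_diff M ys w1 = (\<lambda>T. c \<odot>\<^bsub>M\<^esub> f1 T)" by blast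
      have w1c: "w1 T \<in> carrier M" for T using w1 by (auto simp: koszul_module_def function_module_carrier)
      define g where "g T = c \<odot>\<^bsub>M\<^esub> f0 T \<oplus>\<^bsub>M\<^esub> y \<odot>\<^bsub>M\<^esub> w1 T" for T
      have "f0 \<in> carrier (koszul_module M ys i)"
        using f by (auto simp: f0_def koszul_module_def function_module_carrier)
      hence g: "g \<in> carrier (koszul_module M ys i)"
        using w1 cR y by (auto simp: g_def koszul_module_def function_module_carrier)
      have "koszul_diff M ys g T = c \<odot>\<^bsub>M\<^esub> (koszul_diff M ys f0 T \<oplus>\<^bsub>M\<^esub> y \<odot>\<^bsub>M\<^esub> f1 T)" for T
      proof -
        have "koszul_diff M ys g T = c \<odot>\<^bsub>M\<^esub> koszul_diff M ys f0 T \<oplus>\<^bsub>M\<^esub> y \<odot>\<^bsub>M\<^esub> (c \<odot>\<^bsub>M\<^esub> f1 T)"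
          unfolding g_def[abs_def] using f01c w1c cR y ys
          by (simp add: koszul_diff_add koszul_diff_smult w1(2))
        also have "y \<odot>\<^bsub>M\<^esub> (c \<odot>\<^bsub>M\<^esub> f1 T) = c \<odot>\<^bsub>M\<^esub> (y \<odot>\<^bsub>M\<^esub> f1 T)"
          using f01c cR y by (simp add: smult_assoc1[symmetric] R.m_comm)
        finally show ?thesis using f01c d01 cR y by (simp add: smult_r_distr)
      qed
      hence "koszul_diff M ys g = (\<lambda>_. \<zero>\<^bsub>M\<^esub>)" using cR by (auto simp: df0)
      from N[OF g this] obtain w0 where w0: "w0 \<in> carrier (koszul_module M ys (Suc i))"
        "koszul_diff M ys w0 = (\<lambda>T. c \<odot>\<^bsub>M\<^esub> g T)" unfolding c_def by blast
      define w where "w T = (case T of [] \<Rightarrow> \<zero>\<^bsub>M\<^esub> | b # S \<Rightarrow> if b then \<ominus>\<^bsub>M\<^esub> (c \<odot>\<^bsub>M\<^esub> w1 S) else w0 S)" for T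
      have w: "w [] = \<zero>\<^bsub>M\<^esub>" "w (False # S) = w0 S" "w (True # S) = \<ominus>\<^bsub>M\<^esub> (c \<odot>\<^bsub>M\<^esub> w1 S)" for S
        by (simp_all add: w_def)
      have "w T \<in> carrier M \<and> (T \<notin> koszul_index (Suc (length ys)) (Suc i) \<longrightarrow> w T = \<zero>\<^bsub>M\<^esub>)" for T
        using w0(1) w1(1) cR by (cases T rule: bool_list_cases) (auto simp: w koszul_module_def function_module_carrier)
      hence wK: "w \<in> carrier (koszul_module M (y # ys) (Suc i))"
        by (auto simp: koszul_module_def function_module_carrier)
      have "koszul_diff M (y # ys) w T = c \<odot>\<^bsub>M\<^esub> (c \<odot>\<^bsub>M\<^esub> f T)" for T
      proof (cases T rule: bool_list_cases)
        case 1 thus ?thesis using f cR by (auto simp: koszul_module_def function_module_carrier)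
      next
        case (2 S)
        have e: "c \<odot>\<^bsub>M\<^esub> (y \<odot>\<^bsub>M\<^esub> w1 S) = y \<odot>\<^bsub>M\<^esub> (c \<odot>\<^bsub>M\<^esub> w1 S)"
          using w1c cR y by (simp add: smult_assoc1[symmetric] R.m_comm)
        have "koszul_diff M (y # ys) w (False # S) =
            (c \<odot>\<^bsub>M\<^esub> (c \<odot>\<^bsub>M\<^esub> f0 S) \<oplus>\<^bsub>M\<^esub> y \<odot>\<^bsub>M\<^esub> (c \<odot>\<^bsub>M\<^esub> w1 S)) \<oplus>\<^bsub>M\<^esub> \<ominus>\<^bsub>M\<^esub> (y \<odot>\<^bsub>M\<^esub> (c \<odot>\<^bsub>M\<^esub> w1 S))"
          using f01c w1c cR y by (simp add: w w0(2) g_def smult_r_distr smult_r_minus e)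
        thus ?thesis using f01c w1c cR y 2 by (simp add: M.a_assoc M.r_neg f0_def)
      next
        case (3 S)
        show ?thesis using f01c w1c cR ys 3
          by (simp add: w koszul_diff_minus koszul_diff_smult w1(2)) (simp add: f1_def)
      qed
      moreover have "(z [^] (N + N)) \<odot>\<^bsub>M\<^esub> f T = c \<odot>\<^bsub>M\<^esub> (c \<odot>\<^bsub>M\<^esub> f T)" for T
        using fc cR z by (simp add: c_def smult_assoc1[symmetric] R.nat_pow_mult)
      ultimately have "koszul_diff M (y # ys) w = (\<lambda>T. (z [^] (N + N)) \<odot>\<^bsub>M\<^esub> f T)" by auto
      thus "\<exists>w\<in>carrier (koszul_module M (y # ys) (Suc i)).
          koszul_diff M (y # ys) w = (\<lambda>T. (z [^] (N + N)) \<odot>\<^bsub>M\<^esub> f T)" using wK by blast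
    qed
  qed
qed simp

lemma koszul_module_is_module: "module R (koszul_module M ys i)"
  unfolding koszul_module_def by (rule function_module_is_module)

lemma koszul_diff_linear:
  assumes "set ys \<subseteq> carrier R"
  shows "linear_map R (koszul_module M ys (Suc i)) (koszul_module M ys i) (koszul_diff M ys)"
  by (intro linear_map.intro linear_map_axioms.intro koszul_module_is_module)
    (auto simp: koszul_module_def function_module_carrier koszul_diff_add koszul_diff_smult assms
      koszul_diff_closed intro!: koszul_diff_degree[OF assms, of i])

end

section \<open>Linear maps\<close>

lemma hom_linear_map:
  assumes "module R A" "module R B" "f \<in> module_hom R A B" shows "linear_map R A B f"
  using assms by (intro linear_map.intro linear_map_axioms.intro) (auto simp: module_hom_def)

lemma linear_map_compose:
  assumes "linear_map R A B f" "linear_map R B C g" shows "linear_map R A C (\<lambda>x. g (f x))"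
proof -
  interpret f: linear_map R A B f by fact
  interpret g: linear_map R B C g by fact
  show ?thesis
    by (intro linear_map.intro linear_map_axioms.intro f.N.module_axioms g.N'.module_axioms)
      (auto simp: f.f_closed f.f_add f.f_smult g.f_closed g.f_add g.f_smult)
qed

lemma linear_map_smult:
  assumes "linear_map R A B f" "r \<in> carrier R" shows "linear_map R A B (\<lambda>x. r \<odot>\<^bsub>B\<^esub> f x)"
proof -
  interpret f: linear_map R A B f by fact
  show ?thesis
    by (intro linear_map.intro linear_map_axioms.intro f.N.module_axioms f.N'.module_axioms)
      (use assms(2) in \<open>auto simp: f.f_closed f.f_add f.f_smult f.N'.smult_r_distr f.N'.smult_assoc1[symmetric] f.N.R.m_comm\<close>)
qed

lemma linear_map_add:
  assumes "linear_map R A B f" "linear_map R A B g" shows "linear_map R A B (\<lambda>x. f x \<oplus>\<^bsub>B\<^esub> g x)"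
proof -
  interpret f: linear_map R A B f by fact
  interpret g: linear_map R A B g by fact
  show ?thesis
    by (intro linear_map.intro linear_map_axioms.intro f.N.module_axioms f.N'.module_axioms)
      (auto simp: f.f_closed f.f_add f.f_smult g.f_closed g.f_add g.f_smult f.N'.smult_r_distr f.N'.M.a_ac)
qed

lemma (in linear_map) f_minus:
  assumes "x \<in> carrier N" shows "f (\<ominus>\<^bsub>N\<^esub> x) = \<ominus>\<^bsub>N'\<^esub> f x"
proof -
  have "f (\<ominus>\<^bsub>N\<^esub> x) \<oplus>\<^bsub>N'\<^esub> f x = \<zero>\<^bsub>N'\<^esub>"
    using assms by (simp add: f_add[symmetric] f_zero N.M.l_neg)
  thus ?thesis using assms by (simp add: N'.M.minus_equality f_closed)
qed

lemma linear_map_minus: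
  assumes "linear_map R A B f" shows "linear_map R A B (\<lambda>x. \<ominus>\<^bsub>B\<^esub> f x)"
proof -
  interpret f: linear_map R A B f by fact
  show ?thesis
    by (intro linear_map.intro linear_map_axioms.intro f.N.module_axioms f.N'.module_axioms)
      (auto simp: f.f_closed f.f_add f.f_smult f.N'.smult_r_minus f.N'.M.minus_add)
qed

lemma (in linear_map) image_submodule:
  assumes H: "submodule H R N" shows "submodule (f ` H) R N'"
proof (rule N'.submoduleI)
  note h = N.submoduleE[OF H]
  have c: "x \<in> carrier N" if "x \<in> H" for x using h(1) that by blast
  show "f ` H \<subseteq> carrier N'" using c f_closed by auto
  show "\<zero>\<^bsub>N'\<^esub> \<in> f ` H" using N.submodule_zero[OF H] f_zero by (metis imageI)
  show "\<ominus>\<^bsub>N'\<^esub> a \<in> f ` H" if "a \<in> f ` H" for a using that h(3) by (auto simp: f_minus[symmetric] c)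
  show "a \<oplus>\<^bsub>N'\<^esub> b \<in> f ` H" if "a \<in> f ` H" "b \<in> f ` H" for a b
    using that h(5) by (auto simp: f_add[symmetric] c)
  show "r \<odot>\<^bsub>N'\<^esub> a \<in> f ` H" if "r \<in> carrier R" "a \<in> f ` H" for r a
    using that h(4) by (auto simp: f_smult[symmetric] c)
qed

lemma (in module) submodule_finsum:
  assumes H: "submodule H R M" and f: "\<And>a. a \<in> A \<Longrightarrow> f a \<in> H" shows "finsum M f A \<in> H"
  using f
proof (induction A rule: infinite_finite_induct)
  case (insert a A)
  have "f a \<in> carrier M" "f \<in> A \<rightarrow> carrier M" using insert submoduleE(1)[OF H] by auto
  thus ?case using insert submoduleE(5)[OF H] by simp
qed (auto simp: submodule_zero[OF H])

section \<open>Strict exactness of the Koszul complex\<close>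

text \<open>
  Let \<open>L\<close> be the module of cycles and \<open>P\<close> the image of \<open>a\<^sup>k K\<^bsub>i+1\<^esub>\<close>. If \<open>y\<^sup>N\<close> kills the homology,
  where \<open>y = x\<^sup>s\<close>, then \<open>x\<^sup>k y\<^sup>N\<close> maps \<open>L\<close> into \<open>P\<close>, and the lemma of Artin and Rees applies.
\<close>

lemma (in module) koszul_strictly_exact:
  assumes R: "noetherian_ring R" and fg: "finitely_generated_module R M"
    and X: "finite X" "X \<subseteq> carrier R" and ys: "set ys \<subseteq> carrier R"
    and Xys: "\<And>x. x \<in> X \<Longrightarrow> \<exists>s::nat. x [^] s \<in> set ys"
  shows "\<exists>l. \<forall>f \<in> ideal_times_module R (ideal_power R (Idl X) l) (koszul_module M ys i).
     koszul_diff M ys f = (\<lambda>_. \<zero>\<^bsub>M\<^esub>) \<longrightarrow>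
     (\<exists>w \<in> ideal_times_module R (ideal_power R (Idl X) k) (koszul_module M ys (Suc i)). koszul_diff M ys w = f)"
proof -
  let ?K = "koszul_module M ys" and ?d = "koszul_diff M ys"
  interpret K: module R "?K i" by (rule koszul_module_is_module)
  interpret K': module R "?K (Suc i)" by (rule koszul_module_is_module)
  interpret d: linear_map R "?K (Suc i)" "?K i" ?d by (rule koszul_diff_linear[OF ys])
  have sel: "\<zero>\<^bsub>?K j\<^esub> = (\<lambda>_. \<zero>\<^bsub>M\<^esub>)" "f \<oplus>\<^bsub>?K j\<^esub> g = (\<lambda>T. f T \<oplus>\<^bsub>M\<^esub> g T)"
    "r \<odot>\<^bsub>?K j\<^esub> f = (\<lambda>T. r \<odot>\<^bsub>M\<^esub> f T)" for j f g r by (simp_all add: koszul_module_def)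
  have Kc: "f T \<in> carrier M" if "f \<in> carrier (?K j)" for f T j
    using that by (auto simp: koszul_module_def function_module_carrier)
  have aI: "ideal (Idl X) R" by (rule R.genideal_ideal[OF X(2)])
  have ak: "ideal_power R (Idl X) k \<subseteq> carrier R" for k
    using ideal.Icarr[OF R.ideal_power_ideal[OF aI]] by blast
  have noeth: "noetherian_module R (?K i)"
    unfolding koszul_module_def
    by (intro module.finitely_generated_imp_noetherian function_module_is_module R
        function_module_finitely_generated fg finite_koszul_index)
  define V where "V = ideal_times_module R (ideal_power R (Idl X) k) (?K (Suc i))"
  have V: "submodule V R (?K (Suc i))" unfolding V_def by (rule K'.ideal_times_module_submodule[OF ak])
  have Vc: "v \<in> carrier (?K (Suc i))" if "v \<in> V" for v using K'.submoduleE(1)[OF V] that by blast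
  define L where "L = {f \<in> carrier (?K i). ?d f = (\<lambda>_. \<zero>\<^bsub>M\<^esub>)}"
  have L: "submodule L R (?K i)"
  proof (rule K.submoduleI)
    show sm: "r \<odot>\<^bsub>?K i\<^esub> f \<in> L" if "r \<in> carrier R" "f \<in> L" for r f
    proof -
      have "?d (\<lambda>T. r \<odot>\<^bsub>M\<^esub> f T) T = \<zero>\<^bsub>M\<^esub>" for T
        using that Kc[of f i] by (subst koszul_diff_smult[OF ys]) (auto simp: L_def)
      thus ?thesis using that K.smult_closed[of r f] by (auto simp: L_def sel)
    qed
    show "\<ominus>\<^bsub>?K i\<^esub> f \<in> L" if "f \<in> L" for f
    proof -
      have "f \<in> carrier (?K i)" using that by (simp add: L_def)
      hence "\<ominus>\<^bsub>?K i\<^esub> f = (\<ominus> \<one>) \<odot>\<^bsub>?K i\<^esub> f" by (simp add: K.smult_l_minus)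
      thus ?thesis using sm[of "\<ominus> \<one>" f] that by simp
    qed
    show "f \<oplus>\<^bsub>?K i\<^esub> g \<in> L" if "f \<in> L" "g \<in> L" for f g
    proof -
      have "?d (\<lambda>T. f T \<oplus>\<^bsub>M\<^esub> g T) T = \<zero>\<^bsub>M\<^esub>" for T
        using that Kc[of f i] Kc[of g i] by (subst koszul_diff_add[OF ys]) (auto simp: L_def)
      thus ?thesis using that K.M.a_closed[of f g] by (auto simp: L_def sel)
    qed
    show "\<zero>\<^bsub>?K i\<^esub> \<in> L" using K.M.zero_closed koszul_diff_zero[OF ys] by (auto simp: L_def sel)
  qed (auto simp: L_def)
  have "\<exists>t. ideal_times_module R (ideal_power R (Idl X) t) (?K i) \<inter> L \<subseteq> ?d ` V"
  proof (rule K.artin_rees[OF noeth X L d.image_submodule[OF V]])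
    show "?d ` V \<subseteq> L"
    proof
      fix f assume "f \<in> ?d ` V"
      then obtain v where v: "v \<in> V" "f = ?d v" by blast
      have "?d (?d v) T = \<zero>\<^bsub>M\<^esub>" for T by (rule koszul_diff_diff[OF ys]) (rule Kc[OF Vc[OF v(1)]])
      thus "f \<in> L" using v Vc d.f_closed by (auto simp: L_def)
    qed
    fix x assume x: "x \<in> X"
    hence xc: "x \<in> carrier R" using X by auto
    obtain s :: nat where s: "x [^] s \<in> set ys" using Xys[OF x] by blast
    obtain N :: nat where N: "\<And>i f. f \<in> carrier (?K i) \<Longrightarrow> ?d f = (\<lambda>_. \<zero>\<^bsub>M\<^esub>) \<Longrightarrow>
        \<exists>w \<in> carrier (?K (Suc i)). ?d w = (\<lambda>T. ((x [^] s) [^] N) \<odot>\<^bsub>M\<^esub> f T)"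
      using koszul_homology_killed[OF ys s] by blast
    have "(x [^] (k + s * N)) \<odot>\<^bsub>?K i\<^esub> f \<in> ?d ` V" if f: "f \<in> L" for f
    proof -
      have fK: "f \<in> carrier (?K i)" using f by (simp add: L_def)
      from f obtain w where w: "w \<in> carrier (?K (Suc i))" "?d w = ((x [^] s) [^] N) \<odot>\<^bsub>?K i\<^esub> f"
        using N[of f i] by (auto simp: L_def sel)
      have "(x [^] (k + s * N)) \<odot>\<^bsub>?K i\<^esub> f = (x [^] k) \<odot>\<^bsub>?K i\<^esub> ?d w"
        unfolding w(2) using xc fK by (simp add: K.smult_assoc1[symmetric] R.nat_pow_mult R.nat_pow_pow)
      also have "\<dots> = ?d ((x [^] k) \<odot>\<^bsub>?K (Suc i)\<^esub> w)" using xc w by (simp add: d.f_smult)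
      finally have "(x [^] (k + s * N)) \<odot>\<^bsub>?K i\<^esub> f = ?d ((x [^] k) \<odot>\<^bsub>?K (Suc i)\<^esub> w)" .
      moreover have "x \<in> Idl X" using R.genideal_self[OF X(2)] x by blast
      hence "(x [^] k) \<odot>\<^bsub>?K (Suc i)\<^esub> w \<in> V"
        unfolding V_def using w by (intro K'.smult_mem_ideal_times_module R.power_mem_ideal_power aI)
      ultimately show ?thesis by blast
    qed
    thus "\<exists>e::nat. \<forall>f\<in>L. (x [^] e) \<odot>\<^bsub>?K i\<^esub> f \<in> ?d ` V" by blast
  qed
  then obtain t where t: "ideal_times_module R (ideal_power R (Idl X) t) (?K i) \<inter> L \<subseteq> ?d ` V" by blast
  have "\<exists>w\<in>V. ?d w = f"
    if "f \<in> ideal_times_module R (ideal_power R (Idl X) t) (?K i)" "?d f = (\<lambda>_. \<zero>\<^bsub>M\<^esub>)" for f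
  proof -
    have "f \<in> carrier (?K i)" using that(1) K.submoduleE(1)[OF K.ideal_times_module_submodule[OF ak]] by blast
    thus ?thesis using that t by (auto simp: L_def)
  qed
  thus ?thesis unfolding V_def[symmetric] by (intro exI[of _ t]) simp
qed

section \<open>Chain maps out of the canonical resolution\<close>

text \<open>
  The next component of \<open>z\<close> is defined on the basis of a free module. This needs preimages under \<open>\<delta>\<close>
  only of cycles in the given submodules \<open>V i\<close> of \<open>K i\<close>, provided that they can be chosen in the next
  \<open>V (Suc i)\<close>; the complex \<open>K\<close> itself need not be exact.
\<close>

lemma lift_to_chain_map:
  assumes N: "module R N"
    and \<delta>: "\<And>i. linear_map R (K (Suc i)) (K i) \<delta>"
    and V: "\<And>i. submodule (V i) R (K i)"
    and V0: "\<And>f. f \<in> V 0 \<Longrightarrow> \<exists>w \<in> V 1. \<delta> w = f"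
    and VS: "\<And>i f. f \<in> V (Suc i) \<Longrightarrow> \<delta> f = \<zero>\<^bsub>K i\<^esub> \<Longrightarrow> \<exists>w \<in> V (Suc (Suc i)). \<delta> w = f"
    and \<zeta>: "linear_map R (res_module R N 0) (K 0) \<zeta>"
    and \<zeta>V: "\<And>g. g \<in> carrier (res_module R N (Suc 0)) \<Longrightarrow> \<zeta> (res_diff R N 0 g) \<in> V 0"
  obtains z where "z 0 = \<zeta>" "\<And>i. linear_map R (res_module R N i) (K i) (z i)"
    "\<And>i g. g \<in> carrier (res_module R N (Suc i)) \<Longrightarrow> \<delta> (z (Suc i) g) = z i (res_diff R N i g)"
proof -
  interpret N: module R N by fact
  let ?F = "res_module R N" and ?D = "res_diff R N"
  have D: "linear_map R (?F (Suc i)) (?F i) (?D i)" for i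
    by (rule hom_linear_map[OF N.F_module N.F_module N.diff_hom])
  define P where "P i z \<longleftrightarrow> (i = 0 \<longrightarrow> z = \<zeta>) \<and> linear_map R (?F i) (K i) z \<and>
      (\<forall>g \<in> carrier (?F (Suc i)). z (?D i g) \<in> V i \<and> (\<exists>w \<in> V (Suc i). \<delta> w = z (?D i g)))" for i z
  have "\<exists>z. \<forall>i. P i (z i) \<and> (\<forall>g \<in> carrier (?F (Suc i)). \<delta> (z (Suc i) g) = z i (?D i g))"
  proof (rule dependent_nat_choice)
    have "P 0 \<zeta>" using \<zeta> \<zeta>V V0 by (auto simp: P_def)
    thus "\<exists>z. P 0 z" by blast
  next
    fix z i assume P: "P i z"
    interpret K': module R "K (Suc i)" using \<delta>[of i] by (simp add: linear_map_def)
    interpret K: module R "K i" using \<delta>[of i] by (simp add: linear_map_def)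
    interpret z: linear_map R "?F i" "K i" z using P by (simp add: P_def)
    interpret \<delta>: linear_map R "K (Suc i)" "K i" \<delta> by (rule \<delta>)
    interpret D: linear_map R "?F (Suc i)" "?F i" "?D i" by (rule D)
    interpret D': linear_map R "?F (Suc (Suc i))" "?F (Suc i)" "?D (Suc i)" by (rule D)
    let ?B = "res_basis R N (Suc i)"
    have u: "free_unit R b \<in> carrier (?F (Suc i))" if "b \<in> ?B" for b
      unfolding res_module_def by (rule N.R.unit_carrier[OF that])
    have "\<forall>b \<in> ?B. \<exists>w. w \<in> V (Suc i) \<and> \<delta> w = z (?D i (free_unit R b))"
      using P u by (auto simp: P_def)
    then obtain \<omega> where \<omega>: "\<And>b. b \<in> ?B \<Longrightarrow> \<omega> b \<in> V (Suc i)"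
      "\<And>b. b \<in> ?B \<Longrightarrow> \<delta> (\<omega> b) = z (?D i (free_unit R b))" by metis
    have Vc: "v \<in> carrier (K (Suc i))" if "v \<in> V (Suc i)" for v using K'.submoduleE(1)[OF V] that by blast
    interpret fr: free_to R ?B "K (Suc i)" \<omega>
      by unfold_locales (use \<omega> Vc in auto)
    define z' where "z' = linear_extension R ?B (K (Suc i)) \<omega>"
    have z'h: "z' \<in> module_hom R (?F (Suc i)) (K (Suc i))"
      using fr.le_hom by (simp add: z'_def res_module_def)
    interpret z': linear_map R "?F (Suc i)" "K (Suc i)" z'
      by (rule hom_linear_map[OF N.F_module K'.module_axioms z'h])
    have z'V: "z' g \<in> V (Suc i)" if g: "g \<in> carrier (?F (Suc i))" for g
    proof -
      have gF: "g \<in> carrier (free_module R ?B)" using g by (simp add: res_module_def)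
      have "g b \<odot>\<^bsub>K (Suc i)\<^esub> \<omega> b \<in> V (Suc i)" if "g b \<noteq> \<zero>\<^bsub>R\<^esub>" for b
        using gF that \<omega> by (intro K'.submoduleE(4)[OF V]) (auto simp: free_module_def)
      hence "(\<Oplus>\<^bsub>K (Suc i)\<^esub>b \<in> {b. g b \<noteq> \<zero>\<^bsub>R\<^esub>}. g b \<odot>\<^bsub>K (Suc i)\<^esub> \<omega> b) \<in> V (Suc i)"
        by (intro K'.submodule_finsum[OF V]) auto
      thus ?thesis using gF by (simp add: z'_def linear_extension_def)
    qed
    have eq: "compose (carrier (?F (Suc i))) (restrict \<delta> (carrier (K (Suc i)))) z' =
        compose (carrier (?F (Suc i))) (restrict z (carrier (?F i))) (?D i)"
    proof (rule hom_eq_on_units[OF K.module_axioms, where B = ?B])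
      show "compose (carrier (?F (Suc i))) (restrict \<delta> (carrier (K (Suc i)))) z'
          \<in> module_hom R (free_module R ?B) (K i)"
        using compose_hom[OF z'h \<delta>.f_hom N.F_module] by (simp add: res_module_def)
      show "compose (carrier (?F (Suc i))) (restrict z (carrier (?F i))) (?D i)
          \<in> module_hom R (free_module R ?B) (K i)"
        using compose_hom[OF N.diff_hom z.f_hom N.F_module] by (simp add: res_module_def)
      fix b assume b: "b \<in> ?B"
      have "z' (free_unit R b) = \<omega> b" unfolding z'_def by (rule fr.le_unit[OF b])
      thus "compose (carrier (?F (Suc i))) (restrict \<delta> (carrier (K (Suc i)))) z' (free_unit R b) =
          compose (carrier (?F (Suc i))) (restrict z (carrier (?F i))) (?D i) (free_unit R b)"
        using u[OF b] \<omega>[OF b] Vc by (simp add: compose_def D.f_closed)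
    qed
    have comm: "\<delta> (z' g) = z (?D i g)" if "g \<in> carrier (?F (Suc i))" for g
      using that fun_cong[OF eq, of g] by (simp add: compose_def D.f_closed z'.f_closed)
    have "\<delta> (z' (?D (Suc i) g)) = \<zero>\<^bsub>K i\<^esub>" if g: "g \<in> carrier (?F (Suc (Suc i)))" for g
    proof -
      have "?D i (?D (Suc i) g) = \<zero>\<^bsub>?F i\<^esub>" using N.exact2[of i] g by auto
      thus ?thesis using comm[of "?D (Suc i) g"] D'.f_closed[OF g] z.f_zero by simp
    qed
    hence "P (Suc i) z'"
      unfolding P_def using z'V D'.f_closed VS z'.linear_map_axioms by auto
    thus "\<exists>z'. P (Suc i) z' \<and> (\<forall>g \<in> carrier (?F (Suc i)). \<delta> (z' g) = z (?D i g))" using comm by blast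
  qed
  then obtain z where "\<And>i. P i (z i)" "\<And>i g. g \<in> carrier (?F (Suc i)) \<Longrightarrow> \<delta> (z (Suc i) g) = z i (?D i g)" by blast
  thus ?thesis by (intro that[of z]) (auto simp: P_def)
qed

section \<open>Descent along an inverse system of complexes\<close>

lemma component_linear:
  assumes "module R M" "linear_map R A (function_module M B) \<phi>"
  shows "linear_map R A M (\<lambda>x. \<phi> x b)"
proof -
  interpret M: module R M by fact
  interpret \<phi>: linear_map R A "function_module M B" \<phi> by fact
  show ?thesis
    by (intro linear_map.intro linear_map_axioms.intro \<phi>.N.module_axioms assms)
      (use \<phi>.f_closed in \<open>auto simp: \<phi>.f_add \<phi>.f_smult M.function_module_carrier\<close>)
qed

text \<open>
  Statements about \<open>M\<close> extend to finite powers of \<open>M\<close> component by component, once the stages that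
  belong to the components are replaced by a common one.
\<close>

lemma uniform_stage:
  fixes u :: "'g \<Rightarrow> nat"
  assumes "finite B" "\<And>b. b \<in> B \<Longrightarrow> u b \<ge> t"
  obtains U :: nat where "U \<ge> t" "\<And>b. b \<in> B \<Longrightarrow> u b \<le> U"
  using assms by (intro that[of "Max (insert t (u ` B))"]) auto

text \<open>
  An inverse system of complexes \<open>F t\<close> with differentials \<open>D t\<close> and transition maps \<open>\<pi> t u\<close> from \<open>F u\<close> to
  \<open>F t\<close>. For a module \<open>T\<close>, the complexes of linear maps from \<open>F t\<close> to \<open>T\<close> form a direct system. In the
  application \<open>F t\<close> resolves \<open>R/a\<^sup>t\<close>, and the cohomology of the limit is local cohomology of \<open>T\<close>.
\<close>

locale complex_tower = cring R for R (structure) +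
  fixes F :: "nat \<Rightarrow> nat \<Rightarrow> ('a, 'f, 'k) module_scheme"
    and D :: "nat \<Rightarrow> nat \<Rightarrow> 'f \<Rightarrow> 'f" and \<pi> :: "nat \<Rightarrow> nat \<Rightarrow> nat \<Rightarrow> 'f \<Rightarrow> 'f"
  assumes D_linear: "linear_map R (F t (Suc i)) (F t i) (D t i)"
    and \<pi>_linear: "t \<le> u \<Longrightarrow> linear_map R (F u i) (F t i) (\<pi> t u i)"
    and \<pi>_D: "t \<le> u \<Longrightarrow> x \<in> carrier (F u (Suc i)) \<Longrightarrow> \<pi> t u i (D u i x) = D t i (\<pi> t u (Suc i) x)"
    and \<pi>_\<pi>: "t \<le> u \<Longrightarrow> u \<le> v \<Longrightarrow> x \<in> carrier (F v i) \<Longrightarrow> \<pi> t u i (\<pi> u v i x) = \<pi> t v i x"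
begin

text \<open>
  The next two predicates say that \<open>r\<close> kills the cohomology of the direct limit in degree \<open>0\<close> and in
  degree \<open>Suc i\<close>: every cocycle, multiplied by \<open>r\<close>, becomes a coboundary at a later stage. The first
  stage is \<open>1\<close>, as in the definition of local cohomology.
\<close>

definition kills_degree_0 :: "'a \<Rightarrow> ('a, 'c, 'm) module_scheme \<Rightarrow> bool" where
  "kills_degree_0 r T \<longleftrightarrow> (\<forall>t\<ge>1. \<forall>\<phi>. linear_map R (F t 0) T \<phi> \<longrightarrow>
     (\<forall>x \<in> carrier (F t (Suc 0)). \<phi> (D t 0 x) = \<zero>\<^bsub>T\<^esub>) \<longrightarrow>
     (\<exists>u\<ge>t. \<forall>x \<in> carrier (F u 0). r \<odot>\<^bsub>T\<^esub> \<phi> (\<pi> t u 0 x) = \<zero>\<^bsub>T\<^esub>))"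

definition kills_degree_Suc :: "'a \<Rightarrow> nat \<Rightarrow> ('a, 'c, 'm) module_scheme \<Rightarrow> bool" where
  "kills_degree_Suc r i T \<longleftrightarrow> (\<forall>t\<ge>1. \<forall>\<phi>. linear_map R (F t (Suc i)) T \<phi> \<longrightarrow>
     (\<forall>x \<in> carrier (F t (Suc (Suc i))). \<phi> (D t (Suc i) x) = \<zero>\<^bsub>T\<^esub>) \<longrightarrow>
     (\<exists>u\<ge>t. \<exists>y. linear_map R (F u i) T y \<and>
        (\<forall>x \<in> carrier (F u (Suc i)). r \<odot>\<^bsub>T\<^esub> \<phi> (\<pi> t u (Suc i) x) = y (D u i x))))"

lemma kills_degree_0_function_module:
  assumes M: "module R M" and B: "finite B" and r: "r \<in> carrier R" and kills: "kills_degree_0 r M"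
  shows "kills_degree_0 r (function_module M B)"
  unfolding kills_degree_0_def
proof (intro allI impI)
  interpret M: module R M by (rule M)
  fix t \<phi> assume t: "t \<ge> (1::nat)" and \<phi>: "linear_map R (F t 0) (function_module M B) \<phi>"
    and coc: "\<forall>x \<in> carrier (F t (Suc 0)). \<phi> (D t 0 x) = \<zero>\<^bsub>function_module M B\<^esub>"
  have "\<exists>u\<ge>t. \<forall>x \<in> carrier (F u 0). r \<odot>\<^bsub>M\<^esub> \<phi> (\<pi> t u 0 x) b = \<zero>\<^bsub>M\<^esub>" for b
    using kills t component_linear[OF M \<phi>, of b] coc unfolding kills_degree_0_def by fastforce
  then obtain u where u: "\<And>b. u b \<ge> t"
    "\<And>b x. x \<in> carrier (F (u b) 0) \<Longrightarrow> r \<odot>\<^bsub>M\<^esub> \<phi> (\<pi> t (u b) 0 x) b = \<zero>\<^bsub>M\<^esub>" by metis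
  obtain U where U: "U \<ge> t" "\<And>b. b \<in> B \<Longrightarrow> u b \<le> U" using uniform_stage[of B t u, OF B u(1)] by metis
  interpret \<phi>: linear_map R "F t 0" "function_module M B" \<phi> by (rule \<phi>)
  have "r \<odot>\<^bsub>M\<^esub> \<phi> (\<pi> t U 0 x) b = \<zero>\<^bsub>M\<^esub>" if x: "x \<in> carrier (F U 0)" for x b
  proof (cases "b \<in> B")
    case True
    have "\<pi> (u b) U 0 x \<in> carrier (F (u b) 0)" using linear_map.f_closed[OF \<pi>_linear[OF U(2)[OF True]] x] .
    from u(2)[OF this] show ?thesis using \<pi>_\<pi>[OF u(1) U(2)[OF True] x] by simp
  next
    case False
    have "\<phi> (\<pi> t U 0 x) \<in> carrier (function_module M B)"
      using \<phi>.f_closed linear_map.f_closed[OF \<pi>_linear[OF U(1)] x] by blast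
    thus ?thesis using False r by (auto simp: M.function_module_carrier)
  qed
  thus "\<exists>u\<ge>t. \<forall>x \<in> carrier (F u 0). r \<odot>\<^bsub>function_module M B\<^esub> \<phi> (\<pi> t u 0 x) = \<zero>\<^bsub>function_module M B\<^esub>"
    using U(1) by auto
qed

lemma kills_degree_Suc_function_module:
  assumes M: "module R M" and B: "finite B" and r: "r \<in> carrier R" and kills: "kills_degree_Suc r i M"
  shows "kills_degree_Suc r i (function_module M B)"
  unfolding kills_degree_Suc_def
proof (intro allI impI)
  interpret M: module R M by (rule M)
  fix t \<phi> assume t: "t \<ge> (1::nat)" and \<phi>: "linear_map R (F t (Suc i)) (function_module M B) \<phi>"
    and coc: "\<forall>x \<in> carrier (F t (Suc (Suc i))). \<phi> (D t (Suc i) x) = \<zero>\<^bsub>function_module M B\<^esub>"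
  have "\<exists>u y. u \<ge> t \<and> linear_map R (F u i) M y \<and>
      (\<forall>x \<in> carrier (F u (Suc i)). r \<odot>\<^bsub>M\<^esub> \<phi> (\<pi> t u (Suc i) x) b = y (D u i x))" for b
  proof -
    have "\<forall>x \<in> carrier (F t (Suc (Suc i))). \<phi> (D t (Suc i) x) b = \<zero>\<^bsub>M\<^esub>" using coc by simp
    with kills t component_linear[OF M \<phi>, of b] show ?thesis unfolding kills_degree_Suc_def by blast
  qed
  then obtain u y where u: "\<And>b. u b \<ge> t" and y: "\<And>b. linear_map R (F (u b) i) M (y b)"
    and uy: "\<And>b x. x \<in> carrier (F (u b) (Suc i)) \<Longrightarrow> r \<odot>\<^bsub>M\<^esub> \<phi> (\<pi> t (u b) (Suc i) x) b = y b (D (u b) i x)" by metis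
  obtain U where U: "U \<ge> t" "\<And>b. b \<in> B \<Longrightarrow> u b \<le> U" using uniform_stage[of B t u, OF B u] by metis
  interpret \<phi>: linear_map R "F t (Suc i)" "function_module M B" \<phi> by (rule \<phi>)
  interpret FU: module R "F U i" using D_linear[of U i] by (simp add: linear_map_def)
  define Y where "Y x = (\<lambda>b. if b \<in> B then y b (\<pi> (u b) U i x) else \<zero>\<^bsub>M\<^esub>)" for x
  have yb: "linear_map R (F U i) M (\<lambda>x. y b (\<pi> (u b) U i x))" if "b \<in> B" for b
    by (rule linear_map_compose[OF \<pi>_linear[OF U(2)[OF that]] y])
  have "linear_map R (F U i) (function_module M B) Y"
    by (intro linear_map.intro linear_map_axioms.intro FU.module_axioms M.function_module_is_module)
      (auto simp: Y_def M.function_module_carrier linear_map.f_closed[OF yb] linear_map.f_add[OF yb]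
        linear_map.f_smult[OF yb])
  moreover have "r \<odot>\<^bsub>M\<^esub> \<phi> (\<pi> t U (Suc i) x) b = Y (D U i x) b" if x: "x \<in> carrier (F U (Suc i))" for x b
  proof (cases "b \<in> B")
    case True
    note ub = U(2)[OF True]
    have "\<pi> (u b) U (Suc i) x \<in> carrier (F (u b) (Suc i))" using linear_map.f_closed[OF \<pi>_linear[OF ub] x] .
    from uy[OF this] show ?thesis using \<pi>_\<pi>[OF u ub x] \<pi>_D[OF ub x] True by (simp add: Y_def)
  next
    case False
    have "\<phi> (\<pi> t U (Suc i) x) \<in> carrier (function_module M B)"
      using \<phi>.f_closed linear_map.f_closed[OF \<pi>_linear[OF U(1)] x] by blast
    thus ?thesis using False r by (auto simp: M.function_module_carrier Y_def)
  qed
  ultimately show "\<exists>u\<ge>t. \<exists>y. linear_map R (F u i) (function_module M B) y \<and>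
      (\<forall>x \<in> carrier (F u (Suc i)). r \<odot>\<^bsub>function_module M B\<^esub> \<phi> (\<pi> t u (Suc i) x) = y (D u i x))"
    using U(1) by (intro exI[of _ U] exI[of _ Y] conjI) auto
qed

text \<open>
  By descending induction on \<open>i\<close> there is a stage \<open>u\<close> and a map \<open>y\<close> from \<open>F u i\<close> to \<open>K (Suc i)\<close> such that
  \<open>w = r\<^bsub>i+1\<^esub> \<dots> r\<^sub>n z\<^sub>i + \<delta> y\<close> is a cocycle with values in \<open>K i\<close>. In the top degree \<open>y = 0\<close> works,
  because \<open>z\<^sub>n D = \<delta> z\<^bsub>n+1\<^esub>\<close> and \<open>K (Suc n) = 0\<close>. If \<open>r\<^bsub>i+1\<^esub> w\<close> in degree \<open>i + 1\<close> is the
  coboundary of \<open>y'\<close>, then \<open>- y'\<close> serves in degree \<open>i\<close>.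
\<close>

theorem descent:
  fixes K :: "nat \<Rightarrow> ('a, 'c, 'm) module_scheme"
  assumes t: "t \<ge> 1"
    and \<delta>: "\<And>i. linear_map R (K (Suc i)) (K i) \<delta>"
    and \<delta>\<delta>: "\<And>i w. w \<in> carrier (K (Suc (Suc i))) \<Longrightarrow> \<delta> (\<delta> w) = \<zero>\<^bsub>K i\<^esub>"
    and top: "carrier (K (Suc n)) = {\<zero>\<^bsub>K (Suc n)\<^esub>}"
    and z: "\<And>i. linear_map R (F t i) (K i) (z i)"
    and \<delta>z: "\<And>i g. g \<in> carrier (F t (Suc i)) \<Longrightarrow> \<delta> (z (Suc i) g) = z i (D t i g)"
    and r: "\<And>i. r i \<in> carrier R"
    and kills0: "kills_degree_0 (r 0) (K 0)"
    and killsS: "\<And>i. i < n \<Longrightarrow> kills_degree_Suc (r (Suc i)) i (K (Suc i))"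
  shows "\<exists>u\<ge>t. \<forall>g \<in> carrier (F u 0). \<exists>w \<in> carrier (K (Suc 0)).
     (\<Otimes>i\<in>{..n}. r i) \<odot>\<^bsub>K 0\<^esub> z 0 (\<pi> t u 0 g) = \<delta> w"
proof -
  define c where "c i = (\<Otimes>j\<in>{i..n}. r j)" for i
  have cR: "c i \<in> carrier R" for i unfolding c_def using r by (auto intro: finprod_closed)
  have c_Suc: "c i = r i \<otimes> c (Suc i)" if "i \<le> n" for i
  proof -
    have "{i..n} = insert i {Suc i..n}" using that by auto
    thus ?thesis unfolding c_def using r by (simp add: finprod_insert)
  qed
  have c_top: "c (Suc n) = \<one>" unfolding c_def by simp
  have Km: "module R (K i)" for i using \<delta>[of i] by (simp add: linear_map_def)
  note d = linear_map.f_closed[OF \<delta>] linear_map.f_add[OF \<delta>] linear_map.f_smult[OF \<delta>]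
  define w where "w i u y x = c (Suc i) \<odot>\<^bsub>K i\<^esub> z i (\<pi> t u i x) \<oplus>\<^bsub>K i\<^esub> \<delta> (y x)" for i u y x
  have w_linear: "linear_map R (F u i) (K i) (w i u y)"
    if "u \<ge> t" "linear_map R (F u i) (K (Suc i)) y" for i u y
    unfolding w_def[abs_def]
    by (intro linear_map_add linear_map_smult linear_map_compose[OF \<pi>_linear[OF that(1)] z]
        linear_map_compose[OF that(2) \<delta>] cR)
  define S where "S i \<longleftrightarrow> (\<exists>u\<ge>t. \<exists>y. linear_map R (F u i) (K (Suc i)) y \<and>
      (\<forall>g \<in> carrier (F u (Suc i)). w i u y (D u i g) = \<zero>\<^bsub>K i\<^esub>))" for i
  have zD: "z i (\<pi> t u i (D u i g)) = \<delta> (z (Suc i) (\<pi> t u (Suc i) g))"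
    if "u \<ge> t" "g \<in> carrier (F u (Suc i))" for i u g
    using that linear_map.f_closed[OF \<pi>_linear[OF that(1)] that(2)] by (simp add: \<pi>_D \<delta>z)
  have zc: "z i (\<pi> t u i g) \<in> carrier (K i)" if "u \<ge> t" "g \<in> carrier (F u i)" for i u g
    using linear_map.f_closed[OF z linear_map.f_closed[OF \<pi>_linear[OF that(1)] that(2)]] .
  have "S 0"
  proof (rule inc_induct[of 0 n S])
    interpret Kn: module R "K n" by (rule Km)
    interpret Kn': module R "K (Suc n)" by (rule Km)
    interpret Ft: module R "F t n" using D_linear[of t n] by (simp add: linear_map_def)
    have \<delta>0: "\<delta> \<zero>\<^bsub>K (Suc n)\<^esub> = \<zero>\<^bsub>K n\<^esub>" by (rule linear_map.f_zero[OF \<delta>])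
    have "linear_map R (F t n) (K (Suc n)) (\<lambda>_. \<zero>\<^bsub>K (Suc n)\<^esub>)"
      by (intro linear_map.intro linear_map_axioms.intro Ft.module_axioms Km) auto
    moreover have "w n t (\<lambda>_. \<zero>\<^bsub>K (Suc n)\<^esub>) (D t n g) = \<zero>\<^bsub>K n\<^esub>" if g: "g \<in> carrier (F t (Suc n))" for g
    proof -
      have "z (Suc n) (\<pi> t t (Suc n) g) = \<zero>\<^bsub>K (Suc n)\<^esub>" using zc[OF le_refl g] top by blast
      thus ?thesis using zD[OF le_refl g] by (simp add: w_def c_top \<delta>0)
    qed
    ultimately show "S n" unfolding S_def by blast
  next
    fix i assume i: "i < n" and "S (Suc i)"
    then obtain u y where u: "u \<ge> t" and y: "linear_map R (F u (Suc i)) (K (Suc (Suc i))) y"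
      and coc: "\<forall>g \<in> carrier (F u (Suc (Suc i))). w (Suc i) u y (D u (Suc i) g) = \<zero>\<^bsub>K (Suc i)\<^esub>"
      unfolding S_def by blast
    interpret K: module R "K i" by (rule Km)
    interpret K': module R "K (Suc i)" by (rule Km)
    have "1 \<le> u" using u t by simp
    from killsS[OF i, unfolded kills_degree_Suc_def, rule_format, OF this w_linear[OF u y] coc[rule_format]]
    obtain u' y' where u': "u' \<ge> u"
      and y': "linear_map R (F u' i) (K (Suc i)) y'"
      and eq: "\<And>x. x \<in> carrier (F u' (Suc i)) \<Longrightarrow> r (Suc i) \<odot>\<^bsub>K (Suc i)\<^esub> w (Suc i) u y (\<pi> u u' (Suc i) x) = y' (D u' i x)"
      by blast
    have tu': "u' \<ge> t" using u u' by simp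
    have "w i u' (\<lambda>x. \<ominus>\<^bsub>K (Suc i)\<^esub> y' x) (D u' i g) = \<zero>\<^bsub>K i\<^esub>" if g: "g \<in> carrier (F u' (Suc i))" for g
    proof -
      let ?h = "\<pi> u u' (Suc i) g"
      define Z where "Z = z (Suc i) (\<pi> t u' (Suc i) g)"
      have Z: "Z \<in> carrier (K (Suc i))" unfolding Z_def by (rule zc[OF tu' g])
      have h: "?h \<in> carrier (F u (Suc i))" by (rule linear_map.f_closed[OF \<pi>_linear[OF u'] g])
      have yh: "y ?h \<in> carrier (K (Suc (Suc i)))" by (rule linear_map.f_closed[OF y h])
      have "\<delta> (y' (D u' i g)) = \<delta> (r (Suc i) \<odot>\<^bsub>K (Suc i)\<^esub> (c (Suc (Suc i)) \<odot>\<^bsub>K (Suc i)\<^esub> Z \<oplus>\<^bsub>K (Suc i)\<^esub> \<delta> (y ?h)))"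
        unfolding eq[OF g, symmetric] w_def \<pi>_\<pi>[OF u u' g] Z_def ..
      also have "\<dots> = r (Suc i) \<odot>\<^bsub>K i\<^esub> (c (Suc (Suc i)) \<odot>\<^bsub>K i\<^esub> \<delta> Z)"
        using r cR Z yh by (simp add: d \<delta>\<delta>)
      also have "\<dots> = c (Suc i) \<odot>\<^bsub>K i\<^esub> \<delta> Z"
        using c_Suc[of "Suc i"] i r cR Z by (simp add: K.smult_assoc1 d)
      finally have "\<delta> (y' (D u' i g)) = c (Suc i) \<odot>\<^bsub>K i\<^esub> \<delta> Z" .
      moreover have "y' (D u' i g) \<in> carrier (K (Suc i))"
        using linear_map.f_closed[OF y'] linear_map.f_closed[OF D_linear g] by blast
      ultimately have "\<delta> (\<ominus>\<^bsub>K (Suc i)\<^esub> y' (D u' i g)) = \<ominus>\<^bsub>K i\<^esub> (c (Suc i) \<odot>\<^bsub>K i\<^esub> \<delta> Z)"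
        by (simp add: linear_map.f_minus[OF \<delta>])
      thus ?thesis using zD[OF tu' g] cR Z by (simp add: w_def Z_def[symmetric] d K.M.r_neg)
    qed
    moreover note linear_map_minus[OF y']
    ultimately show "S i" unfolding S_def using tu' by blast
  qed simp
  then obtain u y where u: "u \<ge> t" and y: "linear_map R (F u 0) (K (Suc 0)) y"
    and coc: "\<forall>g \<in> carrier (F u (Suc 0)). w 0 u y (D u 0 g) = \<zero>\<^bsub>K 0\<^esub>"
    unfolding S_def by blast
  have "1 \<le> u" using u t by simp
  from kills0[unfolded kills_degree_0_def, rule_format, OF this w_linear[OF u y] coc[rule_format]]
  obtain u' where u': "u' \<ge> u"
    and eq: "\<And>x. x \<in> carrier (F u' 0) \<Longrightarrow> r 0 \<odot>\<^bsub>K 0\<^esub> w 0 u y (\<pi> u u' 0 x) = \<zero>\<^bsub>K 0\<^esub>"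
    by blast
  have tu': "u' \<ge> t" using u u' by simp
  interpret K0: module R "K 0" by (rule Km)
  interpret K1: module R "K (Suc 0)" by (rule Km)
  have "\<exists>v \<in> carrier (K (Suc 0)). (\<Otimes>i\<in>{..n}. r i) \<odot>\<^bsub>K 0\<^esub> z 0 (\<pi> t u' 0 g) = \<delta> v"
    if g: "g \<in> carrier (F u' 0)" for g
  proof -
    let ?h = "\<pi> u u' 0 g"
    define Z where "Z = z 0 (\<pi> t u' 0 g)"
    have Z: "Z \<in> carrier (K 0)" unfolding Z_def by (rule zc[OF tu' g])
    have h: "?h \<in> carrier (F u 0)" by (rule linear_map.f_closed[OF \<pi>_linear[OF u'] g])
    have yh: "y ?h \<in> carrier (K (Suc 0))" by (rule linear_map.f_closed[OF y h])
    have "r 0 \<odot>\<^bsub>K 0\<^esub> (c (Suc 0) \<odot>\<^bsub>K 0\<^esub> Z \<oplus>\<^bsub>K 0\<^esub> \<delta> (y ?h)) = \<zero>\<^bsub>K 0\<^esub>"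
      using eq[OF g] \<pi>_\<pi>[OF u u' g] by (simp add: w_def Z_def)
    moreover have "{0..n} = {..n}" by auto
    ultimately have "(\<Otimes>i\<in>{..n}. r i) \<odot>\<^bsub>K 0\<^esub> Z \<oplus>\<^bsub>K 0\<^esub> \<delta> (r 0 \<odot>\<^bsub>K (Suc 0)\<^esub> y ?h) = \<zero>\<^bsub>K 0\<^esub>"
      using c_Suc[of 0] r cR Z yh by (simp add: K0.smult_r_distr K0.smult_assoc1 d c_def)
    moreover have "(\<Otimes>i\<in>{..n}. r i) \<in> carrier R" using r by (auto intro: finprod_closed)
    ultimately have "(\<Otimes>i\<in>{..n}. r i) \<odot>\<^bsub>K 0\<^esub> Z = \<delta> (\<ominus>\<^bsub>K (Suc 0)\<^esub> (r 0 \<odot>\<^bsub>K (Suc 0)\<^esub> y ?h))"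
      using r Z yh by (simp add: linear_map.f_minus[OF \<delta>] d K0.M.minus_equality[symmetric])
    thus ?thesis unfolding Z_def using r yh by blast
  qed
  thus ?thesis using tu' by blast
qed

end

section \<open>Annihilators of local cohomology\<close>

context cring
begin

lemma coset_map_linear:
  assumes I: "ideal I R"
  shows "linear_map R (regular_module R) (power_quotient R I t) (\<lambda>r. ideal_power R I t +> r)"
proof -
  interpret G: module R "regular_module R" by (rule regular_module_is_module)
  note K = power_submodule[OF I, of t]
  show ?thesis
    using G.quotient_carrier[of "ideal_power R I t"] G.quotient_add[OF K] G.quotient_smult[OF K]
    by (intro linear_map.intro linear_map_axioms.intro G.module_axioms power_quotient_module[OF I])
      (auto simp: reg_coset power_quotient_def)
qed

lemma power_quotient_carrier:
  "carrier (power_quotient R I t) = (\<lambda>r. ideal_power R I t +> r) ` carrier R"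
  using module.quotient_carrier[OF regular_module_is_module, of "ideal_power R I t"]
  by (simp add: reg_coset power_quotient_def) (simp add: regular_module_def)

lemma power_projection_comp:
  assumes "ideal I R" "t \<le> u" "u \<le> v" "c \<in> carrier (power_quotient R I v)"
  shows "power_projection R I t (power_projection R I u c) = power_projection R I t c"
  using assms by (auto simp: power_quotient_carrier power_proj)

lemma smult_right_linear:
  assumes "module R M" "m \<in> carrier M" shows "linear_map R (regular_module R) M (\<lambda>r. r \<odot>\<^bsub>M\<^esub> m)"
proof -
  interpret M: module R M by fact
  show ?thesis
    by (intro linear_map.intro linear_map_axioms.intro regular_module_is_module M.module_axioms)
      (use assms(2) in \<open>auto simp: regular_module_def M.smult_l_distr M.smult_assoc1\<close>)
qed

lemma coset_eq_ideal_iff: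
  assumes "ideal J R" "r \<in> carrier R" shows "J +> r = J \<longleftrightarrow> r \<in> J"
proof -
  interpret J: ideal J R by fact
  show ?thesis using J.a_rcos_self[OF assms(2)] J.a_rcos_const by auto
qed

lemma resolution_tower:
  assumes I: "ideal I R"
  shows "complex_tower R (\<lambda>t. res_module R (power_quotient R I t)) (\<lambda>t. res_diff R (power_quotient R I t))
    (\<lambda>t u. res_map R (power_quotient R I u) (power_quotient R I t) (power_projection R I t))"
proof (intro complex_tower.intro complex_tower_axioms.intro is_cring)
  note Q = power_quotient_module[OF I] and p = power_projection_linear[OF I]
  show "linear_map R (res_module R (power_quotient R I t) (Suc i)) (res_module R (power_quotient R I t) i)
      (res_diff R (power_quotient R I t) i)" for t i
    by (intro hom_linear_map module.F_module module.diff_hom Q)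
  show "linear_map R (res_module R (power_quotient R I u) i) (res_module R (power_quotient R I t) i)
      (res_map R (power_quotient R I u) (power_quotient R I t) (power_projection R I t) i)"
    if "t \<le> u" for t u i
    by (intro hom_linear_map module.F_module linear_map.rm_hom' Q p that)
  show "res_map R (power_quotient R I u) (power_quotient R I t) (power_projection R I t) i
        (res_diff R (power_quotient R I u) i x) =
      res_diff R (power_quotient R I t) i
        (res_map R (power_quotient R I u) (power_quotient R I t) (power_projection R I t) (Suc i) x)"
    if "t \<le> u" "x \<in> carrier (res_module R (power_quotient R I u) (Suc i))" for t u i x
    using linear_map.chain'[OF p[OF that(1)] that(2)] by simp
  show "res_map R (power_quotient R I u) (power_quotient R I t) (power_projection R I t) i
        (res_map R (power_quotient R I v) (power_quotient R I u) (power_projection R I u) i x) =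
      res_map R (power_quotient R I v) (power_quotient R I t) (power_projection R I t) i x"
    if "t \<le> u" "u \<le> v" "x \<in> carrier (res_module R (power_quotient R I v) i)" for t u v i x
  proof (rule res_map_comp[OF p[OF that(2)] p[OF that(1)] p[OF order_trans[OF that(1,2)]] _ that(3)])
    show "power_projection R I t c = power_projection R I t (power_projection R I u c)"
      if "c \<in> carrier (power_quotient R I v)" for c
      using power_projection_comp[OF I \<open>t \<le> u\<close> \<open>u \<le> v\<close> that] by simp
  qed
qed

lemma local_cohomology_direct_system:
  assumes I: "ideal I R" and M: "module R M"
  shows "direct_system R {1..} (\<lambda>t. Ext_module R (power_quotient R I t) M i)
     (\<lambda>t u. Ext_map R (power_quotient R I u) (power_quotient R I t) (power_projection R I t) M i)"
proof (rule direct_system.intro)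
  note p = power_projection_linear[OF I]
  show "linear_map R (Ext_module R (power_quotient R I t) M i) (Ext_module R (power_quotient R I u) M i)
      (Ext_map R (power_quotient R I u) (power_quotient R I t) (power_projection R I t) M i)"
    if "t \<le> u" for t u
    by (intro ext_lin.Ext_map_linear ext_lin.intro p[OF that] M)
  show "Ext_map R (power_quotient R I t) (power_quotient R I t) (power_projection R I t) M i x = x"
    if "x \<in> carrier (Ext_module R (power_quotient R I t) M i)" for t x
    using that by (intro Ext_map_id[OF p[OF order_refl] M]) (auto simp: power_quotient_carrier power_proj[OF I])
  show "Ext_map R (power_quotient R I s) (power_quotient R I u) (power_projection R I u) M i
        (Ext_map R (power_quotient R I u) (power_quotient R I t) (power_projection R I t) M i x) =
      Ext_map R (power_quotient R I s) (power_quotient R I t) (power_projection R I t) M i x"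
    if "t \<le> u" "u \<le> s" "x \<in> carrier (Ext_module R (power_quotient R I t) M i)" for t u s x
    using power_projection_comp[OF I that(1,2)] that
    by (intro Ext_map_comp[OF p p p M]) auto
qed (auto simp: is_cring)

lemma annihilator_subset_annihilator_local_cohomology:
  assumes I: "ideal I R" and M: "module R M"
  shows "annihilator R M \<subseteq> annihilator R (local_cohomology R I i M)"
proof
  interpret M: module R M by (rule M)
  interpret S: direct_system R "{1..}" "\<lambda>t. Ext_module R (power_quotient R I t) M i"
    "\<lambda>t u. Ext_map R (power_quotient R I u) (power_quotient R I t) (power_projection R I t) M i"
    by (rule local_cohomology_direct_system[OF I M])
  fix r assume r: "r \<in> annihilator R M"
  hence rc: "r \<in> carrier R" and rM: "\<And>m. m \<in> carrier M \<Longrightarrow> r \<odot>\<^bsub>M\<^esub> m = \<zero>\<^bsub>M\<^esub>" by (auto simp: annihilator_def)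
  have "r \<odot>\<^bsub>S.D\<^esub> C = \<zero>\<^bsub>S.D\<^esub>" if C: "C \<in> carrier S.D" for C
  proof -
    obtain t x where t: "t \<in> {1..}" and x: "x \<in> carrier (Ext_module R (power_quotient R I t) M i)"
      and Cx: "C = S.cl t x" using C unfolding S.D_carrier by blast
    interpret P: ext_pair R "power_quotient R I t" M
      by (intro ext_pair.intro power_quotient_module I M)
    interpret Ch: module R "ext_cochains R (power_quotient R I t) M i" by (rule P.cochains_module)
    obtain \<phi> where \<phi>: "\<phi> \<in> ext_cocycles R (power_quotient R I t) M i"
      and x\<phi>: "x = ext_coboundaries R (power_quotient R I t) M i +>\<^bsub>ext_cochains R (power_quotient R I t) M i\<^esub> \<phi>"
      using x unfolding P.Ext_carrier by blast
    have "\<phi> \<in> carrier (ext_cochains R (power_quotient R I t) M i)" by (rule P.cocycle_closed(1)[OF \<phi>])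
    hence "r \<odot>\<^bsub>ext_cochains R (power_quotient R I t) M i\<^esub> \<phi> = \<zero>\<^bsub>ext_cochains R (power_quotient R I t) M i\<^esub>"
      using rM by (auto simp: ext_cochains_def hom_module_def module_hom_def fun_eq_iff)
    hence "r \<odot>\<^bsub>Ext_module R (power_quotient R I t) M i\<^esub> x = \<zero>\<^bsub>Ext_module R (power_quotient R I t) M i\<^esub>"
      unfolding x\<phi> P.Ext_smult[OF \<phi> rc]
      using Ch.a_coset_add_zero[OF Ch.submoduleE(1)[OF P.coboundaries_submodule]]
      by (simp add: Ext_module_def quotient_module_def)
    thus ?thesis unfolding Cx using S.smult_cl[OF rc t x] S.zero_cl[OF t] by simp
  qed
  thus "r \<in> annihilator R (local_cohomology R I i M)"
    using rc by (simp add: annihilator_def local_cohomology_def)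
qed

text \<open>
  An element of a direct limit is zero only if it is zero at some stage; for the class of a cocycle
  this means that the cocycle becomes a coboundary there.
\<close>

lemma annihilator_local_cohomology_coboundary:
  assumes I: "ideal I R" and M: "module R M"
    and r: "r \<in> annihilator R (local_cohomology R I i M)"
    and t: "t \<ge> 1" and \<phi>: "\<phi> \<in> ext_cocycles R (power_quotient R I t) M i"
  shows "\<exists>u\<ge>t. r \<odot>\<^bsub>ext_cochains R (power_quotient R I u) M i\<^esub>
      compose (carrier (res_module R (power_quotient R I u) i)) \<phi>
        (res_map R (power_quotient R I u) (power_quotient R I t) (power_projection R I t) i)
     \<in> ext_coboundaries R (power_quotient R I u) M i"
proof -
  interpret S: direct_system R "{1..}" "\<lambda>t. Ext_module R (power_quotient R I t) M i"
    "\<lambda>t u. Ext_map R (power_quotient R I u) (power_quotient R I t) (power_projection R I t) M i"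
    by (rule local_cohomology_direct_system[OF I M])
  interpret P: ext_pair R "power_quotient R I t" M
    by (intro ext_pair.intro power_quotient_module I M)
  interpret E: module R "Ext_module R (power_quotient R I t) M i" by (rule P.Ext_is_module)
  have rc: "r \<in> carrier R" and rD: "\<And>C. C \<in> carrier S.D \<Longrightarrow> r \<odot>\<^bsub>S.D\<^esub> C = \<zero>\<^bsub>S.D\<^esub>"
    using r by (auto simp: annihilator_def local_cohomology_def)
  have tI: "t \<in> {1..}" using t by simp
  define x where "x = ext_coboundaries R (power_quotient R I t) M i +>\<^bsub>ext_cochains R (power_quotient R I t) M i\<^esub> \<phi>"
  have x: "x \<in> carrier (Ext_module R (power_quotient R I t) M i)"
    unfolding x_def P.Ext_carrier using \<phi> by blast
  have "S.cl t (r \<odot>\<^bsub>Ext_module R (power_quotient R I t) M i\<^esub> x) = S.cl t \<zero>\<^bsub>Ext_module R (power_quotient R I t) M i\<^esub>"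
    using rD[OF S.D_closed[OF tI x]] S.smult_cl[OF rc tI x] S.zero_cl[OF tI] by simp
  then obtain u where u: "u \<ge> t" "u \<in> {1..}" and
    "Ext_map R (power_quotient R I u) (power_quotient R I t) (power_projection R I t) M i
       (r \<odot>\<^bsub>Ext_module R (power_quotient R I t) M i\<^esub> x) =
     Ext_map R (power_quotient R I u) (power_quotient R I t) (power_projection R I t) M i
       \<zero>\<^bsub>Ext_module R (power_quotient R I t) M i\<^esub>"
    using S.cl_eq[OF tI E.smult_closed[OF rc x] tI E.M.zero_closed] by blast
  hence eq: "Ext_map R (power_quotient R I u) (power_quotient R I t) (power_projection R I t) M i
       (r \<odot>\<^bsub>Ext_module R (power_quotient R I t) M i\<^esub> x) = \<zero>\<^bsub>Ext_module R (power_quotient R I u) M i\<^esub>"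
    using S.tz[OF tI u(2,1)] by simp
  interpret X: ext_lin R "power_quotient R I u" "power_quotient R I t" "power_projection R I t" M
    by (intro ext_lin.intro power_projection_linear[OF I u(1)] M)
  interpret Cu: module R "ext_cochains R (power_quotient R I u) M i" by (rule X.E.cochains_module)
  interpret B: abelian_subgroup "ext_coboundaries R (power_quotient R I u) M i" "ext_cochains R (power_quotient R I u) M i"
    by (rule Cu.submodule_abelian_subgroup[OF X.E.coboundaries_submodule])
  note \<phi>c = P.cocycle_closed(1)[OF \<phi>]
  let ?\<psi> = "r \<odot>\<^bsub>ext_cochains R (power_quotient R I u) M i\<^esub> X.pull i \<phi>"
  have "X.cls (power_quotient R I u) i ?\<psi> = ext_coboundaries R (power_quotient R I u) M i"
    using eq unfolding x_def P.Ext_smult[OF \<phi> rc] X.Ext_map_class[OF P.cocycle_closed(1)[OF P.cocycle_closed(3)[OF \<phi> rc]]]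
      X.pull_smult[OF rc \<phi>c] by (simp add: Ext_module_def quotient_module_def)
  moreover have "?\<psi> \<in> carrier (ext_cochains R (power_quotient R I u) M i)"
    using X.pull_closed[OF \<phi>c] rc by blast
  ultimately have "?\<psi> \<in> ext_coboundaries R (power_quotient R I u) M i" using B.a_rcos_self by metis
  thus ?thesis using u(1) by blast
qed

lemma linear_cocycle:
  assumes N: "module R N" and M: "module R M" and \<phi>: "linear_map R (res_module R N i) M \<phi>"
    and coc: "\<And>x. x \<in> carrier (res_module R N (Suc i)) \<Longrightarrow> \<phi> (res_diff R N i x) = \<zero>\<^bsub>M\<^esub>"
  shows "restrict \<phi> (carrier (res_module R N i)) \<in> ext_cocycles R N M i"
proof -
  interpret N: module R N by (rule N)
  interpret D: linear_map R "res_module R N (Suc i)" "res_module R N i" "res_diff R N i"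
    by (intro hom_linear_map N.F_module N.diff_hom)
  show ?thesis
    using linear_map.f_hom[OF \<phi>] coc D.f_closed
    by (auto simp: ext_cocycles_def ext_cochains_def hom_module_def ext_diff_def compose_def fun_eq_iff)
qed

lemma annihilator_kills_degree_0:
  assumes I: "ideal I R" and M: "module R M" and r: "r \<in> annihilator R (local_cohomology R I 0 M)"
  shows "complex_tower.kills_degree_0 R (\<lambda>t. res_module R (power_quotient R I t)) (\<lambda>t. res_diff R (power_quotient R I t))
    (\<lambda>t u. res_map R (power_quotient R I u) (power_quotient R I t) (power_projection R I t)) r M"
  unfolding complex_tower.kills_degree_0_def[OF resolution_tower[OF I]]
proof (intro allI impI)
  fix t \<phi> assume t: "t \<ge> (1::nat)" and \<phi>: "linear_map R (res_module R (power_quotient R I t) 0) M \<phi>"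
    and coc: "\<forall>x\<in>carrier (res_module R (power_quotient R I t) (Suc 0)). \<phi> (res_diff R (power_quotient R I t) 0 x) = \<zero>\<^bsub>M\<^esub>"
  let ?\<phi> = "restrict \<phi> (carrier (res_module R (power_quotient R I t) 0))"
  have "?\<phi> \<in> ext_cocycles R (power_quotient R I t) M 0"
    by (rule linear_cocycle[OF power_quotient_module[OF I] M \<phi>]) (use coc in blast)
  from annihilator_local_cohomology_coboundary[OF I M r t this]
  obtain u where u: "u \<ge> t" and b: "r \<odot>\<^bsub>ext_cochains R (power_quotient R I u) M 0\<^esub>
      compose (carrier (res_module R (power_quotient R I u) 0)) ?\<phi>
        (res_map R (power_quotient R I u) (power_quotient R I t) (power_projection R I t) 0)
     = \<zero>\<^bsub>ext_cochains R (power_quotient R I u) M 0\<^esub>" by auto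
  have "r \<odot>\<^bsub>M\<^esub> \<phi> (res_map R (power_quotient R I u) (power_quotient R I t) (power_projection R I t) 0 x) = \<zero>\<^bsub>M\<^esub>"
    if x: "x \<in> carrier (res_module R (power_quotient R I u) 0)" for x
    using fun_cong[OF b, of x] x linear_map.f_closed[OF complex_tower.\<pi>_linear[OF resolution_tower[OF I] u] x]
    by (simp add: ext_cochains_def hom_module_def compose_def)
  thus "\<exists>u\<ge>t. \<forall>x\<in>carrier (res_module R (power_quotient R I u) 0).
      r \<odot>\<^bsub>M\<^esub> \<phi> (res_map R (power_quotient R I u) (power_quotient R I t) (power_projection R I t) 0 x) = \<zero>\<^bsub>M\<^esub>"
    using u by blast
qed

lemma annihilator_kills_degree_Suc:
  assumes I: "ideal I R" and M: "module R M" and r: "r \<in> annihilator R (local_cohomology R I (Suc i) M)"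
  shows "complex_tower.kills_degree_Suc R (\<lambda>t. res_module R (power_quotient R I t)) (\<lambda>t. res_diff R (power_quotient R I t))
    (\<lambda>t u. res_map R (power_quotient R I u) (power_quotient R I t) (power_projection R I t)) r i M"
  unfolding complex_tower.kills_degree_Suc_def[OF resolution_tower[OF I]]
proof (intro allI impI)
  fix t \<phi> assume t: "t \<ge> (1::nat)" and \<phi>: "linear_map R (res_module R (power_quotient R I t) (Suc i)) M \<phi>"
    and coc: "\<forall>x\<in>carrier (res_module R (power_quotient R I t) (Suc (Suc i))).
       \<phi> (res_diff R (power_quotient R I t) (Suc i) x) = \<zero>\<^bsub>M\<^esub>"
  let ?\<phi> = "restrict \<phi> (carrier (res_module R (power_quotient R I t) (Suc i)))"
  have "?\<phi> \<in> ext_cocycles R (power_quotient R I t) M (Suc i)"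
    by (rule linear_cocycle[OF power_quotient_module[OF I] M \<phi>]) (use coc in blast)
  from annihilator_local_cohomology_coboundary[OF I M r t this]
  obtain u y where u: "u \<ge> t" and y: "y \<in> carrier (ext_cochains R (power_quotient R I u) M i)"
    and b: "r \<odot>\<^bsub>ext_cochains R (power_quotient R I u) M (Suc i)\<^esub>
      compose (carrier (res_module R (power_quotient R I u) (Suc i))) ?\<phi>
        (res_map R (power_quotient R I u) (power_quotient R I t) (power_projection R I t) (Suc i))
     = ext_diff R (power_quotient R I u) i y" by auto
  have yl: "linear_map R (res_module R (power_quotient R I u) i) M y"
    using y by (intro hom_linear_map module.F_module power_quotient_module[OF I] M)
      (simp add: ext_cochains_def hom_module_def)
  have "r \<odot>\<^bsub>M\<^esub> \<phi> (res_map R (power_quotient R I u) (power_quotient R I t) (power_projection R I t) (Suc i) x) =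
      y (res_diff R (power_quotient R I u) i x)"
    if x: "x \<in> carrier (res_module R (power_quotient R I u) (Suc i))" for x
    using fun_cong[OF b, of x] x linear_map.f_closed[OF complex_tower.\<pi>_linear[OF resolution_tower[OF I] u] x]
    by (simp add: ext_cochains_def hom_module_def compose_def ext_diff_def)
  thus "\<exists>u\<ge>t. \<exists>y. linear_map R (res_module R (power_quotient R I u) i) M y \<and>
      (\<forall>x\<in>carrier (res_module R (power_quotient R I u) (Suc i)).
         r \<odot>\<^bsub>M\<^esub> \<phi> (res_map R (power_quotient R I u) (power_quotient R I t) (power_projection R I t) (Suc i) x) =
         y (res_diff R (power_quotient R I u) i x))"
    using u yl by blast
qed

text \<open>
  Choosing a representative of each residue class lifts the augmentation of the resolution of \<open>R/I\<^sup>t\<close>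
  to a map with values in \<open>R\<close>. On boundaries the
  augmentation vanishes, so there the lift has values in \<open>I\<^sup>t\<close>.
\<close>

lemma augmentation_lift:
  assumes I: "ideal I R"
  obtains \<epsilon> where "linear_map R (res_module R (power_quotient R I t) 0) (regular_module R) \<epsilon>"
    "\<And>g. g \<in> carrier (res_module R (power_quotient R I t) (Suc 0)) \<Longrightarrow>
       \<epsilon> (res_diff R (power_quotient R I t) 0 g) \<in> ideal_power R I t"
    "\<epsilon> (free_unit R (Gen (ideal_power R I t +> \<one>))) = \<one>"
proof -
  let ?Q = "power_quotient R I t" and ?J = "ideal_power R I t"
  interpret Q: module R ?Q by (rule power_quotient_module[OF I])
  interpret G: module R "regular_module R" by (rule regular_module_is_module)
  have G: "carrier (regular_module R) = carrier R" by (simp add: regular_module_def)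
  define rep where "rep c = (if c = ?J +> \<one> then \<one> else SOME r. r \<in> carrier R \<and> ?J +> r = c)" for c
  have rep: "rep c \<in> carrier R \<and> ?J +> rep c = c" if "c \<in> carrier ?Q" for c
  proof (cases "c = ?J +> \<one>")
    case False
    have "\<exists>r. r \<in> carrier R \<and> ?J +> r = c" using that unfolding power_quotient_carrier by blast
    from someI_ex[OF this] show ?thesis using False by (simp add: rep_def)
  qed (simp add: rep_def)
  interpret fr: free_to R "res_basis R ?Q 0" "regular_module R" "\<lambda>b. rep (res_elt b)"
    by unfold_locales (use rep G in auto)
  define \<epsilon> where "\<epsilon> = linear_extension R (res_basis R ?Q 0) (regular_module R) (\<lambda>b. rep (res_elt b))"
  have \<epsilon>h: "\<epsilon> \<in> module_hom R (res_module R ?Q 0) (regular_module R)"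
    using fr.le_hom by (simp add: \<epsilon>_def res_module_def)
  interpret \<epsilon>: linear_map R "res_module R ?Q 0" "regular_module R" \<epsilon>
    by (rule hom_linear_map[OF Q.F_module G.module_axioms \<epsilon>h])
  interpret q: linear_map R "regular_module R" ?Q "\<lambda>r. ?J +> r" by (rule coset_map_linear[OF I])
  have "compose (carrier (res_module R ?Q 0)) (restrict (\<lambda>r. ?J +> r) (carrier (regular_module R))) \<epsilon> = res_aug R ?Q"
  proof (rule hom_eq_on_units[OF Q.module_axioms, where B = "res_basis R ?Q 0"])
    show "compose (carrier (res_module R ?Q 0)) (restrict (\<lambda>r. ?J +> r) (carrier (regular_module R))) \<epsilon>
        \<in> module_hom R (free_module R (res_basis R ?Q 0)) ?Q"
      using compose_hom[OF \<epsilon>h q.f_hom Q.F_module] by (simp add: res_module_def)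
    show "res_aug R ?Q \<in> module_hom R (free_module R (res_basis R ?Q 0)) ?Q"
      using Q.aug_hom by (simp add: res_module_def)
    fix b assume b: "b \<in> res_basis R ?Q 0"
    have u: "free_unit R b \<in> carrier (res_module R ?Q 0)"
      unfolding res_module_def by (rule unit_carrier[OF b])
    have 1: "res_aug R ?Q (free_unit R b) = res_elt b"
      unfolding res_aug_def by (rule free_to.le_unit[OF Q.aug_free b])
    have 2: "\<epsilon> (free_unit R b) = rep (res_elt b)" unfolding \<epsilon>_def by (rule fr.le_unit[OF b])
    have "res_elt b \<in> carrier ?Q" using b by auto
    from rep[OF this] show "compose (carrier (res_module R ?Q 0)) (restrict (\<lambda>r. ?J +> r) (carrier (regular_module R))) \<epsilon>
        (free_unit R b) = res_aug R ?Q (free_unit R b)"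
      using u by (simp add: compose_def 1 2 G)
  qed
  note eq = fun_cong[OF this]
  have "\<epsilon> (res_diff R ?Q 0 g) \<in> ?J" if g: "g \<in> carrier (res_module R ?Q (Suc 0))" for g
  proof -
    have d: "res_diff R ?Q 0 g \<in> carrier (res_module R ?Q 0)" "res_aug R ?Q (res_diff R ?Q 0 g) = \<zero>\<^bsub>?Q\<^esub>"
      using Q.exact1 g by auto
    have "?J +> \<epsilon> (res_diff R ?Q 0 g) = ?J"
      using eq[of "res_diff R ?Q 0 g"] d \<epsilon>.f_closed[OF d(1)]
      by (simp add: compose_def power_quotient_def quotient_module_def)
    thus ?thesis using coset_eq_ideal_iff[OF ideal_power_ideal[OF I]] \<epsilon>.f_closed[OF d(1)] G by blast
  qed
  moreover have "\<epsilon> (free_unit R (Gen (?J +> \<one>))) = \<one>"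
  proof -
    have "Gen (?J +> \<one>) \<in> res_basis R ?Q 0" by (auto simp: power_quotient_carrier)
    from fr.le_unit[OF this] show ?thesis by (simp add: \<epsilon>_def rep_def)
  qed
  ultimately show ?thesis using that \<epsilon>.linear_map_axioms by blast
qed

end

text \<open>
  Depths in the \<open>a\<close>-adic filtration are chosen from the top degree of the Koszul complex downwards.
\<close>

lemma descending_choice:
  fixes E :: "nat \<Rightarrow> nat \<Rightarrow> nat \<Rightarrow> bool"
  assumes "\<And>i k. \<exists>l. E i k l" "\<And>i k l. i > n \<Longrightarrow> E i k l"
  obtains \<kappa> where "\<And>i. E i (\<kappa> (Suc i)) (\<kappa> i)"
proof -
  have "\<exists>\<kappa>. \<forall>i\<ge>0. E i (\<kappa> (Suc i)) (\<kappa> i)"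
  proof (rule inc_induct[of 0 "Suc n"])
    show "\<exists>\<kappa>. \<forall>i\<ge>Suc n. E i (\<kappa> (Suc i)) (\<kappa> i)" using assms(2) by auto
    fix j assume "\<exists>\<kappa>. \<forall>i\<ge>Suc j. E i (\<kappa> (Suc i)) (\<kappa> i)"
    then obtain \<kappa> where \<kappa>: "\<And>i. i \<ge> Suc j \<Longrightarrow> E i (\<kappa> (Suc i)) (\<kappa> i)" by blast
    obtain l where "E j (\<kappa> (Suc j)) l" using assms(1) by blast
    hence "E i ((\<kappa>(j := l)) (Suc i)) ((\<kappa>(j := l)) i)" if "i \<ge> j" for i
      using \<kappa>[of i] that by (cases "i = j") auto
    thus "\<exists>\<kappa>. \<forall>i\<ge>j. E i (\<kappa> (Suc i)) (\<kappa> i)" by blast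
  qed simp
  thus ?thesis using that by blast
qed

text \<open>
  The chain map of \<open>lift_to_chain_map\<close>, started at \<open>1 \<mapsto> m\<close>, is made null-homotopic by \<open>descent\<close>.
\<close>

lemma (in module) annihilator_product_smult:
  assumes R: "noetherian_ring R" and fg: "finitely_generated_module R M"
    and xs: "set xs \<subseteq> carrier R"
    and r: "\<And>i. r i \<in> annihilator R (local_cohomology R (Idl (set xs)) i M)"
    and m: "m \<in> carrier M"
  shows "(\<Otimes>i\<in>{..length xs}. r i) \<odot>\<^bsub>M\<^esub> m \<in> ideal_times_module R (ideal_power R (Idl (set xs)) s) M"
proof -
  define n where "n = length xs"
  let ?I = "Idl (set xs)"
  define Q where "Q = power_quotient R ?I"
  have I: "ideal ?I R" by (rule R.genideal_ideal[OF xs])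
  define ys where "ys = map (\<lambda>x. x [^] s) xs"
  have ys: "set ys \<subseteq> carrier R" and len: "length ys = n" using xs by (auto simp: ys_def n_def)
  define K where "K = koszul_module M ys"
  let ?d = "koszul_diff M ys"
  have Kz: "\<zero>\<^bsub>K i\<^esub> = (\<lambda>_. \<zero>\<^bsub>M\<^esub>)" for i by (simp add: K_def koszul_module_def)
  have Ks: "c \<odot>\<^bsub>K i\<^esub> f = (\<lambda>T. c \<odot>\<^bsub>M\<^esub> f T)" for c f i by (simp add: K_def koszul_module_def)
  have Kc: "f \<in> carrier (K i) \<longleftrightarrow> (\<forall>T. f T \<in> carrier M) \<and> (\<forall>T. T \<notin> koszul_index n i \<longrightarrow> f T = \<zero>\<^bsub>M\<^esub>)" for f i
    by (simp add: K_def koszul_module_def function_module_carrier len)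
  have Km: "module R (K i)" for i unfolding K_def by (rule koszul_module_is_module)
  have Ktop: "carrier (K i) = {\<zero>\<^bsub>K i\<^esub>}" if "i > n" for i
    using koszul_index_empty[OF that] by (auto simp: Kc Kz)
  have \<delta>: "linear_map R (K (Suc i)) (K i) ?d" for i unfolding K_def by (rule koszul_diff_linear[OF ys])
  define W where "W k i = ideal_times_module R (ideal_power R ?I k) (K i)" for k i
  have ac: "ideal_power R ?I k \<subseteq> carrier R" for k using ideal.Icarr[OF R.ideal_power_ideal[OF I]] by blast
  have W: "submodule (W k i) R (K i)" for k i
    unfolding W_def by (rule module.ideal_times_module_submodule[OF Km ac])
  have WK: "f \<in> carrier (K i)" if "f \<in> W k i" for f k i using module.submoduleE(1)[OF Km W] that by blast
  define E where "E i k l \<longleftrightarrow> (\<forall>f \<in> W l i. ?d f = (\<lambda>_. \<zero>\<^bsub>M\<^esub>) \<longrightarrow> (\<exists>w \<in> W k (Suc i). ?d w = f))" for i k l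
  \<comment> \<open>\<open>E i k l\<close>: cycles of depth \<open>l\<close> in degree \<open>i\<close> are boundaries of elements of depth \<open>k\<close>\<close>
  have "\<exists>l. E i k l" for i k
    unfolding E_def W_def K_def
    by (rule koszul_strictly_exact[OF R fg _ xs ys]) (auto simp: ys_def)
  moreover have "E i k l" if "i > n" for i k l
  proof -
    have "f = \<zero>\<^bsub>K i\<^esub>" if "f \<in> W l i" for f using WK[OF that] Ktop[OF \<open>i > n\<close>] by blast
    moreover have "\<zero>\<^bsub>K (Suc i)\<^esub> \<in> W k (Suc i)" by (rule module.submodule_zero[OF Km W])
    moreover have "?d \<zero>\<^bsub>K (Suc i)\<^esub> = \<zero>\<^bsub>K i\<^esub>" by (rule linear_map.f_zero[OF \<delta>])
    ultimately show ?thesis unfolding E_def by metis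
  qed
  ultimately obtain \<kappa> where \<kappa>: "\<And>i. E i (\<kappa> (Suc i)) (\<kappa> i)" using descending_choice[of E n] by metis
  \<comment> \<open>the successor makes \<open>t\<close> positive; depth \<open>\<kappa> 0\<close> is what the chain map needs\<close>
  define t where "t = Suc (\<kappa> 0)"
  define f where "f T = (if T = replicate n False then m else \<zero>\<^bsub>M\<^esub>)" for T
  have f: "f \<in> carrier (K 0)" using m by (auto simp: Kc f_def koszul_index_def)
  obtain \<epsilon> where \<epsilon>: "linear_map R (res_module R (Q t) 0) (regular_module R) \<epsilon>"
    and \<epsilon>I: "\<And>g. g \<in> carrier (res_module R (Q t) (Suc 0)) \<Longrightarrow> \<epsilon> (res_diff R (Q t) 0 g) \<in> ideal_power R ?I t"
    and \<epsilon>1: "\<epsilon> (free_unit R (Gen (ideal_power R ?I t +> \<one>))) = \<one>"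
    using R.augmentation_lift[OF I, of t] unfolding Q_def by metis
  define \<zeta> where "\<zeta> g = \<epsilon> g \<odot>\<^bsub>K 0\<^esub> f" for g
  have \<zeta>: "linear_map R (res_module R (Q t) 0) (K 0) \<zeta>"
    unfolding \<zeta>_def[abs_def] by (rule linear_map_compose[OF \<epsilon> R.smult_right_linear[OF Km f]])
  have Qm: "module R (Q t)" unfolding Q_def by (rule R.power_quotient_module[OF I])
  obtain z where z0: "z 0 = \<zeta>" and z: "\<And>i. linear_map R (res_module R (Q t) i) (K i) (z i)"
    and \<delta>z: "\<And>i g. g \<in> carrier (res_module R (Q t) (Suc i)) \<Longrightarrow> ?d (z (Suc i) g) = z i (res_diff R (Q t) i g)"
  proof (rule lift_to_chain_map[where K = K and V = "\<lambda>i. W (\<kappa> i) i" and \<delta> = ?d, OF Qm \<delta> W _ _ \<zeta>])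
    show "\<exists>w\<in>W (\<kappa> 1) 1. ?d w = h" if h: "h \<in> W (\<kappa> 0) 0" for h
    proof -
      have "?d h T = \<zero>\<^bsub>M\<^esub>" for T
        by (rule koszul_diff_degree_0[OF ys]) (use WK[OF h] in \<open>auto simp: Kc len\<close>)
      hence "?d h = (\<lambda>_. \<zero>\<^bsub>M\<^esub>)" by blast
      thus ?thesis using \<kappa>[of 0] h unfolding E_def by simp
    qed
    show "\<exists>w\<in>W (\<kappa> (Suc (Suc i))) (Suc (Suc i)). ?d w = h"
      if "h \<in> W (\<kappa> (Suc i)) (Suc i)" "?d h = \<zero>\<^bsub>K i\<^esub>" for i h
      using \<kappa>[of "Suc i"] that unfolding E_def Kz by blast
    show "\<zeta> (res_diff R (Q t) 0 g) \<in> W (\<kappa> 0) 0" if g: "g \<in> carrier (res_module R (Q t) (Suc 0))" for g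
    proof -
      have "\<epsilon> (res_diff R (Q t) 0 g) \<in> ideal_power R ?I (\<kappa> 0)"
        using \<epsilon>I[OF g] R.ideal_power_antimono[OF I, of "\<kappa> 0" t] by (auto simp: t_def)
      thus ?thesis unfolding \<zeta>_def W_def by (intro module.smult_mem_ideal_times_module[OF Km] f)
    qed
  qed (use that in blast)+
  interpret T: complex_tower R "\<lambda>t. res_module R (Q t)" "\<lambda>t. res_diff R (Q t)"
      "\<lambda>t u. res_map R (Q u) (Q t) (power_projection R ?I t)"
    unfolding Q_def by (rule R.resolution_tower[OF I])
  have rR: "r i \<in> carrier R" for i using r[of i] by (simp add: annihilator_def)
  have fin: "finite (koszul_index (length ys) i)" for i by (rule finite_koszul_index)
  have "\<exists>u\<ge>t. \<forall>g \<in> carrier (res_module R (Q u) 0). \<exists>w \<in> carrier (K (Suc 0)).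
     (\<Otimes>i\<in>{..n}. r i) \<odot>\<^bsub>K 0\<^esub> z 0 (res_map R (Q u) (Q t) (power_projection R ?I t) 0 g) = ?d w"
  proof (rule T.descent[OF _ \<delta> _ _ z \<delta>z rR])
    show "1 \<le> t" by (simp add: t_def)
    show "?d (?d w) = \<zero>\<^bsub>K i\<^esub>" if "w \<in> carrier (K (Suc (Suc i)))" for i w
      using that koszul_diff_diff[OF ys, of w] by (auto simp: Kc Kz)
    show "carrier (K (Suc n)) = {\<zero>\<^bsub>K (Suc n)\<^esub>}" by (rule Ktop) simp
    show "T.kills_degree_0 (r 0) (K 0)"
      unfolding K_def koszul_module_def
      by (rule T.kills_degree_0_function_module[OF module_axioms fin rR])
        (unfold Q_def, rule R.annihilator_kills_degree_0[OF I module_axioms r])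
    show "T.kills_degree_Suc (r (Suc i)) i (K (Suc i))" for i
      unfolding K_def koszul_module_def
      by (rule T.kills_degree_Suc_function_module[OF module_axioms fin rR])
        (unfold Q_def, rule R.annihilator_kills_degree_Suc[OF I module_axioms r])
  qed
  then obtain u where u: "u \<ge> t" and all: "\<And>g. g \<in> carrier (res_module R (Q u) 0) \<Longrightarrow> \<exists>w \<in> carrier (K (Suc 0)).
     (\<Otimes>i\<in>{..n}. r i) \<odot>\<^bsub>K 0\<^esub> \<zeta> (res_map R (Q u) (Q t) (power_projection R ?I t) 0 g) = ?d w"
    unfolding z0 by blast
  let ?b = "Gen (ideal_power R ?I u +> \<one>)"
  have b: "?b \<in> res_basis R (Q u) 0" by (auto simp: Q_def R.power_quotient_carrier)
  have "free_unit R ?b \<in> carrier (res_module R (Q u) 0)"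
    unfolding res_module_def by (rule R.unit_carrier[OF b])
  from all[OF this] obtain w where w: "w \<in> carrier (K (Suc 0))" and
    eq: "(\<Otimes>i\<in>{..n}. r i) \<odot>\<^bsub>K 0\<^esub> \<zeta> (res_map R (Q u) (Q t) (power_projection R ?I t) 0 (free_unit R ?b)) = ?d w" by blast
  have "res_map R (Q u) (Q t) (power_projection R ?I t) 0 (free_unit R ?b) = free_unit R (Gen (ideal_power R ?I t +> \<one>))"
    using linear_map.rm_unit'[OF R.power_projection_linear[OF I u], of ?b 0] b
      R.power_proj[OF I u R.one_closed] unfolding Q_def by simp
  hence "(\<Otimes>i\<in>{..n}. r i) \<odot>\<^bsub>K 0\<^esub> f = ?d w"
    using eq \<epsilon>1 f module.smult_one[OF Km f] by (simp add: \<zeta>_def)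
  hence "(\<Otimes>i\<in>{..n}. r i) \<odot>\<^bsub>M\<^esub> m = ?d w (replicate (length ys) False)"
    using fun_cong[of "\<lambda>T. (\<Otimes>i\<in>{..n}. r i) \<odot>\<^bsub>M\<^esub> f T" "?d w" "replicate n False"]
    by (simp add: Ks len f_def)
  also have "\<dots> \<in> ideal_times_module R (ideal_power R ?I s) M"
  proof (rule koszul_diff_augmentation[OF ys _ ideal_times_module_submodule[OF ac]])
    show "w T \<in> carrier M" for T using w by (simp add: Kc)
    fix y v assume "y \<in> set ys" and v: "v \<in> carrier M"
    then obtain x where x: "x \<in> set xs" "y = x [^] s" by (auto simp: ys_def)
    hence "x \<in> ?I" using R.genideal_self[OF xs] by blast
    thus "y \<odot>\<^bsub>M\<^esub> v \<in> ideal_times_module R (ideal_power R ?I s) M"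
      unfolding x(2) by (intro smult_mem_ideal_times_module R.power_mem_ideal_power I v)
  qed
  finally show ?thesis by (simp add: n_def)
qed

theorem proposition1p2:
  fixes R :: "('a, 'r) ring_scheme" and \<mm> :: "'a set"
    and M :: "('a, 'b, 'm) module_scheme" and x :: "'a list" and n :: nat
  assumes "noetherian_local_ring R \<mm>"
    and "set x \<subseteq> carrier R" and "length x = n"
    and "module R M" and "finitely_generated_module R M"
  shows "annihilator R M [^]\<^bsub>ideals_set R\<^esub> (n + 1)
           \<subseteq> (\<Otimes>\<^bsub>ideals_set R\<^esub> i\<in>{0..n}. annihilator R (local_cohomology R (genideal R (set x)) i M)) \<and>
         (set x \<subseteq> \<mm> \<longrightarrow>
           (\<Otimes>\<^bsub>ideals_set R\<^esub> i\<in>{0..n}. annihilator R (local_cohomology R (genideal R (set x)) i M))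
           \<subseteq> annihilator R M)"
proof -
  interpret L: noetherian_local_ring R \<mm> by fact
  interpret M: module R M by fact
  let ?I = "genideal R (set x)"
  have I: "ideal ?I R" by (rule L.genideal_ideal[OF assms(2)])
  let ?J = "\<lambda>i. annihilator R (local_cohomology R ?I i M)"
  have J: "ideal (?J i) R" for i
    by (rule module.annihilator_ideal[OF L.local_cohomology_is_module[OF I assms(4)]])
  have 1: "annihilator R M [^]\<^bsub>ideals_set R\<^esub> (Suc n) \<subseteq> (\<Otimes>\<^bsub>ideals_set R\<^esub> i\<in>{..n}. ?J i)"
    by (rule L.ideal_power_finprod_mono[OF M.annihilator_ideal J])
      (rule L.annihilator_subset_annihilator_local_cohomology[OF I assms(4)])
  have 2: "(\<Otimes>\<^bsub>ideals_set R\<^esub> i\<in>{..n}. ?J i) \<subseteq> annihilator R M" if xm: "set x \<subseteq> \<mm>"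
  proof (rule L.ideal_finprod_subset[OF J M.annihilator_ideal])
    fix r assume r: "\<And>i. r i \<in> ?J i"
    define \<rho> where "\<rho> = (\<Otimes>\<^bsub>R\<^esub> i\<in>{..n}. r i)"
    have \<rho>: "\<rho> \<in> carrier R" unfolding \<rho>_def using ideal.Icarr[OF J r] by (auto intro: L.finprod_closed)
    have "\<rho> \<odot>\<^bsub>M\<^esub> m = \<zero>\<^bsub>M\<^esub>" if m: "m \<in> carrier M" for m
    proof (rule L.krull_intersection[OF assms(4) _ _ xm])
      show "noetherian_module R M"
        by (rule M.finitely_generated_imp_noetherian[OF L.noetherian_ring_axioms assms(5)])
      show "\<rho> \<odot>\<^bsub>M\<^esub> m \<in> ideal_times_module R (ideal_power R ?I s) M" for s
        using M.annihilator_product_smult[OF L.noetherian_ring_axioms assms(5,2) r m] assms(3)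
        by (simp add: \<rho>_def)
    qed (use m \<rho> in auto)
    thus "(\<Otimes>\<^bsub>R\<^esub> i\<in>{..n}. r i) \<in> annihilator R M"
      using \<rho> by (simp add: annihilator_def \<rho>_def)
  qed
  show ?thesis using 1 2 by (simp only: atLeast0AtMost Suc_eq_plus1) blast
qed

end
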